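(* Let $d=2$ and, for $\beta>\alpha>0$, let $f_1(r)=e^{-\pi\beta r}$ and $f_2(r)=e^{-\pi\alpha r}$. (i) For all $\beta>\alpha>0$ there exists $V_1=V_1(\alpha,\beta)$ such that for all $V>V_1$, $V^{1/2}\mathbb Z^2$ is not a minimizer of $E^\pm_{f_1,f_2}$ in $\mathcal Q(V)$, but a local maximizer. (ii) For all $\beta>0$ and $V>0$ there exists $\alpha_0=\alpha_0(\beta,V)>0$ such that, if $0<\alpha<\beta$ and $\alpha<\alpha_0$, then $V^{1/2}\mathbb Z^2$ is the unique minimizer (up to isometry) of $E^\pm_{f_1,f_2}$ in $\mathcal Q(V)$. (iii) For all $\beta>\alpha>0$ and $V>0$ there exists $\varepsilon_0=\varepsilon_0(\alpha,\beta,V)>0$ such that, if $\varepsilon\in[0,\varepsilon_0)$, then $V^{1/2}\mathbb Z^2$ is the unique minimizer (up to isometry) of $E^\pm_{f_1,\varepsilon f_2}$ in $\mathcal Q(V)$.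
   Context: $\mathcal Q(V)$ is the set of rectangular (orthorhombic) lattices in $\mathbb R^2$ of volume $V$, i.e. lattices $\mathbb Zu_1\oplus\mathbb Zu_2$ with $u_1\perp u_2$ and $|\det(u_1,u_2)|=V$. Up to isometry each such lattice is $V^{1/2}L_y$ with $L_y=\mathbb Z(y,0)\oplus\mathbb Z(0,y^{-1})$ for some $y>0$ ($y$ and $1/y$ give isometric lattices); the square lattice is $y=1$, and "local maximizer in $\mathcal Q(V)$" refers to a local maximum at $y=1$ of $y\mapsto E^\pm_{f_1,f_2}[V^{1/2}L_y]$ on $(0,\infty)$. For functions $g_1,g_2$ the alternating-charge energy is $$E^\pm_{g_1,g_2}[L]=\sum_{p\in L\setminus\{0\}}g_1(|p|^2)+\sum_{p\in L\setminus\{0\}}\varphi_\pm(p)g_2(|p|^2),$$ where, for $L=\mathbb Zu_1\oplus\mathbb Zu_2$ with orthogonal basis $u_1,u_2$, $\varphi_\pm(m_1u_1+m_2u_2)=(-1)^{m_1+m_2}$. *)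

theory Defs
  imports "HOL-Analysis.Analysis"
begin

definition lattice_of :: "real^2 \<Rightarrow> real^2 \<Rightarrow> (real^2) set" where
  "lattice_of u v = {of_int m *\<^sub>R u + of_int n *\<^sub>R v | m n :: int. True}"

definition orth_basis :: "(real^2) set \<Rightarrow> real^2 \<Rightarrow> real^2 \<Rightarrow> bool" where
  "orth_basis L u v \<longleftrightarrow> u \<noteq> 0 \<and> v \<noteq> 0 \<and> orthogonal u v \<and> L = lattice_of u v"

text \<open>The set \<open>\<Q>(V)\<close>; it is only meaningful for \<open>V > 0\<close>.\<close>

definition rect_lattices :: "real \<Rightarrow> (real^2) set set" where
  "rect_lattices V =
     {lattice_of u v | u v. orthogonal u v \<and> \<bar>det (vector [u, v] :: real^2^2)\<bar> = V}"

definition rect_lattice :: "real \<Rightarrow> (real^2) set" where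
  "rect_lattice y = lattice_of (vector [y, 0]) (vector [0, inverse y])"

definition square_lattice :: "(real^2) set" where
  "square_lattice = {p. \<forall>i. p $ i \<in> \<int>}"

definition scale_lattice :: "real \<Rightarrow> (real^2) set \<Rightarrow> (real^2) set" where
  "scale_lattice c L = (\<lambda>p. c *\<^sub>R p) ` L"

text \<open>The charge \<open>\<phi>\<^sub>\<plusminus>\<close>. It does not depend on the choice of the orthogonal basis, which is
  unique up to signs and order; see \<open>alt_charge_eq\<close> below.\<close>

definition alt_charge :: "(real^2) set \<Rightarrow> real^2 \<Rightarrow> real" where
  "alt_charge L p = (THE s. \<exists>u v. \<exists>m n :: int. orth_basis L u v \<and>
      p = of_int m *\<^sub>R u + of_int n *\<^sub>R v \<and> s = (-1) powi (m + n))"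

text \<open>Both series are meant as absolutely convergent ones (\<open>infsum\<close> is \<open>0\<close> otherwise), which
  they are for Gaussian \<open>g1\<close>, \<open>g2\<close>.\<close>

definition alt_energy :: "(real \<Rightarrow> real) \<Rightarrow> (real \<Rightarrow> real) \<Rightarrow> (real^2) set \<Rightarrow> real" where
  "alt_energy g1 g2 L =
     (\<Sum>\<^sub>\<infinity>p\<in>L - {0}. g1 ((norm p)\<^sup>2)) + (\<Sum>\<^sub>\<infinity>p\<in>L - {0}. alt_charge L p * g2 ((norm p)\<^sup>2))"

definition gauss :: "real \<Rightarrow> real \<Rightarrow> real" where
  "gauss a r = exp (- pi * a * r)"

definition isometric_lattices :: "(real^2) set \<Rightarrow> (real^2) set \<Rightarrow> bool" where
  "isometric_lattices L M \<longleftrightarrow> (\<exists>f. orthogonal_transformation f \<and> f ` L = M)"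

definition minimizer_in :: "((real^2) set \<Rightarrow> real) \<Rightarrow> (real^2) set set \<Rightarrow> (real^2) set \<Rightarrow> bool" where
  "minimizer_in E Q L \<longleftrightarrow> is_arg_min E (\<lambda>M. M \<in> Q) L"

definition unique_minimizer_in ::
    "((real^2) set \<Rightarrow> real) \<Rightarrow> (real^2) set set \<Rightarrow> (real^2) set \<Rightarrow> bool" where
  "unique_minimizer_in E Q L \<longleftrightarrow>
     minimizer_in E Q L \<and> (\<forall>M. minimizer_in E Q M \<longrightarrow> isometric_lattices M L)"

text \<open>The square lattice \<open>V\<^sup>1\<^sup>/\<^sup>2 \<int>\<^sup>2\<close>, which is the point \<open>y = 1\<close> of the family
  \<open>V\<^sup>1\<^sup>/\<^sup>2 L\<^sub>y\<close>, is a (not necessarily strict) local maximizer along this family.\<close>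

definition square_local_maximizer :: "((real^2) set \<Rightarrow> real) \<Rightarrow> real \<Rightarrow> bool" where
  "square_local_maximizer E V \<longleftrightarrow>
     (\<forall>\<^sub>F y in at 1 within {0<..}. E (scale_lattice (sqrt V) (rect_lattice y))
                                   \<le> E (scale_lattice (sqrt V) (rect_lattice 1)))"

lemma rect_lattice_1: "rect_lattice 1 = square_lattice"
proof -
  have "p \<in> rect_lattice 1" if "p \<in> square_lattice" for p
  proof -
    have "p $ 1 \<in> \<int>" "p $ 2 \<in> \<int>"
      using that unfolding square_lattice_def by auto
    then obtain m n where "p $ 1 = of_int m" "p $ 2 = of_int n"
      unfolding Ints_def by blast
    then have "p = of_int m *\<^sub>R vector [1, 0] + of_int n *\<^sub>R vector [0, 1]"
      by (simp add: vec_eq_iff forall_2)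
    then show ?thesis unfolding rect_lattice_def lattice_of_def by auto
  qed
  then show ?thesis
    by (auto simp: rect_lattice_def lattice_of_def square_lattice_def forall_2)
qed

lemma scale_lattice_of: "scale_lattice c (lattice_of u v) = lattice_of (c *\<^sub>R u) (c *\<^sub>R v)"
proof -
  have eq: "c *\<^sub>R (of_int m *\<^sub>R u + of_int n *\<^sub>R v) =
        of_int m *\<^sub>R (c *\<^sub>R u) + of_int n *\<^sub>R (c *\<^sub>R v)" for m n :: int
    by (simp add: scaleR_add_right mult.commute)
  show ?thesis unfolding scale_lattice_def lattice_of_def image_Collect eq[symmetric] by blast
qed

lemma scaled_rect_lattice_in:
  assumes "V > 0" "y > 0"
  shows "scale_lattice (sqrt V) (rect_lattice y) \<in> rect_lattices V"
proof -
  let ?u = "sqrt V *\<^sub>R vector [y, 0] :: real^2"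
  let ?v = "sqrt V *\<^sub>R vector [0, inverse y] :: real^2"
  have "orthogonal ?u ?v" by (simp add: orthogonal_def inner_vec_def sum_2)
  moreover have "\<bar>det (vector [?u, ?v] :: real^2^2)\<bar> = V"
  proof -
    have "det (vector [?u, ?v] :: real^2^2) = (sqrt V * sqrt V) * (y * inverse y)"
      by (simp add: det_2)
    then show ?thesis using assms by simp
  qed
  ultimately show ?thesis
    unfolding rect_lattice_def scale_lattice_of rect_lattices_def by blast
qed

lemma scaled_square_lattice_in:
  "V > 0 \<Longrightarrow> scale_lattice (sqrt V) square_lattice \<in> rect_lattices V"
  using scaled_rect_lattice_in[of V 1] by (simp add: rect_lattice_1)

lemma orth_coeffs_unique:
  fixes u v :: "real^2"
  assumes "u \<noteq> 0" "v \<noteq> 0" "orthogonal u v"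
    and "a *\<^sub>R u + b *\<^sub>R v = c *\<^sub>R u + d *\<^sub>R v"
  shows "a = c" "b = d"
proof -
  have uv: "u \<bullet> v = 0" "v \<bullet> u = 0" using assms(3) by (auto simp: orthogonal_def inner_commute)
  have "(a *\<^sub>R u + b *\<^sub>R v) \<bullet> u = (c *\<^sub>R u + d *\<^sub>R v) \<bullet> u" using assms(4) by simp
  then show "a = c" using assms(1) uv by (simp add: inner_add_left)
  have "(a *\<^sub>R u + b *\<^sub>R v) \<bullet> v = (c *\<^sub>R u + d *\<^sub>R v) \<bullet> v" using assms(4) by simp
  then show "b = d" using assms(2) uv by (simp add: inner_add_left)
qed

lemma basis_in_lattice_of: "u \<in> lattice_of u v" "v \<in> lattice_of u v"
proof -
  have "u = of_int 1 *\<^sub>R u + of_int 0 *\<^sub>R v" by simp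
  then show "u \<in> lattice_of u v" unfolding lattice_of_def mem_Collect_eq by blast
  have "v = of_int 0 *\<^sub>R u + of_int 1 *\<^sub>R v" by simp
  then show "v \<in> lattice_of u v" unfolding lattice_of_def mem_Collect_eq by blast
qed

lemma orth_basis_change:
  fixes u v u' v' :: "real^2" and m n m' n' :: int
  assumes B: "orth_basis L u v" and B': "orth_basis L u' v'"
    and p: "of_int m *\<^sub>R u + of_int n *\<^sub>R v = of_int m' *\<^sub>R u' + of_int n' *\<^sub>R v'"
  shows "even (m + n) \<longleftrightarrow> even (m' + n')"
proof -
  note b = B[unfolded orth_basis_def] and b' = B'[unfolded orth_basis_def]
  have uv: "u \<noteq> 0" "v \<noteq> 0" "orthogonal u v" using b by auto
  note q = orth_coeffs_unique[OF uv]
  have L: "lattice_of u v = lattice_of u' v'" using b b' by metis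
  have mem: "u' \<in> lattice_of u v" "v' \<in> lattice_of u v" "u \<in> lattice_of u' v'" "v \<in> lattice_of u' v'"
    using basis_in_lattice_of[where u=u and v=v] basis_in_lattice_of[where u=u' and v=v'] unfolding L by simp_all
  obtain a c where u': "u' = of_int a *\<^sub>R u + of_int c *\<^sub>R v"
    using mem(1) unfolding lattice_of_def by blast
  obtain d e where v': "v' = of_int d *\<^sub>R u + of_int e *\<^sub>R v"
    using mem(2) unfolding lattice_of_def by blast
  obtain s t where u: "u = of_int s *\<^sub>R u' + of_int t *\<^sub>R v'"
    using mem(3) unfolding lattice_of_def by blast
  obtain w z where v: "v = of_int w *\<^sub>R u' + of_int z *\<^sub>R v'"
    using mem(4) unfolding lattice_of_def by blast
  have "of_int 1 *\<^sub>R u + of_int 0 *\<^sub>R v = of_int (s*a+t*d) *\<^sub>R u + of_int (s*c+t*e) *\<^sub>R v"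
  proof -
    have "of_int (s*a+t*d) *\<^sub>R u + of_int (s*c+t*e) *\<^sub>R v = of_int s *\<^sub>R u' + of_int t *\<^sub>R v'"
      unfolding u' v' by (simp add: algebra_simps)
    then show ?thesis unfolding u[symmetric] by simp
  qed
  note 1 = q[OF this, unfolded of_int_eq_iff]
  have "of_int 0 *\<^sub>R u + of_int 1 *\<^sub>R v = of_int (w*a+z*d) *\<^sub>R u + of_int (w*c+z*e) *\<^sub>R v"
  proof -
    have "of_int (w*a+z*d) *\<^sub>R u + of_int (w*c+z*e) *\<^sub>R v = of_int w *\<^sub>R u' + of_int z *\<^sub>R v'"
      unfolding u' v' by (simp add: algebra_simps)
    then show ?thesis unfolding v[symmetric] by simp
  qed
  note 2 = q[OF this, unfolded of_int_eq_iff]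
  have "of_int m *\<^sub>R u + of_int n *\<^sub>R v = of_int (m'*a+n'*d) *\<^sub>R u + of_int (m'*c+n'*e) *\<^sub>R v"
  proof -
    have "of_int (m'*a+n'*d) *\<^sub>R u + of_int (m'*c+n'*e) *\<^sub>R v = of_int m' *\<^sub>R u' + of_int n' *\<^sub>R v'"
      unfolding u' v' by (simp add: algebra_simps)
    then show ?thesis using p by (simp only:)
  qed
  note mn = q[OF this, unfolded of_int_eq_iff]
  have "(s*z-t*w) * (a*e-c*d) = (s*a+t*d)*(w*c+z*e) - (s*c+t*e)*(w*a+z*d)"
    by (simp add: algebra_simps)
  then have "(s*z-t*w) * (a*e-c*d) = 1"
    unfolding 1[symmetric] 2[symmetric] by simp
  then have det: "a*e-c*d = 1 \<or> a*e-c*d = -1" by (metis zmult_eq_1_iff mult.commute)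
  have "u' \<bullet> v' = 0" "u \<bullet> v = 0" using b b' by (auto simp: orthogonal_def)
  then have orth: "of_int (a*d) * (u \<bullet> u) + of_int (c*e) * (v \<bullet> v) = 0"
    unfolding u' v' by (simp add: inner_add_left inner_add_right inner_commute algebra_simps)
  have pos: "u \<bullet> u > 0" "v \<bullet> v > 0" using b by auto
  have "(a*d) * (c*e) \<le> 0"
  proof (rule ccontr)
    assume "\<not> ?thesis"
    then consider "a*d > 0" "c*e > 0" | "a*d < 0" "c*e < 0"
      using zero_less_mult_iff[of "a*d" "c*e"] by linarith
    then show False
    proof cases
      case 1
      then have "real_of_int (a*d) * (u \<bullet> u) > 0" "real_of_int (c*e) * (v \<bullet> v) > 0"
        using pos by (intro mult_pos_pos; linarith)+
      then show False using orth by linarith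
    next
      case 2
      then have "real_of_int (a*d) * (u \<bullet> u) < 0" "real_of_int (c*e) * (v \<bullet> v) < 0"
        using pos by (intro mult_neg_pos; linarith)+
      then show False using orth by linarith
    qed
  qed
  then have le: "(a*e) * (c*d) \<le> 0" by (simp add: mult_ac)
  have "a*e = 0 \<or> c*d = 0"
  proof (rule ccontr)
    assume n: "\<not> ?thesis"
    with le have "a*e > 0 \<and> c*d < 0 \<or> a*e < 0 \<and> c*d > 0"
      using mult_le_0_iff[of "a*e" "c*d"] by linarith
    with det show False by linarith
  qed
  moreover have iff: "a*d = 0 \<longleftrightarrow> c*e = 0"
  proof
    assume h: "a*d = 0"
    have "real_of_int (c*e) * (v \<bullet> v) = 0"
      using orth unfolding h by (simp only: of_int_0 mult_zero_left add_0)
    then show "c*e = 0" using pos(2) by (metis less_irrefl mult_eq_0_iff of_int_eq_0_iff)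
  next
    assume h: "c*e = 0"
    have "real_of_int (a*d) * (u \<bullet> u) = 0"
      using orth unfolding h by (simp only: of_int_0 mult_zero_left add_0_right)
    then show "a*d = 0" using pos(1) by (metis less_irrefl mult_eq_0_iff of_int_eq_0_iff)
  qed
  ultimately have "odd (a + c) \<and> odd (d + e)"
  proof (elim disjE)
    assume z: "a*e = 0"
    then have "c*d = 1 \<or> c*d = -1" using det by linarith
    then have "odd (c*d)"
      by (elim disjE) (simp_all only: even_minus odd_one not_False_eq_True)
    then have o: "odd c" "odd d" unfolding even_mult_iff by auto
    then have "c \<noteq> 0" "d \<noteq> 0" by fastforce+
    then have "a = 0 \<and> e = 0" using z iff by (simp only: mult_eq_0_iff) blast
    then show ?thesis using o by simp
  next
    assume z: "c*d = 0"
    then have "a*e = 1 \<or> a*e = -1" using det by linarith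
    then have "odd (a*e)"
      by (elim disjE) (simp_all only: even_minus odd_one not_False_eq_True)
    then have o: "odd a" "odd e" unfolding even_mult_iff by auto
    then have "a \<noteq> 0" "e \<noteq> 0" by fastforce+
    then have "c = 0 \<and> d = 0" using z iff by (simp only: mult_eq_0_iff) blast
    then show ?thesis using o by simp
  qed
  then have o: "\<not> even (a + c)" "\<not> even (d + e)" by blast+
  have "m + n = m' * (a + c) + n' * (d + e)"
    unfolding mn distrib_left by (simp only: ac_simps)
  then have "even (m + n) \<longleftrightarrow> even (m' * (a + c) + n' * (d + e))" by (rule arg_cong)
  also have "\<dots> \<longleftrightarrow> even (m' + n')"
    unfolding even_add[of "m' * (a + c)" "n' * (d + e)"] even_add[of m' n'] even_mult_iff
    using o by blast
  finally show ?thesis .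
qed

lemma alt_charge_eq:
  assumes "orth_basis L u v"
  shows "alt_charge L (of_int m *\<^sub>R u + of_int n *\<^sub>R v) = (-1) powi (m + n)"
proof -
  have sign: "(-1) powi k = ((-1::real) powi l)" if "even k \<longleftrightarrow> even l" for k l :: int
    using that by (simp add: power_int_minus_left)
  show ?thesis unfolding alt_charge_def
  proof (rule the_equality)
    fix x :: real
    assume "\<exists>u' v'. \<exists>m' n' :: int. orth_basis L u' v' \<and>
      of_int m *\<^sub>R u + of_int n *\<^sub>R v = of_int m' *\<^sub>R u' + of_int n' *\<^sub>R v' \<and>
      x = (-1) powi (m' + n')"
    then obtain u' v' m' n' where x: "orth_basis L u' v'"
      "of_int m *\<^sub>R u + of_int n *\<^sub>R v = of_int m' *\<^sub>R u' + of_int n' *\<^sub>R v'"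
      "x = (-1) powi (m' + n')" by (elim exE conjE)
    show "x = (-1) powi (m + n)"
      unfolding x(3) using orth_basis_change[OF assms x(1,2)] by (intro sign) (rule sym)
  qed (intro exI conjI, rule assms, rule refl, rule refl)
qed

end

theory Submission
  imports Defs "HOL-Real_Asymp.Real_Asymp"
begin

text \<open>
  Put \<open>t = y\<^sup>2\<close>, \<open>p = \<pi>\<beta>V\<close> and \<open>q = \<pi>\<alpha>V\<close>. The energy is, up to constants,
  \<open>\<theta>\<^sub>3(pt) \<theta>\<^sub>3(p/t) + \<epsilon> \<theta>\<^sub>4(qt) \<theta>\<^sub>4(q/t)\<close>, which is invariant under \<open>t \<mapsto> 1/t\<close>, so \<open>t \<ge> 1\<close> may be
  assumed. The first product exceeds its value at \<open>t = 1\<close> by at least \<open>c min(1, (t - 1)\<^sup>2/t)\<close>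
  with \<open>c > 0\<close>: Poisson summation reduces this to \<open>p \<ge> 3\<close>, where the shortest vectors dominate.
  Poisson summation turns the second product into a positive sum over a shifted lattice, and
  averaging over exchange of the two coordinates shows that it drops by at most
  \<open>D(q) min(1, (t - 1)\<^sup>2/t)\<close>, where \<open>D(q) \<rightarrow> 0\<close> as \<open>q \<rightarrow> 0\<close>. Comparing \<open>c\<close> with \<open>\<epsilon> D(q)\<close> gives (ii) and
  (iii). For (i), near \<open>t = 1\<close> and for large \<open>V\<close> the four shortest vectors of negative charge contribute
  a decrease of order \<open>q\<^sup>2 e\<^sup>-\<^sup>q (t - 1)\<^sup>2\<close>, which beats all other second-order terms because \<open>q < p\<close>.
\<close>

section \<open>Polya's finite Poisson summation\<close>

text \<open>The profile \<open>min 1 ((t - 1)\<^sup>2 / t)\<close> has to serve both products. Near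
  \<open>t = 1\<close> each of them varies only to second order; for large \<open>t\<close> the drop
  of the alternating product saturates, because its dual is nonnegative, so a constant gap is enough
  there. The reduction to \<open>p \<ge> 3\<close> works since duality exchanges \<open>p\<close>
  and \<open>pi\<^sup>2 / p\<close>, and \<open>pi\<^sup>2 > 9\<close> makes one of the two at least
  3. For the alternating product, duality trades the signs for a shift by 1/2. Half-integers stay
  away from 0, so the dual sum is exponentially small in 1/q, which beats the prefactor
  \<open>pi / q\<close> and forces D(q) to 0. In (i) q is large and the direct series is the right
  one. The obstacle is that letting t range up to \<open>1 + \<eta>\<close> weakens the Gaussian
  factor of the full product from exp(-p) to exp(-p(1 - \<eta>)); \<eta>, depending on \<alpha> /
  \<beta> only, is so small that this is still negligible against exp(-q). The maximum obtained is
  strict, hence some nearby lattice has smaller energy and the square is no minimizer.\<close>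

lemma tendsto_infsum_dominated:
  fixes f :: "nat \<Rightarrow> 'a \<Rightarrow> real"
  assumes lim: "\<And>x. x \<in> A \<Longrightarrow> (\<lambda>n. f n x) \<longlonglongrightarrow> g x"
    and bound: "\<forall>\<^sub>F n in sequentially. \<forall>x\<in>A. \<bar>f n x\<bar> \<le> w x"
    and w: "w summable_on A"
  shows "(\<lambda>n. infsum (f n) A) \<longlonglongrightarrow> infsum g A"
proof -
  obtain N where N: "\<And>n x. n \<ge> N \<Longrightarrow> x \<in> A \<Longrightarrow> \<bar>f n x\<bar> \<le> w x"
    using bound unfolding eventually_sequentially by blast
  have gb: "\<bar>g x\<bar> \<le> w x" if "x \<in> A" for x
    by (rule tendsto_upperbound[OF tendsto_rabs[OF lim[OF that]]])
      (use N that in \<open>auto simp: eventually_sequentially\<close>)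
  \<comment> \<open>For absolutely summable families \<open>infsum\<close> is the Lebesgue integral
    over counting measure, which makes dominated convergence available; the majorant
    \<open>w\<close> supplies the absolute summability.\<close>
  have conv: "infsum h A = integral\<^sup>L (count_space A) h" "integrable (count_space A) h"
    if "\<And>x. x \<in> A \<Longrightarrow> \<bar>h x\<bar> \<le> w x" for h
  proof -
    have "(\<lambda>x. norm (h x)) summable_on A"
      using w that by (intro Infinite_Sum.abs_summable_on_comparison_test') auto
    then have "Infinite_Set_Sum.abs_summable_on h A"
      by (rule abs_summable_equivalent[THEN iffD1])
    then show "infsum h A = integral\<^sup>L (count_space A) h" "integrable (count_space A) h"
      by (simp_all add: infsetsum_infsum[symmetric] infsetsum_def Infinite_Set_Sum.abs_summable_on_def)
  qed
  have wnn: "\<bar>w x\<bar> \<le> w x" if "x \<in> A" for x using gb[OF that] by simp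
  \<comment> \<open>Shifting by \<open>N\<close> turns the eventual domination into one valid for
    every index.\<close>
  have "(\<lambda>n. integral\<^sup>L (count_space A) (f (n + N))) \<longlonglongrightarrow> integral\<^sup>L (count_space A) g"
  proof (rule integral_dominated_convergence)
    show "integrable (count_space A) w" by (rule conv) (rule wnn)
    show "AE x in count_space A. (\<lambda>i. f (i + N) x) \<longlonglongrightarrow> g x"
      using lim by (auto simp: AE_count_space intro!: LIMSEQ_ignore_initial_segment)
    show "AE x in count_space A. norm (f (i + N) x) \<le> w x" for i
      using N by (auto simp: AE_count_space)
  qed auto
  then have "(\<lambda>n. infsum (f (n + N)) A) \<longlonglongrightarrow> infsum g A"
    using N gb by (subst (1 2) conv(1)) auto
  then show ?thesis by (rule LIMSEQ_offset)
qed

lemma exp_abs_int_summable: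
  fixes q :: real assumes "q > 0"
  shows "(\<lambda>n::int. exp (- q * \<bar>of_int n\<bar>)) summable_on UNIV"
proof -
  let ?f = "\<lambda>n::int. exp (- q * \<bar>of_int n\<bar>)"
  have "summable (\<lambda>n::nat. exp (- q) ^ n)" using assms by (intro summable_geometric) simp
  then have nat: "(\<lambda>n::nat. exp (- q * real n)) summable_on UNIV"
    by (subst summable_on_UNIV_nonneg_real_iff) (simp_all add: exp_of_nat_mult[symmetric] mult.commute)
  have "?f summable_on range int"
    using nat by (subst summable_on_reindex) (auto simp: o_def)
  moreover have "?f summable_on range (\<lambda>n. - int n)"
    using nat by (subst summable_on_reindex) (auto simp: o_def inj_on_def)
  moreover have "range int \<union> range (\<lambda>n. - int n) = UNIV"
  proof -
    have "n \<in> range int \<union> range (\<lambda>n. - int n)" for n by (cases n rule: int_cases2) auto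
    then show ?thesis by blast
  qed
  ultimately show ?thesis by (metis summable_on_union)
qed

lemma gauss_int_summable:
  fixes q c :: real assumes "q > 0"
  shows "(\<lambda>n::int. exp (- q * (of_int n + c)\<^sup>2)) summable_on UNIV"
proof (rule summable_on_comparison_test)
  show "(\<lambda>n::int. exp (q * (\<bar>c\<bar> + 1)) * exp (- q * \<bar>of_int n\<bar>)) summable_on UNIV"
    by (intro summable_on_cmult_right exp_abs_int_summable assms)
  fix n :: int
  have "(of_int n + c)\<^sup>2 = \<bar>of_int n + c\<bar>\<^sup>2" by simp
  also have "\<dots> \<ge> \<bar>of_int n + c\<bar> - 1"
    using zero_le_power2[of "\<bar>of_int n + c\<bar> - 1/2"] by (simp add: power2_eq_square algebra_simps)
  finally have "(of_int n + c)\<^sup>2 \<ge> \<bar>of_int n\<bar> - (\<bar>c\<bar> + 1)" by linarith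
  then have "q * (of_int n + c)\<^sup>2 \<ge> q * (\<bar>of_int n\<bar> - (\<bar>c\<bar> + 1))"
    using assms by (intro mult_left_mono) auto
  then show "exp (- q * (of_int n + c)\<^sup>2) \<le> exp (q * (\<bar>c\<bar> + 1)) * exp (- q * \<bar>of_int n\<bar>)"
    by (simp add: exp_add[symmetric] algebra_simps)
qed simp

text \<open>Binomial expansion of \<open>(cis x + cis (- x)) ^ (2*m)\<close>, with the index
  measured from the centre m so that it becomes the frequency.\<close>

lemma cos_power_even_expand:
  fixes x :: real
  shows "(4 * (cos x)\<^sup>2) ^ m = (\<Sum>j\<le>2*m. real (2*m choose j) * cos (2 * of_int (int j - int m) * x))"
proof -
  have "of_real ((4 * (cos x)\<^sup>2) ^ m) = (cis x + cis (- x)) ^ (2*m)"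
  proof -
    have "cis x + cis (- x) = of_real (2 * cos x)" by (simp add: complex_eq_iff)
    then show ?thesis by (simp add: power_mult power_mult_distrib)
  qed
  also have "\<dots> = (\<Sum>j\<le>2*m. of_nat (2*m choose j) * cis x ^ j * cis (- x) ^ (2*m - j))"
    by (rule binomial_ring)
  also have "\<dots> = (\<Sum>j\<le>2*m. of_nat (2*m choose j) * cis (2 * of_int (int j - int m) * x))"
  proof (rule sum.cong[OF refl])
    fix j assume j: "j \<in> {..2*m}"
    have "cis x ^ j * cis (- x) ^ (2*m - j) = cis (real j * x + real (2*m - j) * (- x))"
      by (simp only: Complex.DeMoivre cis_mult)
    also have "real j * x + real (2*m - j) * (- x) = 2 * of_int (int j - int m) * x"
      using j by (simp add: of_nat_diff algebra_simps)
    finally show "of_nat (2*m choose j) * cis x ^ j * cis (- x) ^ (2*m - j) =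
      of_nat (2*m choose j) * cis (2 * of_int (int j - int m) * x)" by (simp add: mult.assoc)
  qed
  finally have "Re (of_real ((4 * (cos x)\<^sup>2) ^ m)) =
      Re (\<Sum>j\<le>2*m. of_nat (2*m choose j) * cis (2 * of_int (int j - int m) * x))" by (rule arg_cong)
  then show ?thesis by (simp only: Re_complex_of_real Re_sum) simp
qed

text \<open>Sampling at 2h equidistant points gives a geometric sum over powers of a 2h-th root of
  unity, which vanishes unless that root is 1. The offset c survives as a phase; this is the source
  of the cosine on the dual side of Poisson summation.\<close>

lemma sum_cos_roots_of_unity:
  fixes c :: real and d :: int
  assumes "h > 0"
  shows "(\<Sum>k\<in>{-int h..<int h}. cos (2 * of_int d * (pi * (of_int k + c) / (2 * real h)))) =
    (if 2 * int h dvd d then 2 * real h * cos (2 * pi * c * of_int (d div (2 * int h))) else 0)"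
proof -
  let ?z = "cis (2 * pi * of_int d / (2 * real h))"
  \<comment> \<open>The phase of the first sample, \<open>k = - int h\<close>.\<close>
  let ?w = "cis (2 * pi * of_int d * (c - real h) / (2 * real h))"
  have "(\<Sum>k\<in>{-int h..<int h}. cis (2 * of_int d * (pi * (of_int k + c) / (2 * real h)))) =
        (\<Sum>i<2*h. ?w * ?z ^ i)"
  proof (rule sum.reindex_bij_witness[where i = "\<lambda>i. int i - int h" and j = "\<lambda>k. nat (k + int h)"])
    fix k assume k: "k \<in> {-int h..<int h}"
    have r: "real (nat (k + int h)) = of_int k + real h" using k by simp
    have "?w * ?z ^ nat (k + int h) =
      cis (2 * pi * of_int d * (c - real h) / (2 * real h) + (of_int k + real h) * (2 * pi * of_int d / (2 * real h)))"
      by (simp only: Complex.DeMoivre cis_mult r)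
    also have "2 * pi * of_int d * (c - real h) / (2 * real h) + (of_int k + real h) * (2 * pi * of_int d / (2 * real h))
      = 2 * of_int d * (pi * (of_int k + c) / (2 * real h))"
      using assms by (simp add: field_simps)
    finally show "?w * ?z ^ nat (k + int h) = cis (2 * of_int d * (pi * (of_int k + c) / (2 * real h)))" .
  qed auto
  also have "\<dots> = ?w * (\<Sum>i<2*h. ?z ^ i)" by (simp add: sum_distrib_left)
  finally have eq: "(\<Sum>k\<in>{-int h..<int h}. cis (2 * of_int d * (pi * (of_int k + c) / (2 * real h)))) =
      ?w * (\<Sum>i<2*h. ?z ^ i)" .
  have Re: "(\<Sum>k\<in>{-int h..<int h}. cos (2 * of_int d * (pi * (of_int k + c) / (2 * real h)))) =
      Re (?w * (\<Sum>i<2*h. ?z ^ i))"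
    unfolding eq[symmetric] by (simp only: Re_sum cis.simps)
  show ?thesis
  proof (cases "2 * int h dvd d")
    case True
    then obtain e where e: "d = 2 * int h * e" by (elim dvdE)
    have 1: "2 * pi * of_int d / (2 * real h) = 2 * pi * of_int e"
      using assms by (simp add: e)
    have 2: "2 * pi * of_int d * (c - real h) / (2 * real h) = 2 * pi * c * of_int e - 2 * pi * of_int (e * int h)"
      using assms by (simp add: e field_simps)
    have z: "?z = 1" unfolding 1 by (rule cis_multiple_2pi) auto
    have w: "?w = cis (2 * pi * c * of_int e)"
      unfolding 2 cis_divide[symmetric] by (simp only: cis_multiple_2pi[OF Ints_of_int] div_by_1)
    have "d div (2 * int h) = e" using assms by (simp add: e)
    then show ?thesis unfolding Re z w using True by simp
  next
    case False
    have "?z \<noteq> 1"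
    proof
      assume "?z = 1"
      then have "cos (2 * pi * of_int d / (2 * real h)) = 1" by (simp add: complex_eq_iff)
      then obtain n :: int where "2 * pi * of_int d / (2 * real h) = of_int n * 2 * pi"
        unfolding cos_one_2pi_int by blast
      then have "real_of_int d = of_int (2 * int h * n)" using assms by (simp add: field_simps)
      then have "d = 2 * int h * n" unfolding of_int_eq_iff .
      with False show False by simp
    qed
    moreover have "?z ^ (2*h) = 1"
    proof -
      have "real (2*h) * (2 * pi * of_int d / (2 * real h)) = 2 * pi * of_int d" using assms by simp
      then show ?thesis unfolding Complex.DeMoivre by (simp only: cis_multiple_2pi[OF Ints_of_int])
    qed
    ultimately have "(\<Sum>i<2*h. ?z ^ i) = 0" by (simp add: geometric_sum)
    then show ?thesis unfolding Re using False by simp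
  qed
qed

text \<open>A discrete Gaussian in k, normalized to 1 at the centre. The value 0 outside the range
  lets finite binomial sums be written over all integers, where dominated convergence
  applies.\<close>

definition binom_ratio :: "nat \<Rightarrow> int \<Rightarrow> real" where
  "binom_ratio m k = (if \<bar>k\<bar> \<le> int m then real (2*m choose nat (int m + k)) / real (2*m choose m) else 0)"

lemma binom_ratio_minus: "binom_ratio m (- k) = binom_ratio m k"
proof (cases "\<bar>k\<bar> \<le> int m")
  case True
  have "2*m choose nat (int m - k) = 2*m choose (2*m - nat (int m - k))"
    using True by (intro binomial_symmetric) linarith
  also have "2*m - nat (int m - k) = nat (int m + k)" using True by linarith
  finally show ?thesis using True by (simp add: binom_ratio_def)
qed (simp add: binom_ratio_def)

text \<open>A finite form of Poisson summation: after expanding the cosine powers and exchanging the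
  sums, averaging over the samples keeps only the binomial indices
  \<open>j = m + 2 * h * \<nu>\<close>.\<close>

lemma polya_identity:
  fixes c :: real
  assumes "h > 0"
  shows "(\<Sum>k\<in>{-int h..<int h}. ((cos (pi * (of_int k + c) / (2 * real h)))\<^sup>2) ^ m) =
    2 * real h * real (2*m choose m) / 4 ^ m *
      (\<Sum>\<^sub>\<infinity>\<nu>\<in>UNIV. binom_ratio m (2 * int h * \<nu>) * cos (2 * pi * c * of_int \<nu>))"
proof -
  let ?x = "\<lambda>k::int. pi * (of_int k + c) / (2 * real h)"
  let ?l = "2 * int h"
  have l0: "?l > 0" using assms by simp
  have "(\<Sum>k\<in>{-int h..<int h}. (4 * (cos (?x k))\<^sup>2) ^ m) =
    (\<Sum>j\<le>2*m. real (2*m choose j) * (\<Sum>k\<in>{-int h..<int h}. cos (2 * of_int (int j - int m) * ?x k)))"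
    unfolding cos_power_even_expand sum_distrib_left by (rule sum.swap)
  also have "\<dots> = (\<Sum>j\<le>2*m. if ?l dvd int j - int m then real (2*m choose j) *
      (2 * real h * cos (2 * pi * c * of_int ((int j - int m) div ?l))) else 0)"
    unfolding sum_cos_roots_of_unity[OF assms] by (intro sum.cong) auto
  also have "\<dots> = (\<Sum>j | j \<le> 2*m \<and> ?l dvd int j - int m. real (2*m choose j) *
      (2 * real h * cos (2 * pi * c * of_int ((int j - int m) div ?l))))"
    by (subst sum.inter_filter[symmetric]) auto
  also have "\<dots> = (\<Sum>\<nu> | \<bar>?l * \<nu>\<bar> \<le> int m. real (2*m choose nat (int m + ?l * \<nu>)) *
      (2 * real h * cos (2 * pi * c * of_int \<nu>)))"
  proof (rule sum.reindex_bij_witness[where i = "\<lambda>\<nu>. nat (int m + ?l * \<nu>)"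
        and j = "\<lambda>j. (int j - int m) div ?l"])
    fix j assume "j \<in> {j. j \<le> 2*m \<and> ?l dvd int j - int m}"
    then have j: "j \<le> 2*m" "?l * ((int j - int m) div ?l) = int j - int m" by auto
    show "nat (int m + ?l * ((int j - int m) div ?l)) = j" unfolding j(2) by simp
    show "(int j - int m) div ?l \<in> {\<nu>. \<bar>?l * \<nu>\<bar> \<le> int m}" unfolding mem_Collect_eq j(2) using j(1) by linarith
    show "real (2*m choose nat (int m + ?l * ((int j - int m) div ?l))) * (2 * real h * cos (2 * pi * c * of_int ((int j - int m) div ?l)))
      = real (2*m choose j) * (2 * real h * cos (2 * pi * c * of_int ((int j - int m) div ?l)))"
      unfolding j(2) by simp
  next
    fix \<nu> assume "\<nu> \<in> {\<nu>. \<bar>?l * \<nu>\<bar> \<le> int m}"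
    then have \<nu>: "int (nat (int m + ?l * \<nu>)) = int m + ?l * \<nu>" "\<bar>?l * \<nu>\<bar> \<le> int m" by auto
    show "(int (nat (int m + ?l * \<nu>)) - int m) div ?l = \<nu>" unfolding \<nu>(1) using assms by simp
    have "?l dvd int (nat (int m + ?l * \<nu>)) - int m" unfolding \<nu>(1) by simp
    moreover have "nat (int m + ?l * \<nu>) \<le> 2 * m" using \<nu>(2) by linarith
    ultimately show "nat (int m + ?l * \<nu>) \<in> {j. j \<le> 2*m \<and> ?l dvd int j - int m}" by blast
  qed
  also have "\<dots> = (\<Sum>\<nu> | \<bar>?l * \<nu>\<bar> \<le> int m. 2 * real h * real (2*m choose m) *
       (binom_ratio m (?l * \<nu>) * cos (2 * pi * c * of_int \<nu>)))"
    by (intro sum.cong) (auto simp: binom_ratio_def)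
  also have "\<dots> = 2 * real h * real (2*m choose m) * (\<Sum>\<nu> | \<bar>?l * \<nu>\<bar> \<le> int m.
       binom_ratio m (?l * \<nu>) * cos (2 * pi * c * of_int \<nu>))"
    by (simp only: sum_distrib_left)
  also have "(\<Sum>\<nu> | \<bar>?l * \<nu>\<bar> \<le> int m. binom_ratio m (?l * \<nu>) * cos (2 * pi * c * of_int \<nu>)) =
     (\<Sum>\<^sub>\<infinity>\<nu>\<in>UNIV. binom_ratio m (?l * \<nu>) * cos (2 * pi * c * of_int \<nu>))"
  proof -
    have "finite {\<nu>. \<bar>?l * \<nu>\<bar> \<le> int m}"
    proof (rule finite_subset)
      show "{\<nu>. \<bar>?l * \<nu>\<bar> \<le> int m} \<subseteq> {- int m..int m}"
      proof
        fix \<nu> assume "\<nu> \<in> {\<nu>. \<bar>?l * \<nu>\<bar> \<le> int m}"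
        moreover have "1 * \<bar>\<nu>\<bar> \<le> \<bar>?l\<bar> * \<bar>\<nu>\<bar>" using l0 by (intro mult_right_mono) auto
        ultimately have "\<bar>\<nu>\<bar> \<le> int m" unfolding mem_Collect_eq abs_mult by linarith
        then show "\<nu> \<in> {- int m..int m}" by auto
      qed
    qed simp
    then have "(\<Sum>\<nu> | \<bar>?l * \<nu>\<bar> \<le> int m. binom_ratio m (?l * \<nu>) * cos (2 * pi * c * of_int \<nu>)) =
       (\<Sum>\<^sub>\<infinity>\<nu>\<in>{\<nu>. \<bar>?l * \<nu>\<bar> \<le> int m}. binom_ratio m (?l * \<nu>) * cos (2 * pi * c * of_int \<nu>))"
      by simp
    also have "\<dots> = (\<Sum>\<^sub>\<infinity>\<nu>\<in>UNIV. binom_ratio m (?l * \<nu>) * cos (2 * pi * c * of_int \<nu>))"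
      by (rule infsum_cong_neutral) (auto simp: binom_ratio_def)
    finally show ?thesis .
  qed
  finally have eq: "4 ^ m * (\<Sum>k\<in>{-int h..<int h}. ((cos (?x k))\<^sup>2) ^ m) =
    2 * real h * real (2*m choose m) *
      (\<Sum>\<^sub>\<infinity>\<nu>\<in>UNIV. binom_ratio m (?l * \<nu>) * cos (2 * pi * c * of_int \<nu>))"
    by (simp only: power_mult_distrib sum_distrib_left)
  have "X = K / 4 ^ m * Y" if "4 ^ m * X = K * Y" for X K Y :: real
    using that by (simp add: field_simps)
  from this[OF eq] show ?thesis .
qed

section \<open>Poisson summation for Gaussians\<close>

text \<open>The lower bound is the inverse of
  \<open>1 / (1 - y) = 1 + y / (1 - y) \<le> exp (y / (1 - y))\<close>. Both exponents agree to
  first order in y, so products of factors \<open>1 - y\<close> can be squeezed between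
  exponentials.\<close>

lemma one_minus_exp_bounds:
  fixes y :: real
  assumes "0 \<le> y" "y < 1"
  shows "exp (- (y / (1 - y))) \<le> 1 - y" "1 - y \<le> exp (- y)"
proof -
  have "inverse (exp (y / (1 - y))) \<le> inverse (1 + y / (1 - y))"
    using assms by (intro le_imp_inverse_le exp_ge_add_one_self) (auto intro: add_pos_nonneg)
  also have "\<dots> = 1 - y" using assms by (simp add: field_simps)
  finally show "exp (- (y / (1 - y))) \<le> 1 - y" by (simp add: exp_minus)
  show "1 - y \<le> exp (- y)" using exp_ge_add_one_self[of "-y"] by simp
qed

lemma one_minus_power_tendsto:
  fixes y :: "nat \<Rightarrow> real" and m :: "nat \<Rightarrow> nat"
  assumes y: "y \<longlonglongrightarrow> 0" "\<And>n. 0 \<le> y n" and my: "(\<lambda>n. real (m n) * y n) \<longlonglongrightarrow> L"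
  shows "(\<lambda>n. (1 - y n) ^ m n) \<longlonglongrightarrow> exp (- L)"
proof (rule tendsto_sandwich)
  have ev: "\<forall>\<^sub>F n in sequentially. y n < 1" using order_tendstoD(2)[OF y(1), of 1] by simp
  show "\<forall>\<^sub>F n in sequentially. exp (- (real (m n) * y n / (1 - y n))) \<le> (1 - y n) ^ m n"
    using ev
  proof eventually_elim
    case (elim n)
    have "exp (- (y n / (1 - y n))) ^ m n \<le> (1 - y n) ^ m n"
      using one_minus_exp_bounds(1)[OF y(2) elim] by (intro power_mono) auto
    then show ?case by (simp add: exp_of_nat_mult[symmetric])
  qed
  show "\<forall>\<^sub>F n in sequentially. (1 - y n) ^ m n \<le> exp (- (real (m n) * y n))"
    using ev
  proof eventually_elim
    case (elim n)
    have "(1 - y n) ^ m n \<le> exp (- y n) ^ m n"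
      using one_minus_exp_bounds(2)[OF y(2) elim] elim by (intro power_mono) auto
    then show ?case by (simp add: exp_of_nat_mult[symmetric])
  qed
  have "(\<lambda>n. exp (- (real (m n) * y n / (1 - y n)))) \<longlonglongrightarrow> exp (- (L / (1 - 0)))"
    by (intro tendsto_intros my y) auto
  then show "(\<lambda>n. exp (- (real (m n) * y n / (1 - y n)))) \<longlonglongrightarrow> exp (- L)" by simp
  show "(\<lambda>n. exp (- (real (m n) * y n))) \<longlonglongrightarrow> exp (- L)" by (intro tendsto_intros my)
qed

text \<open>The cubic Maclaurin error is at most \<open>\<bar>x\<bar> / 2\<close>, because the
  square of 1.6 is below 3. This crude bound is meant for dominating the cosine powers uniformly in
  h.\<close>

lemma sin_squared_lower:
  fixes x :: real
  assumes "\<bar>x\<bar> \<le> pi / 2"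
  shows "x\<^sup>2 / 4 \<le> (sin x)\<^sup>2"
proof -
  have "\<bar>sin x - x\<bar> \<le> \<bar>x\<bar> ^ 3 / 6"
    using Maclaurin_sin_bound[of x 3] by (simp add: sin_coeff_def eval_nat_numeral)
  moreover have "\<bar>x\<bar> ^ 3 / 6 \<le> \<bar>x\<bar> / 2"
  proof -
    have "\<bar>x\<bar> \<le> 1.6" using assms pi_approx by simp
    then have "\<bar>x\<bar> ^ 2 \<le> 1.6 ^ 2" by (intro power_mono) auto
    then have "\<bar>x\<bar> ^ 2 \<le> 3" by (simp add: power2_eq_square)
    then have "\<bar>x\<bar> ^ 2 * \<bar>x\<bar> \<le> 3 * \<bar>x\<bar>" by (intro mult_right_mono) auto
    then show ?thesis by (simp add: power3_eq_cube power2_eq_square)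
  qed
  ultimately have "\<bar>x / 2\<bar> \<le> \<bar>sin x\<bar>" by linarith
  then have "(x / 2)\<^sup>2 \<le> (sin x)\<^sup>2" by (simp only: abs_le_square_iff)
  then show ?thesis by (simp add: power_divide)
qed

lemma binom_ratio_0: "binom_ratio m 0 = 1"
  by (simp add: binom_ratio_def)

lemma binom_ratio_Suc:
  assumes "k < m"
  shows "binom_ratio m (int (Suc k)) = binom_ratio m (int k) * ((real m - real k) / (real m + real k + 1))"
proof -
  have "Suc (m + k) * (2*m choose Suc (m + k)) = (2*m - (m + k)) * (2*m choose (m + k))"
    using assms by (metis Suc_times_binomial_eq binomial_absorption binomial_absorb_comp)
  then have "real (Suc (m + k)) * real (2*m choose Suc (m + k)) = real (2*m - (m + k)) * real (2*m choose (m + k))"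
    by (simp only: of_nat_mult[symmetric])
  then have "real (2*m choose Suc (m + k)) = real (2*m choose (m + k)) * ((real m - real k) / (real m + real k + 1))"
    using assms by (simp add: field_simps of_nat_diff)
  moreover have "nat (int m + int (Suc k)) = Suc (m + k)" "nat (int m + int k) = m + k" by linarith+
  ultimately show ?thesis using assms by (simp add: binom_ratio_def)
qed

text \<open>The ratio is the product over \<open>j < k\<close> of
  \<open>1 - (2 * j + 1) / (m + j + 1)\<close>, and the odd numbers \<open>2 * j + 1\<close> add up
  to the square of k. The separate bound K keeps the denominators fixed during the induction on
  k.\<close>

lemma binom_ratio_bounds:
  assumes "k \<le> K" "K < m"
  shows "exp (- ((real k)\<^sup>2 / (real m - real K))) \<le> binom_ratio m (int k)"
    "binom_ratio m (int k) \<le> exp (- ((real k)\<^sup>2 / (real m + real K)))"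
proof -
  have "exp (- ((real k)\<^sup>2 / (real m - real K))) \<le> binom_ratio m (int k) \<and>
    binom_ratio m (int k) \<le> exp (- ((real k)\<^sup>2 / (real m + real K)))"
    using assms
  proof (induction k)
    case (Suc k)
    define y where "y = (2 * real k + 1) / (real m + real k + 1)"
    have y: "0 \<le> y" "y < 1" using Suc.prems by (auto simp: y_def divide_simps)
    have 1: "1 - y = (real m - real k) / (real m + real k + 1)"
      by (simp add: y_def field_simps)
    have "y / (1 - y) = (2 * real k + 1) / (real m - real k)"
      unfolding 1 using Suc.prems by (simp add: y_def)
    also have "\<dots> \<le> (2 * real k + 1) / (real m - real K)"
      using Suc.prems by (intro divide_left_mono) auto
    finally have a: "exp (- ((2 * real k + 1) / (real m - real K))) \<le> 1 - y"
      using one_minus_exp_bounds(1)[OF y] by (meson exp_le_cancel_iff neg_le_iff_le order_trans)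
    have "(2 * real k + 1) / (real m + real K) \<le> y"
      unfolding y_def using Suc.prems by (intro divide_left_mono) auto
    then have b: "1 - y \<le> exp (- ((2 * real k + 1) / (real m + real K)))"
      using one_minus_exp_bounds(2)[OF y] by (meson exp_le_cancel_iff neg_le_iff_le order_trans)
    have sq: "(real (Suc k))\<^sup>2 / d = (real k)\<^sup>2 / d + (2 * real k + 1) / d" for d
      by (simp add: power2_eq_square add_divide_distrib[symmetric] algebra_simps)
    have R: "binom_ratio m (int (Suc k)) = binom_ratio m (int k) * (1 - y)"
      unfolding 1 using Suc.prems by (intro binom_ratio_Suc) auto
    have IH: "exp (- ((real k)\<^sup>2 / (real m - real K))) \<le> binom_ratio m (int k)"
      "binom_ratio m (int k) \<le> exp (- ((real k)\<^sup>2 / (real m + real K)))"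
      using Suc by auto
    have "exp (- ((real k)\<^sup>2 / (real m - real K))) * exp (- ((2 * real k + 1) / (real m - real K)))
       \<le> binom_ratio m (int k) * (1 - y)"
      using IH a y by (intro mult_mono) (auto simp: binom_ratio_def)
    moreover have "binom_ratio m (int k) * (1 - y) \<le>
       exp (- ((real k)\<^sup>2 / (real m + real K))) * exp (- ((2 * real k + 1) / (real m + real K)))"
      using IH b y by (intro mult_mono) auto
    ultimately show ?case unfolding R sq by (simp only: exp_add[symmetric] minus_add_distrib)
  qed (simp add: binom_ratio_0)
  then show "exp (- ((real k)\<^sup>2 / (real m - real K))) \<le> binom_ratio m (int k)"
    "binom_ratio m (int k) \<le> exp (- ((real k)\<^sup>2 / (real m + real K)))" by auto
qed

lemma binom_ratio_nonneg: "0 \<le> binom_ratio m k"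
  by (simp add: binom_ratio_def)

lemma binom_ratio_abs: "binom_ratio m \<bar>k\<bar> = binom_ratio m k"
  by (simp add: abs_if binom_ratio_minus)

text \<open>The bound with K = k has denominator \<open>m + k \<le> 2 * m\<close>; weakening it to
  \<open>2 * m\<close> gives one Gaussian majorant for all k.\<close>

lemma binom_ratio_le_exp:
  assumes "m > 0"
  shows "binom_ratio m k \<le> exp (- ((of_int k)\<^sup>2 / (2 * real m)))"
proof -
  consider "\<bar>k\<bar> < int m" | "\<bar>k\<bar> = int m" | "\<bar>k\<bar> > int m" by linarith
  then show ?thesis
  proof cases
    case 1
    define n where "n = nat \<bar>k\<bar>"
    have n: "int n = \<bar>k\<bar>" "(real n)\<^sup>2 = (of_int k)\<^sup>2" "n < m"
      using 1 by (auto simp: n_def)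
    have "binom_ratio m k \<le> exp (- ((real n)\<^sup>2 / (real m + real n)))"
      using binom_ratio_bounds(2)[of n n m] n by (simp add: binom_ratio_abs)
    also have "\<dots> \<le> exp (- ((real n)\<^sup>2 / (2 * real m)))"
    proof -
      have "(real n)\<^sup>2 / (2 * real m) \<le> (real n)\<^sup>2 / (real m + real n)"
        using n by (intro divide_left_mono) auto
      then show ?thesis by simp
    qed
    finally show ?thesis unfolding n(2) .
  next
    case 2
    \<comment> \<open>The endpoint \<open>\<bar>k\<bar> = m\<close> escapes
      \<open>binom_ratio_bounds\<close>, which asks for \<open>K < m\<close>. One more step from
      \<open>m - 1\<close> closes it: the last factor \<open>1 / (2 * m)\<close> equals
      \<open>1 - (2 * m' + 1) / (2 * m)\<close>.\<close>
    obtain m' where m': "m = Suc m'" using assms by (cases m) auto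
    have "binom_ratio m k = binom_ratio m (int (Suc m'))" using 2 m' by (metis binom_ratio_abs)
    also have "\<dots> = binom_ratio m (int m') * (1 / (2 * real m))"
      using m' by (subst binom_ratio_Suc) auto
    also have "\<dots> \<le> exp (- ((real m')\<^sup>2 / (real m + real m'))) * (1 - (2 * real m' + 1) / (2 * real m))"
      using m' binom_ratio_bounds(2)[of m' m' m] by (intro mult_mono) (auto simp: field_simps)
    also have "\<dots> \<le> exp (- ((real m')\<^sup>2 / (2 * real m))) * exp (- ((2 * real m' + 1) / (2 * real m)))"
    proof (intro mult_mono)
      have "(real m')\<^sup>2 / (2 * real m) \<le> (real m')\<^sup>2 / (real m + real m')"
        using m' by (intro divide_left_mono) auto
      then show "exp (- ((real m')\<^sup>2 / (real m + real m'))) \<le> exp (- ((real m')\<^sup>2 / (2 * real m)))" by simp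
      show "1 - (2 * real m' + 1) / (2 * real m) \<le> exp (- ((2 * real m' + 1) / (2 * real m)))"
        using exp_ge_add_one_self[of "- ((2 * real m' + 1) / (2 * real m))"] by simp
      show "0 \<le> 1 - (2 * real m' + 1) / (2 * real m)" using m' by (simp add: field_simps)
    qed simp
    also have "\<dots> = exp (- ((real m)\<^sup>2 / (2 * real m)))"
      unfolding m' by (simp only: exp_add[symmetric] minus_add_distrib[symmetric] add_divide_distrib[symmetric])
        (simp add: power2_eq_square algebra_simps)
    also have "(real m)\<^sup>2 = (of_int k)\<^sup>2" using 2
      by (metis of_int_abs of_int_of_nat_eq power2_abs)
    finally show ?thesis .
  qed (simp add: binom_ratio_def)
qed

text \<open>The partial Wallis products \<open>W m\<close> satisfy the exact identity
  \<open>eq\<close>, so the expression is the square root of \<open>m / ((2 * m + 1) * W m)\<close>,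
  which tends to the root of (1/2) / (pi/2).\<close>

lemma central_binomial_asymp:
  "(\<lambda>m. sqrt (real m) * (real (2*m choose m) / 4 ^ m)) \<longlonglongrightarrow> 1 / sqrt pi"
proof -
  define W where "W = (\<lambda>n. \<Prod>k=1..n. (4*(real k)\<^sup>2) / (4*(real k)\<^sup>2 - 1))"
  have W: "W \<longlonglongrightarrow> pi / 2" unfolding W_def by (rule wallis)
  have rec: "real (2 * Suc m choose Suc m) * (real m + 1) = real (2*m choose m) * (2 * (2 * real m + 1))" for m
  proof -
    have F: "fact n * fact n * real (2*n choose n) = fact (2*n)" for n
    proof -
      have "fact n * fact (2*n - n) * (2*n choose n) = fact (2*n)"
        by (rule binomial_fact_lemma) simp
      then have "real (fact n * fact (2*n - n) * (2*n choose n)) = real (fact (2*n))"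
        by (rule arg_cong)
      then show ?thesis by (simp only: of_nat_mult of_nat_fact mult_2 diff_add_inverse)
    qed
    have f1: "fact (Suc m) = (real m + 1) * fact m" by simp
    have f2: "fact (2 * Suc m) = (2 * real m + 2) * ((2 * real m + 1) * fact (2*m))"
      by (simp add: algebra_simps)
    have "(real m + 1) * fact m * ((real m + 1) * fact m) * real (2 * Suc m choose Suc m) =
       (2 * real m + 2) * ((2 * real m + 1) * (fact m * fact m * real (2*m choose m)))"
      using F[of "Suc m"] unfolding f1 f2 F[of m] .
    note eq1 = this
    have "x * c = y * (2 * a)"
      if "c * f * (c * f) * x = (2 * c) * (a * (f * f * y))" "c \<noteq> 0" "f \<noteq> 0" for x y a c f :: real
    proof -
      have "(c * f * f) * (x * c) = (c * f * f) * (y * (2 * a))" using that(1) by (simp add: mult_ac)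
      then show ?thesis using that by simp
    qed
    from this[of "real m + 1" "fact m" "real (2 * Suc m choose Suc m)" "2 * real m + 1" "real (2*m choose m)"]
    show ?thesis using eq1 by (simp add: distrib_left)
  qed
  have alg: "(b * (a / (2 * c)))\<^sup>2 * (d * (w * (4 * c\<^sup>2 / (a * d)))) = b\<^sup>2 * (a * w)"
    if "a \<noteq> 0" "c \<noteq> 0" "d \<noteq> 0" for a b c d w :: real
    using that by (simp add: power2_eq_square)
  have eq: "(real (2*m choose m) / 4 ^ m)\<^sup>2 * ((2 * real m + 1) * W m) = 1" for m
  proof (induction m)
    case (Suc m)
    define b where "b = real (2*m choose m) / 4 ^ m"
    have b': "real (2 * Suc m choose Suc m) / 4 ^ Suc m = b * ((2 * real m + 1) / (2 * (real m + 1)))"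
    proof -
      have "real (2 * Suc m choose Suc m) = real (2*m choose m) * (2 * (2 * real m + 1)) / (real m + 1)"
        by (rule nonzero_eq_divide_eq[THEN iffD2, OF _ rec]) linarith
      moreover have "y * (2 * a) / c / (4 * p) = y / p * (a / (2 * c))" for y a c p :: real by (simp add: mult_ac)
      ultimately show ?thesis unfolding b_def power_Suc by (simp only:)
    qed
    have W': "W (Suc m) = W m * (4 * (real m + 1)\<^sup>2 / ((2 * real m + 1) * (2 * real m + 3)))"
      by (simp add: W_def power2_eq_square algebra_simps)
    have d: "2 * real (Suc m) + 1 = 2 * real m + 3" by simp
    have "(b * ((2 * real m + 1) / (2 * (real m + 1))))\<^sup>2 * ((2 * real m + 3) *
       (W m * (4 * (real m + 1)\<^sup>2 / ((2 * real m + 1) * (2 * real m + 3)))))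
       = b\<^sup>2 * ((2 * real m + 1) * W m)"
      by (rule alg) (simp_all add: add_nonneg_eq_0_iff)
    also have "\<dots> = 1" using Suc unfolding b_def .
    finally show ?case unfolding b' W' d .
  qed (simp add: W_def)
  have w: "sqrt (real m) * (real (2*m choose m) / 4 ^ m) = sqrt (real m / ((2 * real m + 1) * W m))" for m
  proof -
    have "(real (2*m choose m) / 4 ^ m)\<^sup>2 = 1 / ((2 * real m + 1) * W m)"
      using eq[of m] by (metis eq_divide_eq mult_zero_right zero_neq_one)
    then have "sqrt ((real (2*m choose m) / 4 ^ m)\<^sup>2) = sqrt (1 / ((2 * real m + 1) * W m))" by simp
    then have "real (2*m choose m) / 4 ^ m = sqrt (1 / ((2 * real m + 1) * W m))" by simp
    then show ?thesis by (simp add: real_sqrt_mult[symmetric])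
  qed
  have "(\<lambda>m. real m / (2 * real m + 1)) \<longlonglongrightarrow> 1 / 2" by real_asymp
  then have "(\<lambda>m. sqrt (real m / (2 * real m + 1) / W m)) \<longlonglongrightarrow> sqrt (1 / 2 / (pi / 2))"
    by (intro tendsto_real_sqrt tendsto_divide[OF _ W]) auto
  then show ?thesis unfolding w by (simp add: real_sqrt_divide)
qed

text \<open>The limit \<open>h \<rightarrow> \<infinity>\<close> of \<open>polya_identity\<close> with \<open>m\<close> close to \<open>4 h\<^sup>2 / q\<close>: powers of the cosine and
  binomial coefficients both converge to Gaussians.\<close>

lemma poisson_gauss:
  fixes q c :: real
  assumes q: "q > 0" and c: "0 \<le> c" "c \<le> 1"
  shows "(\<Sum>\<^sub>\<infinity>k\<in>UNIV. exp (- (pi\<^sup>2 / q) * (of_int k + c)\<^sup>2)) =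
    sqrt (q / pi) * (\<Sum>\<^sub>\<infinity>\<nu>\<in>UNIV. exp (- q * (of_int \<nu>)\<^sup>2) * cos (2 * pi * c * of_int \<nu>))"
proof -
  \<comment> \<open>The choice makes both sides Gaussian at once: m times the squared sine of
    \<open>pi * (k + c) / (2 * h)\<close> tends to \<open>pi\<^sup>2 / q * (k + c)\<^sup>2\<close>,
    while \<open>(2 * h * \<nu>)\<^sup>2 / m\<close> tends to
    \<open>q * \<nu>\<^sup>2\<close>.\<close>
  define m where "m = (\<lambda>h::nat. nat \<lfloor>4 * (real h)\<^sup>2 / q\<rfloor>)"
  define \<mu> where "\<mu> = (\<lambda>h::nat. real (m h) / (real h)\<^sup>2)"
  have m_le: "real (m h) \<le> 4 * (real h)\<^sup>2 / q" and m_ge: "real (m h) \<ge> 4 * (real h)\<^sup>2 / q - 1" for h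
  proof -
    have "real (m h) = of_int \<lfloor>4 * (real h)\<^sup>2 / q\<rfloor>" using q by (simp add: m_def)
    then show "real (m h) \<le> 4 * (real h)\<^sup>2 / q" "real (m h) \<ge> 4 * (real h)\<^sup>2 / q - 1" by linarith+
  qed
  have \<mu>: "\<mu> \<longlonglongrightarrow> 4 / q"
  proof (rule tendsto_sandwich)
    show "\<forall>\<^sub>F h in sequentially. 4 / q - 1 / (real h)\<^sup>2 \<le> \<mu> h"
      using eventually_gt_at_top[of 0]
    proof eventually_elim
      case (elim h)
      have "4 / q - 1 / (real h)\<^sup>2 = (4 * (real h)\<^sup>2 / q - 1) / (real h)\<^sup>2"
        using elim by (simp add: diff_divide_distrib)
      also have "\<dots> \<le> \<mu> h" unfolding \<mu>_def by (intro divide_right_mono m_ge) simp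
      finally show ?case .
    qed
    show "\<forall>\<^sub>F h in sequentially. \<mu> h \<le> 4 / q"
      using eventually_gt_at_top[of 0]
    proof eventually_elim
      case (elim h)
      have "\<mu> h \<le> 4 * (real h)\<^sup>2 / q / (real h)\<^sup>2"
        unfolding \<mu>_def by (intro divide_right_mono m_le) simp
      then show ?case using elim by simp
    qed
    show "(\<lambda>h. 4 / q - 1 / (real h)\<^sup>2) \<longlonglongrightarrow> 4 / q" by real_asymp
  qed simp
  have m_top: "filterlim m at_top sequentially"
    unfolding filterlim_sequentially_iff_filterlim_real
  proof (rule filterlim_at_top_mono)
    show "filterlim (\<lambda>h. 4 * (real h)\<^sup>2 / q - 1) at_top sequentially" using q by real_asymp
    show "\<forall>\<^sub>F h in sequentially. 4 * (real h)\<^sup>2 / q - 1 \<le> real (m h)" using m_ge by simp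
  qed
  have m_big: "\<forall>\<^sub>F h in sequentially. real (m h) \<ge> 2 * (real h)\<^sup>2 / q"
  proof -
    have "\<forall>\<^sub>F h in sequentially. 4 * (real h)\<^sup>2 / q - 1 \<ge> 2 * (real h)\<^sup>2 / q" using q by real_asymp
    then show ?thesis by eventually_elim (use m_ge order_trans in blast)
  qed
  define f where "f = (\<lambda>h k. if k \<in> {-int h..<int h}
      then ((cos (pi * (of_int k + c) / (2 * real h)))\<^sup>2) ^ m h else 0)"
  define g where "g = (\<lambda>h \<nu>. binom_ratio (m h) (2 * int h * \<nu>) * cos (2 * pi * c * of_int \<nu>))"
  have f_lim: "(\<lambda>h. infsum (f h) UNIV) \<longlonglongrightarrow> (\<Sum>\<^sub>\<infinity>k\<in>UNIV. exp (- (pi\<^sup>2 / q) * (of_int k + c)\<^sup>2))"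
  proof (rule tendsto_infsum_dominated)
    fix k :: int
    define a where "a = pi * (of_int k + c) / 2"
    have y: "(\<lambda>h. (sin (a / real h))\<^sup>2) \<longlonglongrightarrow> 0"
    proof -
      have "(\<lambda>h. a / real h) \<longlonglongrightarrow> 0" by real_asymp
      then have "(\<lambda>h. (sin (a / real h))\<^sup>2) \<longlonglongrightarrow> (sin 0)\<^sup>2" by (intro tendsto_intros)
      then show ?thesis by simp
    qed
    have "(\<lambda>h. real h * sin (a / real h)) \<longlonglongrightarrow> a" by real_asymp
    then have "(\<lambda>h. \<mu> h * (real h * sin (a / real h))\<^sup>2) \<longlonglongrightarrow> 4 / q * a\<^sup>2"
      by (intro tendsto_intros \<mu>)
    moreover have "\<forall>\<^sub>F h in sequentially. \<mu> h * (real h * sin (a / real h))\<^sup>2 = real (m h) * (sin (a / real h))\<^sup>2"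
      using eventually_gt_at_top[of 0] by eventually_elim (simp add: \<mu>_def power_mult_distrib)
    ultimately have "(\<lambda>h. real (m h) * (sin (a / real h))\<^sup>2) \<longlonglongrightarrow> 4 / q * a\<^sup>2"
      by (rule Lim_transform_eventually)
    then have "(\<lambda>h. (1 - (sin (a / real h))\<^sup>2) ^ m h) \<longlonglongrightarrow> exp (- (4 / q * a\<^sup>2))"
      by (intro one_minus_power_tendsto y) auto
    moreover have "- (4 / q * a\<^sup>2) = - (pi\<^sup>2 / q) * (of_int k + c)\<^sup>2"
      by (simp add: a_def power_mult_distrib power_divide)
    ultimately have "(\<lambda>h. (1 - (sin (a / real h))\<^sup>2) ^ m h) \<longlonglongrightarrow> exp (- (pi\<^sup>2 / q) * (of_int k + c)\<^sup>2)"
      by (simp only:)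
    moreover have "\<forall>\<^sub>F h in sequentially. (1 - (sin (a / real h))\<^sup>2) ^ m h = f h k"
      using eventually_gt_at_top[of "nat \<bar>k\<bar>"]
    proof eventually_elim
      case (elim h)
      then have "k \<in> {-int h..<int h}" by auto
      then show ?case by (simp add: f_def a_def cos_squared_eq)
    qed
    ultimately show "(\<lambda>h. f h k) \<longlonglongrightarrow> exp (- (pi\<^sup>2 / q) * (of_int k + c)\<^sup>2)"
      by (rule Lim_transform_eventually)
  next
    \<comment> \<open>The rate 1 / q of the majorant is the product of
      \<open>m h \<ge> 2 * (real h)\<^sup>2 / q\<close> and of \<open>z\<^sup>2 / 2\<close>, the
      lower bound for the squared sine, where \<open>z = (k + c) / h\<close>.\<close>
    show "(\<lambda>k::int. exp (- (1 / q) * (of_int k + c)\<^sup>2)) summable_on UNIV"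
      using q by (intro gauss_int_summable) simp
    show "\<forall>\<^sub>F h in sequentially. \<forall>k\<in>UNIV. \<bar>f h k\<bar> \<le> exp (- (1 / q) * (of_int k + c)\<^sup>2)"
      using m_big eventually_gt_at_top[of 0]
    proof eventually_elim
      case (elim h)
      show ?case
      proof
        fix k :: int
        show "\<bar>f h k\<bar> \<le> exp (- (1 / q) * (of_int k + c)\<^sup>2)"
        proof (cases "k \<in> {-int h..<int h}")
          case True
          define x where "x = pi * (of_int k + c) / (2 * real h)"
          define z where "z = (of_int k + c) / real h"
          have xz: "x = z * (pi / 2)" by (simp add: x_def z_def mult_ac)
          have "- real h \<le> of_int k" "of_int k \<le> real h - 1"
            using True by auto
          \<comment> \<open>The window of k is half-open, so \<open>0 \<le> c \<le> 1\<close> keeps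
            \<open>k + c\<close> between -h and h.\<close>
          then have "\<bar>z\<bar> \<le> 1" using c elim by (simp add: z_def abs_le_iff field_simps)
          then have "\<bar>x\<bar> \<le> pi / 2" unfolding xz by (simp add: abs_mult mult_left_le_one_le)
          then have "x\<^sup>2 / 4 \<le> (sin x)\<^sup>2" by (rule sin_squared_lower)
          moreover have "z\<^sup>2 / 2 \<le> x\<^sup>2 / 4"
          proof -
            have "(3 / 2)\<^sup>2 \<le> (pi / 2)\<^sup>2" using pi_gt3 by (intro power_mono) auto
            then have "2 \<le> (pi / 2)\<^sup>2" by (simp add: power2_eq_square)
            then have "z\<^sup>2 * 2 \<le> z\<^sup>2 * (pi / 2)\<^sup>2" by (intro mult_left_mono) auto
            then show ?thesis unfolding xz power_mult_distrib by simp
          qed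
          ultimately have s: "z\<^sup>2 / 2 \<le> (sin x)\<^sup>2" by linarith
          have "\<bar>f h k\<bar> = (1 - (sin x)\<^sup>2) ^ m h"
            using True by (simp add: f_def x_def cos_squared_eq[symmetric])
          also have "\<dots> \<le> exp (- (sin x)\<^sup>2) ^ m h"
            using exp_ge_add_one_self[of "- (sin x)\<^sup>2"]
            by (intro power_mono) (simp_all add: cos_squared_eq[symmetric])
          also have "\<dots> = exp (- (real (m h) * (sin x)\<^sup>2))" by (simp add: exp_of_nat_mult[symmetric])
          also have "\<dots> \<le> exp (- (2 * (real h)\<^sup>2 / q * (z\<^sup>2 / 2)))"
            using mult_mono[OF elim(1) s] by simp
          also have "- (2 * (real h)\<^sup>2 / q * (z\<^sup>2 / 2)) = - (1 / q) * (of_int k + c)\<^sup>2"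
            using elim by (simp add: z_def power_divide)
          finally show ?thesis .
        qed (auto simp: f_def)
      qed
    qed
  qed
  have g_lim: "(\<lambda>h. infsum (g h) UNIV) \<longlonglongrightarrow> (\<Sum>\<^sub>\<infinity>\<nu>\<in>UNIV. exp (- q * (of_int \<nu>)\<^sup>2) * cos (2 * pi * c * of_int \<nu>))"
  proof (rule tendsto_infsum_dominated)
    fix \<nu> :: int
    define r where "r = \<bar>real_of_int \<nu>\<bar>"
    define K where "K = (\<lambda>h. nat \<bar>2 * int h * \<nu>\<bar>)"
    have K: "real (K h) = 2 * real h * r" "binom_ratio (m h) (int (K h)) = binom_ratio (m h) (2 * int h * \<nu>)" for h
      by (simp add: K_def r_def abs_mult) (simp only: K_def int_nat_eq abs_ge_zero if_True binom_ratio_abs)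
    have inv: "(\<lambda>h. 2 * r / real h) \<longlonglongrightarrow> 0" by real_asymp
    have "(\<lambda>h. \<mu> h - 2 * r / real h) \<longlonglongrightarrow> 4 / q - 0" by (intro tendsto_diff \<mu> inv)
    then have "\<forall>\<^sub>F h in sequentially. 0 < \<mu> h - 2 * r / real h"
      by (rule order_tendstoD(1)) (use q in simp)
    then have ev: "\<forall>\<^sub>F h in sequentially. h > 0 \<and> K h < m h"
      using eventually_gt_at_top[of 0]
    proof eventually_elim
      case (elim h)
      have "0 < (\<mu> h - 2 * r / real h) * (real h)\<^sup>2" using elim by simp
      also have "\<dots> = real (m h) - real (K h)"
        using elim by (simp add: \<mu>_def K(1) left_diff_distrib power2_eq_square)
      finally show ?case using elim by simp
    qed
    have e: "(real (K h))\<^sup>2 / (real (m h) + s * real (K h)) = 4 * r\<^sup>2 / (\<mu> h + s * (2 * r / real h))"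
      if "h > 0" for h s
    proof -
      have 1: "(real (K h))\<^sup>2 = 4 * r\<^sup>2 * (real h)\<^sup>2" by (simp add: K(1) power_mult_distrib)
      have 2: "real (m h) + s * real (K h) = (\<mu> h + s * (2 * r / real h)) * (real h)\<^sup>2"
        using that by (simp add: \<mu>_def K(1) distrib_right power2_eq_square)
      show ?thesis unfolding 1 2 using that by simp
    qed
    have "(\<lambda>h. binom_ratio (m h) (2 * int h * \<nu>)) \<longlonglongrightarrow> exp (- (4 * r\<^sup>2 / (4 / q)))"
    proof (rule tendsto_sandwich)
      show "\<forall>\<^sub>F h in sequentially. exp (- (4 * r\<^sup>2 / (\<mu> h + (-1) * (2 * r / real h)))) \<le> binom_ratio (m h) (2 * int h * \<nu>)"
        using ev
      proof eventually_elim
        case (elim h)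
        then show ?case using binom_ratio_bounds(1)[of "K h" "K h" "m h"]
          by (subst e[symmetric]) (simp_all add: K(2))
      qed
      show "\<forall>\<^sub>F h in sequentially. binom_ratio (m h) (2 * int h * \<nu>) \<le> exp (- (4 * r\<^sup>2 / (\<mu> h + 1 * (2 * r / real h))))"
        using ev
      proof eventually_elim
        case (elim h)
        then show ?case using binom_ratio_bounds(2)[of "K h" "K h" "m h"]
          by (subst e[symmetric]) (simp_all add: K(2))
      qed
      have lim: "(\<lambda>h. exp (- (4 * r\<^sup>2 / (\<mu> h + s * (2 * r / real h))))) \<longlonglongrightarrow> exp (- (4 * r\<^sup>2 / (4 / q + s * 0)))" for s
        using q by (intro tendsto_intros \<mu> inv) auto
      show "(\<lambda>h. exp (- (4 * r\<^sup>2 / (\<mu> h + (-1) * (2 * r / real h))))) \<longlonglongrightarrow> exp (- (4 * r\<^sup>2 / (4 / q)))"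
        using lim[of "-1"] by (simp only: mult_zero_right add_0_right)
      show "(\<lambda>h. exp (- (4 * r\<^sup>2 / (\<mu> h + 1 * (2 * r / real h))))) \<longlonglongrightarrow> exp (- (4 * r\<^sup>2 / (4 / q)))"
        using lim[of 1] by (simp only: mult_zero_right add_0_right)
    qed
    moreover have "- (4 * r\<^sup>2 / (4 / q)) = - q * (of_int \<nu>)\<^sup>2" using q by (simp add: r_def)
    ultimately show "(\<lambda>h. g h \<nu>) \<longlonglongrightarrow> exp (- q * (of_int \<nu>)\<^sup>2) * cos (2 * pi * c * of_int \<nu>)"
      unfolding g_def by (intro tendsto_mult tendsto_const) (simp only:)
  next
    \<comment> \<open>The rate q / 2 comes from \<open>m h \<le> 4 * (real h)\<^sup>2 / q\<close>
      inserted into the exponent \<open>(2 * h * \<nu>)\<^sup>2 / (2 * m)\<close> of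
      \<open>binom_ratio_le_exp\<close>.\<close>
    show "(\<lambda>\<nu>::int. exp (- (q / 2) * (of_int \<nu> + 0)\<^sup>2)) summable_on UNIV"
      using q by (intro gauss_int_summable) simp
    have "\<forall>\<^sub>F h in sequentially. m h > 0" by (rule eventually_compose_filterlim[OF eventually_gt_at_top m_top])
    then show "\<forall>\<^sub>F h in sequentially. \<forall>\<nu>\<in>UNIV. \<bar>g h \<nu>\<bar> \<le> exp (- (q / 2) * (of_int \<nu> + 0)\<^sup>2)"
    proof eventually_elim
      case (elim h)
      show ?case
      proof
        fix \<nu> :: int
        have "\<bar>g h \<nu>\<bar> \<le> binom_ratio (m h) (2 * int h * \<nu>) * 1"
          unfolding g_def abs_mult by (intro mult_mono) (simp_all add: binom_ratio_nonneg)
        also have "\<dots> \<le> exp (- ((of_int (2 * int h * \<nu>))\<^sup>2 / (2 * real (m h))))"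
          unfolding mult_1_right by (rule binom_ratio_le_exp[OF elim])
        also have "\<dots> \<le> exp (- (q / 2) * (of_int \<nu> + 0)\<^sup>2)"
        proof -
          have "q * real (m h) \<le> 4 * (real h)\<^sup>2" using m_le[of h] q by (simp add: field_simps)
          then have "(q * real (m h)) * (of_int \<nu>)\<^sup>2 \<le> (4 * (real h)\<^sup>2) * (of_int \<nu>)\<^sup>2"
            by (intro mult_right_mono) auto
          then have "(q / 2) * (of_int \<nu>)\<^sup>2 \<le> (of_int (2 * int h * \<nu>))\<^sup>2 / (2 * real (m h))"
            using elim by (simp add: field_simps power_mult_distrib)
          then show ?thesis by simp
        qed
        finally show "\<bar>g h \<nu>\<bar> \<le> exp (- (q / 2) * (of_int \<nu> + 0)\<^sup>2)" .
      qed
    qed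
  qed
  \<comment> \<open>The prefactor of \<open>polya_identity\<close>. Writing 2h as
    \<open>2 / sqrt (\<mu> h) * sqrt (m h)\<close> isolates the central binomial
    asymptotics.\<close>
  define \<kappa> where "\<kappa> = (\<lambda>h. 2 * real h * real (2 * m h choose m h) / 4 ^ m h)"
  have fg: "\<forall>\<^sub>F h in sequentially. infsum (f h) UNIV = \<kappa> h * infsum (g h) UNIV"
    using eventually_gt_at_top[of 0]
  proof eventually_elim
    case (elim h)
    have "infsum (f h) UNIV = (\<Sum>k\<in>{-int h..<int h}. ((cos (pi * (of_int k + c) / (2 * real h)))\<^sup>2) ^ m h)"
      unfolding infsum_finite[OF finite_atLeastLessThan_int, symmetric]
      by (rule infsum_cong_neutral) (auto simp: f_def)
    also have "\<dots> = \<kappa> h * infsum (g h) UNIV" unfolding \<kappa>_def g_def by (rule polya_identity[OF elim])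
    finally show ?case .
  qed
  have "(\<lambda>h. 2 / sqrt (\<mu> h) * (sqrt (real (m h)) * (real (2 * m h choose m h) / 4 ^ m h))) \<longlonglongrightarrow>
      2 / sqrt (4 / q) * (1 / sqrt pi)"
    using q by (intro tendsto_intros \<mu> filterlim_compose[OF central_binomial_asymp m_top]) auto
  moreover have "\<forall>\<^sub>F h in sequentially. 2 / sqrt (\<mu> h) * (sqrt (real (m h)) * (real (2 * m h choose m h) / 4 ^ m h)) = \<kappa> h"
    using eventually_gt_at_top[of 0] eventually_compose_filterlim[OF eventually_gt_at_top[of 0] m_top]
  proof eventually_elim
    case (elim h)
    have "sqrt (\<mu> h) = sqrt (real (m h)) / real h" by (simp add: \<mu>_def real_sqrt_divide)
    then show ?case using elim by (simp add: \<kappa>_def)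
  qed
  ultimately have "\<kappa> \<longlonglongrightarrow> 2 / sqrt (4 / q) * (1 / sqrt pi)" by (rule Lim_transform_eventually)
  moreover have "2 / sqrt (4 / q) * (1 / sqrt pi) = sqrt (q / pi)" using q by (simp add: real_sqrt_divide)
  ultimately have "\<kappa> \<longlonglongrightarrow> sqrt (q / pi)" by simp
  from tendsto_mult[OF this g_lim] have "(\<lambda>h. infsum (f h) UNIV) \<longlonglongrightarrow>
     sqrt (q / pi) * (\<Sum>\<^sub>\<infinity>\<nu>\<in>UNIV. exp (- q * (of_int \<nu>)\<^sup>2) * cos (2 * pi * c * of_int \<nu>))"
    by (rule Lim_transform_eventually) (use fg in \<open>eventually_elim, simp\<close>)
  then show ?thesis using f_lim LIMSEQ_unique by blast
qed

section \<open>Symmetrized lattice sums\<close>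

lemma has_sum_product_nonneg:
  fixes f :: "'a \<Rightarrow> real" and g :: "'b \<Rightarrow> real"
  assumes "(f has_sum a) A" "(g has_sum b) B"
    and "\<And>x. x \<in> A \<Longrightarrow> f x \<ge> 0" "\<And>y. y \<in> B \<Longrightarrow> g y \<ge> 0"
  shows "((\<lambda>(x, y). f x * g y) has_sum (a * b)) (A \<times> B)"
proof (rule has_sum_SigmaI)
  show inner: "((\<lambda>y. case (x, y) of (x, y) \<Rightarrow> f x * g y) has_sum f x * b) B" if "x \<in> A" for x
    using assms(2) by (simp add: has_sum_cmult_right)
  show outer: "((\<lambda>x. f x * b) has_sum a * b) A"
    using assms(1) by (rule has_sum_cmult_left)
  show "(\<lambda>(x, y). f x * g y) summable_on A \<times> B"
    using inner has_sum_imp_summable[OF outer] by (rule summable_on_SigmaI) (auto intro: mult_nonneg_nonneg assms(3,4))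
qed

text \<open>Real summability over a set is absolute, so the nonnegative case applied to absolute
  values gives the joint summability needed to combine the iterated sums.\<close>

lemma has_sum_product_abs:
  fixes f :: "'a \<Rightarrow> real" and g :: "'b \<Rightarrow> real"
  assumes "(f has_sum a) A" "(g has_sum b) B"
  shows "((\<lambda>(x, y). f x * g y) has_sum (a * b)) (A \<times> B)"
proof (rule has_sum_SigmaI)
  show "((\<lambda>y. case (x, y) of (x, y) \<Rightarrow> f x * g y) has_sum f x * b) B" if "x \<in> A" for x
    using assms(2) by (simp add: has_sum_cmult_right)
  show "((\<lambda>x. f x * b) has_sum a * b) A"
    using assms(1) by (rule has_sum_cmult_left)
  have "(\<lambda>x. \<bar>f x\<bar>) summable_on A" "(\<lambda>x. \<bar>g x\<bar>) summable_on B"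
    using assms[THEN has_sum_imp_summable, THEN summable_on_iff_abs_summable_on_real[THEN iffD1]]
    by simp_all
  then have "((\<lambda>(x, y). \<bar>f x\<bar> * \<bar>g y\<bar>) has_sum (infsum (\<lambda>x. \<bar>f x\<bar>) A * infsum (\<lambda>x. \<bar>g x\<bar>) B)) (A \<times> B)"
    by (intro has_sum_product_nonneg) auto
  then have "(\<lambda>(x, y). \<bar>f x\<bar> * \<bar>g y\<bar>) summable_on (A \<times> B)" by (rule has_sum_imp_summable)
  moreover have "(\<lambda>z. norm (case z of (x, y) \<Rightarrow> f x * g y)) = (\<lambda>(x, y). \<bar>f x\<bar> * \<bar>g y\<bar>)"
    by (auto simp: fun_eq_iff abs_mult)
  ultimately have "(\<lambda>z. norm (case z of (x, y) \<Rightarrow> f x * g y)) summable_on (A \<times> B)" by (simp only:)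
  then show "(\<lambda>(x, y). f x * g y) summable_on A \<times> B"
    by (rule summable_on_iff_abs_summable_on_real[THEN iffD2])
qed

text \<open>Relative to t = 1 the two exponents change by u and v. Each is of first order in
  \<open>t - 1\<close>, but their sum is exactly \<open>- q * (a + b) * (t - 1)\<^sup>2 / t\<close>.
  The tangent bound \<open>exp u + exp v \<ge> 2 + u + v\<close> sees only this sum.\<close>

lemma exp_sym_lower:
  fixes q t a b :: real
  assumes "t > 0"
  shows "2 * exp (- q * (a + b)) * (1 - q * (a + b) * ((t - 1)\<^sup>2 / (2 * t)))
    \<le> exp (- q * (a * t + b / t)) + exp (- q * (b * t + a / t))"
proof -
  define u where "u = - q * (a * t + b / t - (a + b))"
  define v where "v = - q * (b * t + a / t - (a + b))"
  define D where "D = q * (a + b) * ((t - 1)\<^sup>2 / (2 * t))"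
  define E where "E = exp (- q * (a + b))"
  have sum: "u + v = - 2 * D"
    using assms by (simp add: u_def v_def D_def field_simps power2_eq_square)
  have e: "exp (- q * (a * t + b / t)) = E * exp u" "exp (- q * (b * t + a / t)) = E * exp v"
    unfolding exp_add[symmetric] u_def v_def E_def by (simp_all add: algebra_simps)
  have "E * (2 + (u + v)) \<le> E * (exp u + exp v)"
    using exp_ge_add_one_self[of u] exp_ge_add_one_self[of v]
    by (intro mult_left_mono) (linarith, simp add: E_def)
  then show ?thesis unfolding sum e D_def[symmetric] E_def[symmetric] by (simp add: algebra_simps)
qed

lemma infsum_symmetrize:
  fixes f :: "'a \<times> 'a \<Rightarrow> real"
  assumes "f summable_on A \<times> A"
  shows "2 * infsum f (A \<times> A) = (\<Sum>\<^sub>\<infinity>(x, y)\<in>A \<times> A. f (x, y) + f (y, x))"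
    "(\<lambda>(x, y). f (x, y) + f (y, x)) summable_on A \<times> A"
proof -
  have "((\<lambda>(x, y). f (y, x)) has_sum infsum f (A \<times> A)) (A \<times> A)"
    using assms by (subst has_sum_swap[symmetric]) simp
  then have "((\<lambda>z. f z + (case z of (x, y) \<Rightarrow> f (y, x))) has_sum infsum f (A \<times> A) + infsum f (A \<times> A)) (A \<times> A)"
    using assms by (intro has_sum_add) auto
  then have h: "((\<lambda>(x, y). f (x, y) + f (y, x)) has_sum 2 * infsum f (A \<times> A)) (A \<times> A)"
    by (simp add: case_prod_unfold)
  show "2 * infsum f (A \<times> A) = (\<Sum>\<^sub>\<infinity>(x, y)\<in>A \<times> A. f (x, y) + f (y, x))"
    using h by (simp add: infsumI)
  show "(\<lambda>(x, y). f (x, y) + f (y, x)) summable_on A \<times> A"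
    using h by (rule has_sum_imp_summable)
qed

text \<open>Half of the exponent pays for the linear factor; this bounds first moments by a theta
  sum at half the parameter.\<close>

lemma mult_exp_minus_le:
  fixes y :: real
  shows "y * exp (- y) \<le> exp (- (y / 2))"
proof -
  have "y \<le> exp (y / 2)"
  proof (cases "y \<ge> 0")
    case True
    have "0 \<le> (y - 2)\<^sup>2" by simp
    then have "y \<le> 1 + y / 2 + (y / 2)\<^sup>2 / 2" by (simp add: power2_eq_square field_simps)
    also have "\<dots> \<le> exp (y / 2)" using True by (intro exp_lower_Taylor_quadratic) simp
    finally show ?thesis .
  qed (use exp_gt_zero[of "y / 2"] in linarith)
  then have "y * exp (- y) \<le> exp (y / 2) * exp (- y)" by (intro mult_right_mono) auto
  then show ?thesis by (simp add: exp_add[symmetric])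
qed

text \<open>The symmetrization argument uses only nonnegative weights with summable Gaussians. It is
  needed for three families: squares of positive integers (the open quadrant), squares of all
  integers (the lattice), and squares of half-integers (the dual of the alternating sum).\<close>

locale gauss_weights =
  fixes a :: "'a \<Rightarrow> real" and A :: "'a set"
  assumes nonneg: "x \<in> A \<Longrightarrow> 0 \<le> a x"
    and summable: "0 < s \<Longrightarrow> (\<lambda>x. exp (- s * a x)) summable_on A"
begin

definition theta :: "real \<Rightarrow> real" where
  "theta s = (\<Sum>\<^sub>\<infinity>x\<in>A. exp (- s * a x))"

definition dtheta :: "real \<Rightarrow> real \<Rightarrow> real" where
  "dtheta q t = (\<Sum>\<^sub>\<infinity>(x, y)\<in>A \<times> A. exp (- q * (a x * t + a y / t)))"

lemma theta_has_sum: "s > 0 \<Longrightarrow> ((\<lambda>x. exp (- s * a x)) has_sum theta s) A"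
  unfolding theta_def using summable by (rule has_sum_infsum)

lemma dtheta_has_sum:
  assumes "q > 0" "t > 0"
  shows "((\<lambda>(x, y). exp (- q * (a x * t + a y / t))) has_sum theta (q * t) * theta (q / t)) (A \<times> A)"
proof -
  have "((\<lambda>(x, y). exp (- (q * t) * a x) * exp (- (q / t) * a y)) has_sum
      theta (q * t) * theta (q / t)) (A \<times> A)"
    using assms by (intro has_sum_product_nonneg theta_has_sum) auto
  then show ?thesis by (simp add: exp_add[symmetric] case_prod_unfold algebra_simps)
qed

lemma dtheta_eq: "q > 0 \<Longrightarrow> t > 0 \<Longrightarrow> dtheta q t = theta (q * t) * theta (q / t)"
  unfolding dtheta_def using dtheta_has_sum by (rule infsumI)

lemma dtheta_summable:
  assumes "q > 0" "t > 0"
  shows "(\<lambda>(x, y). exp (- q * (a x * t + a y / t))) summable_on A \<times> A"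
  using dtheta_has_sum[OF assms] by (rule has_sum_imp_summable)

lemma dtheta_nonneg: "0 \<le> dtheta q t"
  unfolding dtheta_def by (rule infsum_nonneg) auto

lemma moment_summable:
  assumes "q > 0"
  shows "(\<lambda>(x, y). q * (a x + a y) * exp (- q * (a x + a y))) summable_on A \<times> A"
proof (rule summable_on_comparison_test)
  show "(\<lambda>(x, y). exp (- (q / 2) * (a x * 1 + a y / 1))) summable_on A \<times> A"
    using assms by (intro dtheta_summable) auto
  show "(case z of (x, y) \<Rightarrow> q * (a x + a y) * exp (- q * (a x + a y)))
    \<le> (case z of (x, y) \<Rightarrow> exp (- (q / 2) * (a x * 1 + a y / 1)))" for z
    using mult_exp_minus_le[of "q * (a (fst z) + a (snd z))"] by (simp add: case_prod_unfold)
  show "0 \<le> (case z of (x, y) \<Rightarrow> q * (a x + a y) * exp (- q * (a x + a y)))" if "z \<in> A \<times> A" for z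
    using that assms by (auto intro!: mult_nonneg_nonneg add_nonneg_nonneg nonneg)
qed

text \<open>Symmetrizing in the two summation indices cancels the linear term in \<open>t - 1\<close>.\<close>

lemma dtheta_lower:
  assumes "q > 0" "t > 0"
  shows "dtheta q 1 - (t - 1)\<^sup>2 / (2 * t) *
      (\<Sum>\<^sub>\<infinity>(x, y)\<in>A \<times> A. q * (a x + a y) * exp (- q * (a x + a y))) \<le> dtheta q t"
proof -
  let ?M = "\<lambda>(x, y). q * (a x + a y) * exp (- q * (a x + a y))"
  let ?c = "(t - 1)\<^sup>2 / (2 * t)"
  have e1: "((\<lambda>(x, y). exp (- q * (a x * 1 + a y / 1))) has_sum dtheta q 1) (A \<times> A)"
    using dtheta_summable[OF assms(1), of 1] by (simp add: dtheta_def)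
  have "((\<lambda>z. 2 * ((case z of (x, y) \<Rightarrow> exp (- q * (a x * 1 + a y / 1))) + - ?c * ?M z)) has_sum
      2 * (dtheta q 1 + - ?c * infsum ?M (A \<times> A))) (A \<times> A)"
    by (intro has_sum_cmult_right has_sum_add e1 has_sum_infsum moment_summable assms)
  moreover have "((\<lambda>(x, y). exp (- q * (a x * t + a y / t)) + exp (- q * (a y * t + a x / t))) has_sum
      2 * dtheta q t) (A \<times> A)"
    unfolding dtheta_def
    using infsum_symmetrize[OF dtheta_summable[OF assms]] by (simp add: has_sum_iff)
  ultimately have "2 * (dtheta q 1 + - ?c * infsum ?M (A \<times> A)) \<le> 2 * dtheta q t"
  proof (rule has_sum_mono)
    fix z assume "z \<in> A \<times> A"
    obtain x y where z: "z = (x, y)" by (cases z)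
    have alg: "2 * (E + - c * (X * E)) = 2 * E * (1 - X * c)" for c X E :: real by (simp add: algebra_simps)
    show "2 * ((case z of (x, y) \<Rightarrow> exp (- q * (a x * 1 + a y / 1))) + - ?c * ?M z) \<le>
      (case z of (x, y) \<Rightarrow> exp (- q * (a x * t + a y / t)) + exp (- q * (a y * t + a x / t)))"
      unfolding z prod.case mult_1_right div_by_1 alg by (rule exp_sym_lower[OF assms(2)])
  qed
  then show ?thesis by simp
qed

text \<open>The first moment is replaced by the theta product at q / 2, whose decay is easy to
  control; the halved parameter reappears in \<open>alt_drop\<close>.\<close>

lemma dtheta_lower':
  assumes "q > 0" "t > 0"
  shows "dtheta q 1 - (t - 1)\<^sup>2 / (2 * t) * dtheta (q / 2) 1 \<le> dtheta q t"
proof -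
  have "(\<Sum>\<^sub>\<infinity>(x, y)\<in>A \<times> A. q * (a x + a y) * exp (- q * (a x + a y))) \<le>
    (\<Sum>\<^sub>\<infinity>(x, y)\<in>A \<times> A. exp (- (q / 2) * (a x * 1 + a y / 1)))"
  proof (rule infsum_mono)
    show "(\<lambda>(x, y). exp (- (q / 2) * (a x * 1 + a y / 1))) summable_on A \<times> A"
      using assms by (intro dtheta_summable) auto
    show "(case z of (x, y) \<Rightarrow> q * (a x + a y) * exp (- q * (a x + a y)))
      \<le> (case z of (x, y) \<Rightarrow> exp (- (q / 2) * (a x * 1 + a y / 1)))" for z
      using mult_exp_minus_le[of "q * (a (fst z) + a (snd z))"] by (simp add: case_prod_unfold)
  qed (rule moment_summable[OF assms(1)])
  then have "(t - 1)\<^sup>2 / (2 * t) * (\<Sum>\<^sub>\<infinity>(x, y)\<in>A \<times> A. q * (a x + a y) * exp (- q * (a x + a y)))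
    \<le> (t - 1)\<^sup>2 / (2 * t) * dtheta (q / 2) 1"
    unfolding dtheta_def using assms by (intro mult_left_mono) auto
  then show ?thesis using dtheta_lower[OF assms] by linarith
qed

lemma dtheta_inverse: "q > 0 \<Longrightarrow> t > 0 \<Longrightarrow> dtheta q (1 / t) = dtheta q t"
  by (subst (1 2) dtheta_eq) (simp_all add: mult.commute)

end

section \<open>The theta product of a rectangular lattice\<close>

lemma gauss_nat_summable:
  fixes s :: real assumes "s > 0"
  shows "(\<lambda>n::nat. exp (- s * (real n + 1)\<^sup>2)) summable_on UNIV"
proof -
  have "(\<lambda>k::int. exp (- s * (of_int k + 1)\<^sup>2)) summable_on range int"
    using gauss_int_summable[OF assms] by (rule summable_on_subset) simp
  then show ?thesis by (subst (asm) summable_on_reindex) (auto simp: o_def)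
qed

global_interpretation pos: gauss_weights "\<lambda>n::nat. (real n + 1)\<^sup>2" UNIV
  defines theta_pos = pos.theta and dtheta_pos = pos.dtheta
  by (rule gauss_weights.intro) (simp, rule gauss_nat_summable)

global_interpretation full: gauss_weights "\<lambda>n::int. (of_int n)\<^sup>2" UNIV
  defines theta_full = full.theta and dtheta_full = full.dtheta
  by (rule gauss_weights.intro) (simp, use gauss_int_summable[of _ 0] in simp)

global_interpretation half: gauss_weights "\<lambda>n::int. (of_int n + 1 / 2)\<^sup>2" UNIV
  defines theta_half = half.theta and dtheta_half = half.dtheta
  by (rule gauss_weights.intro) (simp, rule gauss_int_summable)

lemma theta_split:
  assumes "s > 0"
  shows "theta_full s = 1 + 2 * theta_pos s"
proof -
  let ?f = "\<lambda>n::int. exp (- s * (of_int n)\<^sup>2)"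
  have h: "((\<lambda>n::nat. exp (- s * (real n + 1)\<^sup>2)) has_sum theta_pos s) UNIV"
    using assms by (rule pos.theta_has_sum)
  have "(?f has_sum theta_pos s) (range (\<lambda>n. int n + 1))"
    by (subst has_sum_reindex) (use h in \<open>auto simp: o_def inj_on_def add_ac\<close>)
  moreover have "(?f has_sum theta_pos s) (range (\<lambda>n. - int n - 1))"
  proof (subst has_sum_reindex)
    have "(- real n - 1)\<^sup>2 = (real n + 1)\<^sup>2" for n by (simp add: power2_eq_square algebra_simps)
    then show "((?f \<circ> (\<lambda>n. - int n - 1)) has_sum theta_pos s) UNIV" using h by (simp add: o_def)
  qed (auto simp: inj_on_def)
  moreover have "range (\<lambda>n. int n + 1) \<inter> range (\<lambda>n. - int n - 1) = {}" by auto
  ultimately have "(?f has_sum (theta_pos s + theta_pos s)) (range (\<lambda>n. int n + 1) \<union> range (\<lambda>n. - int n - 1))"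
    by (rule has_sum_Un_disjoint)
  then have "(?f has_sum (?f 0 + (theta_pos s + theta_pos s))) (insert 0 (range (\<lambda>n. int n + 1) \<union> range (\<lambda>n. - int n - 1)))"
    by (intro has_sum_insert) auto
  moreover have "insert 0 (range (\<lambda>n. int n + 1) \<union> range (\<lambda>n. - int n - 1)) = UNIV"
  proof -
    have "k \<in> insert 0 (range (\<lambda>n. int n + 1) \<union> range (\<lambda>n. - int n - 1))" for k :: int
    proof -
      consider "k = 0" | "k = int (nat (k - 1)) + 1" | "k = - int (nat (- k - 1)) - 1" by linarith
      then show ?thesis by cases blast+
    qed
    then show ?thesis by blast
  qed
  ultimately have "(?f has_sum (1 + 2 * theta_pos s)) UNIV" by simp
  then show ?thesis unfolding full.theta_def by (rule infsumI)
qed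

lemma theta_dual:
  assumes "s > 0"
  shows "theta_full s = sqrt (pi / s) * theta_full (pi\<^sup>2 / s)"
proof -
  have "theta_full (pi\<^sup>2 / (pi\<^sup>2 / s)) = sqrt ((pi\<^sup>2 / s) / pi) * theta_full (pi\<^sup>2 / s)"
    using poisson_gauss[of "pi\<^sup>2 / s" 0] assms by (simp add: full.theta_def mult.commute)
  moreover have "pi\<^sup>2 / (pi\<^sup>2 / s) = s" "(pi\<^sup>2 / s) / pi = pi / s"
    using assms by (simp_all add: power2_eq_square)
  ultimately show ?thesis by simp
qed

text \<open>The two square-root prefactors multiply to \<open>pi / q\<close>, free of t, and the
  dual parameters are those of t with the factors exchanged. Hence any comparison of t with 1
  carries over between q and \<open>pi\<^sup>2 / q\<close>.\<close>

lemma dtheta_dual: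
  assumes "q > 0" "t > 0"
  shows "dtheta_full q t = pi / q * dtheta_full (pi\<^sup>2 / q) t"
proof -
  have "dtheta_full q t = (sqrt (pi / (q * t)) * sqrt (pi / (q / t))) * (theta_full (pi\<^sup>2 / (q * t)) * theta_full (pi\<^sup>2 / (q / t)))"
    using assms theta_dual[of "q * t"] theta_dual[of "q / t"] by (simp add: full.dtheta_eq)
  also have "sqrt (pi / (q * t)) * sqrt (pi / (q / t)) = sqrt ((pi / q)\<^sup>2)"
    using assms by (simp add: real_sqrt_mult[symmetric] power2_eq_square)
  also have "\<dots> = pi / q" using assms by simp
  also have "theta_full (pi\<^sup>2 / (q * t)) * theta_full (pi\<^sup>2 / (q / t)) = dtheta_full (pi\<^sup>2 / q) t"
    using assms by (simp add: full.dtheta_eq mult.commute)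
  finally show ?thesis .
qed

section \<open>The gap of the full product above its value at the square\<close>

text \<open>The pair belongs to two unit vectors, one on each axis. The tangent bound is used for
  the shrinking exponential and a quadratic Taylor bound for the growing one: first-order terms give
  the factor -1, the quadratic term gives \<open>p / (2 * t)\<close>. The result is a genuine gain
  once \<open>p > 2 * t\<close>.\<close>

lemma exp_pair_lower:
  fixes p t :: real
  assumes "p \<ge> 0" "t \<ge> 1"
  shows "exp (- p) * (p * ((t - 1)\<^sup>2 / t) * (p / (2 * t) - 1)) \<le> exp (- (p * t)) + exp (- (p / t)) - 2 * exp (- p)"
proof -
  define v where "v = p * (1 - 1 / t)"
  have v: "v \<ge> 0" using assms by (simp add: v_def)
  have "p * ((t - 1)\<^sup>2 / t) * (p / (2 * t) - 1) = (1 - p * (t - 1)) + (1 + v + v\<^sup>2 / 2) - 2"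
    using assms by (simp add: v_def field_simps power2_eq_square)
  also have "\<dots> \<le> exp (- (p * (t - 1))) + exp v - 2"
    using exp_ge_add_one_self[of "- (p * (t - 1))"] exp_lower_Taylor_quadratic[OF v] by simp
  finally have "exp (- p) * (p * ((t - 1)\<^sup>2 / t) * (p / (2 * t) - 1)) \<le>
      exp (- p) * (exp (- (p * (t - 1))) + exp v - 2)" by (intro mult_left_mono) auto
  also have "\<dots> = exp (- p) * exp (- (p * (t - 1))) + exp (- p) * exp v - 2 * exp (- p)"
    by (simp add: algebra_simps)
  also have "exp (- p) * exp (- (p * (t - 1))) = exp (- (p * t))"
    by (simp add: exp_add[symmetric] algebra_simps)
  also have "exp (- p) * exp v = exp (- (p / t))"
    by (simp add: exp_add[symmetric] algebra_simps v_def)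
  finally show ?thesis .
qed

text \<open>The numbers are tuned to \<open>dtheta_far\<close>, where 2 * 2.113 = 4.226 has to
  exceed 4.206.\<close>

lemma exp_numeric: "exp (- 3) \<le> (10 / 199 :: real)" "exp (3 / 4) \<ge> (2113 / 1000 :: real)"
proof -
  \<comment> \<open>\<open>145 / 128 = 1 + 1 / 8 + (1 / 8)\<^sup>2 / 2\<close>\<close>
  have "(145 / 128 :: real) \<le> exp (1 / 8)"
    using exp_lower_Taylor_quadratic[of "1 / 8"] by (simp add: power2_eq_square)
  then have le: "(145 / 128 :: real) ^ n \<le> exp (1 / 8) ^ n" for n by (intro power_mono) auto
  have "(199 / 10 :: real) \<le> (145 / 128) ^ 24" by (simp add: eval_nat_numeral)
  also have "\<dots> \<le> exp 3" using le[of 24] by (simp add: exp_of_nat_mult[symmetric])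
  finally show "exp (- 3) \<le> (10 / 199 :: real)" by (simp add: exp_minus field_simps)
  have "(2113 / 1000 :: real) \<le> (145 / 128) ^ 6" by (simp add: eval_nat_numeral)
  also have "\<dots> \<le> exp (3 / 4)" using le[of 6] by (simp add: exp_of_nat_mult[symmetric])
  finally show "exp (3 / 4) \<ge> (2113 / 1000 :: real)" .
qed

lemma geometric_has_sum:
  fixes r :: real assumes "0 \<le> r" "r < 1"
  shows "((\<lambda>n::nat. r ^ n) has_sum (1 / (1 - r))) UNIV"
  using assms by (intro sums_nonneg_imp_has_sum geometric_sums) auto

text \<open>Beyond the first term the sums are negligible for \<open>p \<ge> 3\<close>: the square
  of \<open>n + 1\<close> is at least \<open>1 + 3 * n\<close> in the exponent and at most
  \<open>4 ^ n\<close> as a coefficient, which leaves geometric series of ratio r and 4r.\<close>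

lemma pos_bounds:
  assumes p: "p \<ge> 3"
  shows "theta_pos p \<le> (1001 / 1000) * exp (- p)"
    "(\<lambda>n::nat. (real n + 1)\<^sup>2 * exp (- p * (real n + 1)\<^sup>2)) summable_on UNIV"
    "(\<Sum>\<^sub>\<infinity>n::nat. (real n + 1)\<^sup>2 * exp (- p * (real n + 1)\<^sup>2)) \<le> (1001 / 1000) * exp (- p)"
proof -
  define r where "r = exp (- 3 * p)"
  have "exp (- 3 * p) = exp (- p) ^ 3" by (simp add: exp_of_nat_mult[symmetric])
  also have "\<dots> \<le> (10 / 199) ^ 3"
  proof (rule power_mono)
    have "exp (- p) \<le> exp (- 3)" using p by simp
    then show "exp (- p) \<le> 10 / 199" using exp_numeric(1) by linarith
  qed simp
  \<comment> \<open>Four times the cube of 10/199 is about 0.00051, and 1/1900 is small enough for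
    \<open>1 / (1 - 4 * r)\<close> to stay below 1.001.\<close>
  finally have r: "0 \<le> r" "4 * r \<le> 1 / 1900" by (simp_all add: r_def eval_nat_numeral)
  have term_le: "exp (- p * (real n + 1)\<^sup>2) \<le> exp (- p) * r ^ n" for n
  proof -
    have "real n \<le> (real n)\<^sup>2" by (cases n) (auto simp: power2_eq_square)
    then have "p * (1 + 3 * real n) \<le> p * (real n + 1)\<^sup>2"
      using p by (intro mult_left_mono) (auto simp: power2_eq_square algebra_simps)
    moreover have "exp (- p) * r ^ n = exp (- (p * (1 + 3 * real n)))"
      by (simp add: r_def exp_of_nat_mult[symmetric] exp_add[symmetric] algebra_simps)
    ultimately show ?thesis by simp
  qed
  have "theta_pos p \<le> exp (- p) * (1 / (1 - r))"
    using p r by (intro has_sum_mono[OF pos.theta_has_sum has_sum_cmult_right[OF geometric_has_sum]] term_le) auto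
  also have "\<dots> \<le> exp (- p) * (1001 / 1000)" using r by (intro mult_left_mono) (auto simp: field_simps)
  finally show "theta_pos p \<le> (1001 / 1000) * exp (- p)" by simp
  have pow4: "(real n + 1)\<^sup>2 \<le> 4 ^ n" for n
  proof (induction n)
    case (Suc n)
    have "(real (Suc n) + 1)\<^sup>2 \<le> 4 * (real n + 1)\<^sup>2" by (simp add: power2_eq_square algebra_simps)
    also have "\<dots> \<le> 4 ^ Suc n" using Suc by simp
    finally show ?case .
  qed simp
  have g: "((\<lambda>n::nat. exp (- p) * (4 * r) ^ n) has_sum (exp (- p) * (1 / (1 - 4 * r)))) UNIV"
    using r by (intro has_sum_cmult_right geometric_has_sum) auto
  have term_le': "(real n + 1)\<^sup>2 * exp (- p * (real n + 1)\<^sup>2) \<le> exp (- p) * (4 * r) ^ n" for n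
  proof -
    have "(real n + 1)\<^sup>2 * exp (- p * (real n + 1)\<^sup>2) \<le> 4 ^ n * (exp (- p) * r ^ n)"
      by (intro mult_mono pow4 term_le) auto
    then show ?thesis by (simp add: power_mult_distrib mult_ac)
  qed
  show s: "(\<lambda>n::nat. (real n + 1)\<^sup>2 * exp (- p * (real n + 1)\<^sup>2)) summable_on UNIV"
    by (rule summable_on_comparison_test[OF has_sum_imp_summable[OF g] term_le']) auto
  have "(\<Sum>\<^sub>\<infinity>n::nat. (real n + 1)\<^sup>2 * exp (- p * (real n + 1)\<^sup>2)) \<le> exp (- p) * (1 / (1 - 4 * r))"
    by (rule has_sum_mono[OF has_sum_infsum[OF s] g term_le'])
  also have "\<dots> \<le> exp (- p) * (1001 / 1000)" using r by (intro mult_left_mono) (auto simp: field_simps)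
  finally show "(\<Sum>\<^sub>\<infinity>n::nat. (real n + 1)\<^sup>2 * exp (- p * (real n + 1)\<^sup>2)) \<le> (1001 / 1000) * exp (- p)" by simp
qed

lemma exp_le_pos_theta:
  assumes "s > 0"
  shows "exp (- s) \<le> theta_pos s"
proof -
  have "(\<Sum>n\<in>{0::nat}. exp (- s * (real n + 1)\<^sup>2)) \<le> theta_pos s"
    unfolding pos.theta_def by (intro finite_sum_le_infsum pos.summable assms) auto
  then show ?thesis by simp
qed

lemma dtheta_expand:
  assumes "p > 0" "t > 0"
  shows "dtheta_full p t = 1 + 2 * (theta_pos (p * t) + theta_pos (p / t)) + 4 * dtheta_pos p t"
  using assms by (simp add: full.dtheta_eq pos.dtheta_eq theta_split algebra_simps)

text \<open>The two shortest vectors suffice: from t = 4/3 on they contribute \<open>2 * exp (- (p /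
  t)) \<ge> 2 * exp (p / 4) * x \<ge> 4.226 * x\<close> with \<open>x = exp (- p)\<close>, more than
  the whole excess over 1 at the square, which is at most 4.206 x. The difference 0.02 is the
  constant 1/50.\<close>

lemma dtheta_far:
  assumes p: "p \<ge> 3" and t: "t \<ge> 4 / 3"
  shows "dtheta_full p 1 + exp (- p) / 50 \<le> dtheta_full p t"
proof -
  define x where "x = exp (- p)"
  define S where "S = theta_pos p"
  have pt: "0 < p" "0 < t" using p t by auto
  have x: "0 < x" "x \<le> 10 / 199"
  proof -
    have "exp (- p) \<le> exp (- 3)" using p by simp
    then show "x \<le> 10 / 199" using exp_numeric(1) unfolding x_def by linarith
  qed (simp add: x_def)
  have S: "S \<le> (1001 / 1000) * x" "0 \<le> S" using pos_bounds(1)[OF p] exp_le_pos_theta[OF pt(1)] x by (auto simp: S_def x_def)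
  have S_small: "S \<le> (504 / 10000)" using S(1) x(2) by simp
  have "S * S \<le> (504 / 10000) * S" using S S_small by (intro mult_right_mono) auto
  then have S2: "4 * S + 4 * (S * S) \<le> (4206 / 1000) * x" using S x by simp
  have "p / t \<le> 3 * p / 4" using p t by (simp add: field_simps)
  then have "exp (- (3 * p / 4)) \<le> exp (- (p / t))" by simp
  also have "exp (- (3 * p / 4)) = x * exp (p / 4)" by (simp add: x_def exp_add[symmetric])
  finally have "x * exp (p / 4) \<le> exp (- (p / t))" .
  moreover have "exp (3 / 4) \<le> exp (p / 4)" using p by simp
  then have "(2113 / 1000) \<le> exp (p / 4)" using exp_numeric(2) by linarith
  then have "x * (2113 / 1000) \<le> x * exp (p / 4)" using x by (intro mult_left_mono) auto
  ultimately have "(2113 / 1000) * x \<le> theta_pos (p / t)" using exp_le_pos_theta[of "p / t"] pt by simp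
  moreover have "0 \<le> theta_pos (p * t)" using pt
    by (intro order_trans[OF _ exp_le_pos_theta]) auto
  ultimately have "1 + 2 * (2113 / 1000 * x) \<le> dtheta_full p t"
    using dtheta_expand[OF pt] pos.dtheta_nonneg[of p t] by simp
  moreover have "dtheta_full p 1 = 1 + (4 * S + 4 * (S * S))"
    using pt by (simp add: dtheta_expand pos.dtheta_eq S_def)
  ultimately show ?thesis using S2 x unfolding x_def[symmetric] by simp
qed

text \<open>The axes gain and the open quadrants may lose, both in proportion to
  \<open>(t - 1)\<^sup>2 / t\<close>. The gain is of order exp(-p), the loss of order exp(-2p).
  Every pair of axis terms gains, so the unit vectors alone bound the gain from below.\<close>

lemma dtheta_near:
  assumes p: "p \<ge> 3" and t: "1 \<le> t" "t \<le> 4 / 3"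
  shows "dtheta_full p 1 + exp (- p) / 50 * ((t - 1)\<^sup>2 / t) \<le> dtheta_full p t"
proof -
  define x where "x = exp (- p)"
  define S where "S = theta_pos p"
  define M where "M = (\<Sum>\<^sub>\<infinity>n::nat. (real n + 1)\<^sup>2 * exp (- p * (real n + 1)\<^sup>2))"
  define D where "D = (t - 1)\<^sup>2 / t"
  have pt: "0 < p" "0 < t" using p t by auto
  have D: "0 \<le> D" using t by (simp add: D_def)
  have x: "0 < x" "x \<le> 10 / 199"
  proof -
    have "exp (- p) \<le> exp (- 3)" using p by simp
    then show "x \<le> 10 / 199" using exp_numeric(1) unfolding x_def by linarith
  qed (simp add: x_def)
  have S: "S \<le> (1001 / 1000) * x" "0 \<le> S" using pos_bounds(1)[OF p] exp_le_pos_theta[OF pt(1)] x by (auto simp: S_def x_def)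
  have M: "M \<le> (1001 / 1000) * x" "0 \<le> M" using pos_bounds(3)[OF p] by (auto simp: M_def x_def intro!: infsum_nonneg)
  have SM: "S * M \<le> (505 / 10000) * x"
  proof -
    have "S * M \<le> (504 / 10000) * (1001 / 1000 * x)" using S M x by (intro mult_mono) auto
    then show ?thesis using x by simp
  qed
  have gain: "x * (p * D / 8) \<le> theta_pos (p * t) + theta_pos (p / t) - 2 * theta_pos p"
  proof -
    let ?g = "\<lambda>n::nat. exp (- (p * t) * (real n + 1)\<^sup>2) + exp (- (p / t) * (real n + 1)\<^sup>2) + - 2 * exp (- p * (real n + 1)\<^sup>2)"
    have h: "(?g has_sum (theta_pos (p * t) + theta_pos (p / t) + - 2 * theta_pos p)) UNIV"
      using pt by (intro has_sum_add has_sum_cmult_right pos.theta_has_sum) auto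
    have lower: "exp (- (p * (real n + 1)\<^sup>2)) * (p * (real n + 1)\<^sup>2 * D * (1 / 8)) \<le> ?g n" for n
    proof -
      let ?P = "p * (real n + 1)\<^sup>2"
      have "1 \<le> (real n + 1)\<^sup>2" by simp
      then have P: "3 \<le> ?P" using p mult_mono[of 3 p 1 "(real n + 1)\<^sup>2"] by simp
      \<comment> \<open>\<open>?P \<ge> 3\<close> and \<open>t \<le> 4 / 3\<close> give
        \<open>?P / (2 * t) \<ge> 9 / 8\<close>; this is what limits the range of t.\<close>
      have "1 / 8 \<le> ?P / (2 * t) - 1" using P t by (simp add: field_simps)
      then have "exp (- ?P) * (?P * D * (1 / 8)) \<le> exp (- ?P) * (?P * D * (?P / (2 * t) - 1))"
        using P D by (intro mult_left_mono) auto
      also have "\<dots> \<le> exp (- (?P * t)) + exp (- (?P / t)) - 2 * exp (- ?P)"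
        unfolding D_def using P t by (intro exp_pair_lower) auto
      also have "\<dots> = ?g n" by (simp add: mult_ac)
      finally show ?thesis .
    qed
    have "0 \<le> ?g n" for n by (rule order_trans[OF _ lower]) (use pt D in simp)
    then have "(\<Sum>n\<in>{0}. ?g n) \<le> theta_pos (p * t) + theta_pos (p / t) + - 2 * theta_pos p"
      by (intro finite_sum_le_has_sum[OF h]) auto
    then show ?thesis using lower[of 0] by (simp add: x_def)
  qed
  have mom: "(\<Sum>\<^sub>\<infinity>(m, n)\<in>UNIV \<times> UNIV. p * ((real m + 1)\<^sup>2 + (real n + 1)\<^sup>2) *
      exp (- p * ((real m + 1)\<^sup>2 + (real n + 1)\<^sup>2))) = p * (2 * S * M)"
  proof (rule infsumI)
    have hS: "((\<lambda>n::nat. exp (- p * (real n + 1)\<^sup>2)) has_sum S) UNIV"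
      unfolding S_def by (rule pos.theta_has_sum[OF pt(1)])
    have hM: "((\<lambda>n::nat. (real n + 1)\<^sup>2 * exp (- p * (real n + 1)\<^sup>2)) has_sum M) UNIV"
      unfolding M_def by (rule has_sum_infsum[OF pos_bounds(2)[OF p]])
    have "((\<lambda>z. p * ((case z of (m, n) \<Rightarrow> ((real m + 1)\<^sup>2 * exp (- p * (real m + 1)\<^sup>2)) * exp (- p * (real n + 1)\<^sup>2))
       + (case z of (m, n) \<Rightarrow> exp (- p * (real m + 1)\<^sup>2) * ((real n + 1)\<^sup>2 * exp (- p * (real n + 1)\<^sup>2)))))
       has_sum (p * (M * S + S * M))) (UNIV \<times> UNIV)"
      by (intro has_sum_cmult_right has_sum_add has_sum_product_abs hS hM)
    moreover have "p * ((case z of (m, n) \<Rightarrow> ((real m + 1)\<^sup>2 * exp (- p * (real m + 1)\<^sup>2)) * exp (- p * (real n + 1)\<^sup>2))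
       + (case z of (m, n) \<Rightarrow> exp (- p * (real m + 1)\<^sup>2) * ((real n + 1)\<^sup>2 * exp (- p * (real n + 1)\<^sup>2))))
      = (case z of (m, n) \<Rightarrow> p * ((real m + 1)\<^sup>2 + (real n + 1)\<^sup>2) *
      exp (- p * ((real m + 1)\<^sup>2 + (real n + 1)\<^sup>2)))" for z :: "nat \<times> nat"
    proof -
      have "p * ((a * exp (- p * a)) * exp (- p * b) + exp (- p * a) * (b * exp (- p * b))) =
        p * (a + b) * exp (- p * (a + b))" for a b
      proof -
        have "exp (- p * (a + b)) = exp (- p * a) * exp (- p * b)"
          by (simp add: exp_add[symmetric] algebra_simps)
        then show ?thesis by (simp only:) (simp add: algebra_simps)
      qed
      then show ?thesis unfolding case_prod_unfold .
    qed
    ultimately show "((\<lambda>(m, n). p * ((real m + 1)\<^sup>2 + (real n + 1)\<^sup>2) *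
      exp (- p * ((real m + 1)\<^sup>2 + (real n + 1)\<^sup>2))) has_sum p * (2 * S * M)) (UNIV \<times> UNIV)"
      by (simp add: mult_ac)
  qed
  have loss: "dtheta_pos p 1 - D / 2 * (p * (2 * S * M)) \<le> dtheta_pos p t"
    using pos.dtheta_lower[OF pt] unfolding mom by (simp add: D_def)
  define y where "y = x * (p * D)"
  define Z where "Z = D / 2 * (p * (2 * S * M))"
  have "D / 2 * (p * (2 * S * M)) = (p * D) * (S * M)" by simp
  also have "\<dots> \<le> (p * D) * (505 / 10000 * x)" using SM pt D by (intro mult_left_mono) auto
  finally have "Z \<le> 505 / 10000 * y" by (simp add: y_def Z_def mult_ac)
  moreover have "y / 8 \<le> theta_pos (p * t) + theta_pos (p / t) - 2 * theta_pos p"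
    using gain by (simp add: y_def)
  moreover have "dtheta_full p 1 = 1 + 4 * theta_pos p + 4 * dtheta_pos p 1"
    using dtheta_expand[OF pt(1), of 1] by simp
  moreover have "0 \<le> y" using pt x D by (simp add: y_def)
  \<comment> \<open>The gain is 2 * y / 8 = 0.25 y and the loss at most 4 * 0.0505 y = 0.202
    y.\<close>
  ultimately have "dtheta_full p 1 + (4 / 100) * y \<le> dtheta_full p t"
    using loss dtheta_expand[OF pt] unfolding Z_def[symmetric] by argo
  moreover have "x * D * 1 \<le> x * D * p" using p x D by (intro mult_left_mono) auto
  then have "x * D \<le> y" by (simp add: y_def mult_ac)
  moreover have "0 \<le> x * D" using x D by simp
  ultimately show ?thesis unfolding x_def[symmetric] D_def[symmetric] by simp
qed

lemma dtheta_gap_ge3: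
  assumes "p \<ge> 3"
  shows "\<exists>c>0. \<forall>t\<ge>1. dtheta_full p 1 + c * min 1 ((t - 1)\<^sup>2 / t) \<le> dtheta_full p t"
proof (intro exI conjI allI impI)
  fix t :: real assume t: "1 \<le> t"
  have m: "exp (- p) / 50 * min 1 D \<le> exp (- p) / 50 * 1" "exp (- p) / 50 * min 1 D \<le> exp (- p) / 50 * D" for D
    by (intro mult_left_mono; simp)+
  show "dtheta_full p 1 + exp (- p) / 50 * min 1 ((t - 1)\<^sup>2 / t) \<le> dtheta_full p t"
  proof (cases "t \<le> 4 / 3")
    case True
    then show ?thesis using dtheta_near[OF assms t] m(2)[of "(t - 1)\<^sup>2 / t"] by linarith
  next
    case False
    then show ?thesis using dtheta_far[OF assms, of t] m(1)[of "(t - 1)\<^sup>2 / t"] by linarith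
  qed
qed simp

lemma dtheta_gap:
  assumes "p > 0"
  shows "\<exists>c>0. \<forall>t\<ge>1. dtheta_full p 1 + c * min 1 ((t - 1)\<^sup>2 / t) \<le> dtheta_full p t"
proof (cases "p \<ge> 3")
  case False
  have "pi\<^sup>2 / p \<ge> 3"
  proof -
    have "3 * 3 \<le> pi * pi" using pi_gt3 by (intro mult_mono) auto
    then show ?thesis using False assms by (simp add: power2_eq_square field_simps)
  qed
  then obtain c where c: "c > 0" "\<And>t. t \<ge> 1 \<Longrightarrow> dtheta_full (pi\<^sup>2 / p) 1 + c * min 1 ((t - 1)\<^sup>2 / t) \<le> dtheta_full (pi\<^sup>2 / p) t"
    using dtheta_gap_ge3 by blast
  show ?thesis
  proof (intro exI conjI allI impI)
    show "pi / p * c > 0" using assms c by simp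
    fix t :: real assume t: "1 \<le> t"
    have "pi / p * (dtheta_full (pi\<^sup>2 / p) 1 + c * min 1 ((t - 1)\<^sup>2 / t)) \<le> pi / p * dtheta_full (pi\<^sup>2 / p) t"
      using c(2)[OF t] assms by (intro mult_left_mono) auto
    then show "dtheta_full p 1 + pi / p * c * min 1 ((t - 1)\<^sup>2 / t) \<le> dtheta_full p t"
      using dtheta_dual[OF assms, of 1] dtheta_dual[OF assms, of t] t by (simp add: distrib_left mult.assoc)
  qed
qed (rule dtheta_gap_ge3)

section \<open>The alternating theta product\<close>

definition theta_alt :: "real \<Rightarrow> real" where
  "theta_alt s = (\<Sum>\<^sub>\<infinity>n::int. (-1) powi n * exp (- s * (of_int n)\<^sup>2))"

definition dtheta_alt :: "real \<Rightarrow> real \<Rightarrow> real" where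
  "dtheta_alt q t = (\<Sum>\<^sub>\<infinity>(m, n)\<in>UNIV \<times> UNIV.
     (-1) powi (m + n) * exp (- q * ((of_int m)\<^sup>2 * t + (of_int n)\<^sup>2 / t)))"

lemma minus_one_powi_int: "(-1 :: real) powi n = (if even n then 1 else -1)"
  by (simp add: power_int_minus_left)

lemma cos_pi_times_int: "cos (pi * of_int n) = (-1) powi n"
proof (cases "even n")
  case True
  then obtain k where "n = 2 * k" by (elim evenE)
  then have "cos (pi * of_int n) = cos (2 * of_int k * pi)" by (simp add: mult_ac)
  then show ?thesis using True cos_one_2pi_int[of "2 * of_int k * pi"]
    by (simp add: minus_one_powi_int)
next
  case False
  then obtain k where "n = 2 * k + 1" by (elim oddE)
  then have "cos (pi * of_int n) = cos (2 * of_int k * pi + pi)" by (simp add: algebra_simps)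
  moreover have "cos (2 * of_int k * pi) = 1"
    using cos_one_2pi_int[of "2 * of_int k * pi"] by (metis mult.commute mult.left_commute)
  ultimately show ?thesis using False by (simp add: minus_one_powi_int)
qed

lemma theta_alt_has_sum:
  assumes "s > 0"
  shows "((\<lambda>n::int. (-1) powi n * exp (- s * (of_int n)\<^sup>2)) has_sum theta_alt s) UNIV"
  unfolding theta_alt_def
proof (rule has_sum_infsum)
  have "(\<lambda>n::int. norm ((-1) powi n * exp (- s * (of_int n)\<^sup>2))) summable_on UNIV"
  proof -
    have "norm ((-1) powi n * exp (- s * (of_int n)\<^sup>2)) = exp (- s * (of_int n)\<^sup>2)" for n :: int
      by (cases "even n") (simp_all add: minus_one_powi_int)
    then show ?thesis using full.summable[OF assms] by (simp only:)
  qed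
  then show "(\<lambda>n::int. (-1) powi n * exp (- s * (of_int n)\<^sup>2)) summable_on UNIV"
    by (rule summable_on_iff_abs_summable_on_real[THEN iffD2])
qed

lemma dtheta_alt_has_sum:
  assumes "q > 0" "t > 0"
  shows "((\<lambda>(m, n). (-1::real) powi (m + n) * exp (- q * ((of_int m)\<^sup>2 * t + (of_int n)\<^sup>2 / t)))
    has_sum theta_alt (q * t) * theta_alt (q / t)) (UNIV \<times> UNIV)"
proof -
  have "((\<lambda>(m, n). ((-1) powi m * exp (- (q * t) * (of_int m)\<^sup>2)) * ((-1) powi n * exp (- (q / t) * (of_int n)\<^sup>2))) has_sum
      theta_alt (q * t) * theta_alt (q / t)) (UNIV \<times> UNIV)"
    using assms by (intro has_sum_product_abs theta_alt_has_sum) auto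
  moreover have "((-1) powi m * exp (- (q * t) * (of_int m)\<^sup>2)) * ((-1) powi n * exp (- (q / t) * (of_int n)\<^sup>2))
     = (-1) powi (m + n) * exp (- q * ((of_int m)\<^sup>2 * t + (of_int n)\<^sup>2 / t))" for m n :: int
  proof -
    have "exp (- q * ((of_int m)\<^sup>2 * t + (of_int n)\<^sup>2 / t)) =
      exp (- (q * t) * (of_int m)\<^sup>2) * exp (- (q / t) * (of_int n)\<^sup>2)"
      by (simp add: exp_add[symmetric] algebra_simps)
    then show ?thesis by (simp add: power_int_add)
  qed
  ultimately show ?thesis by (simp only:)
qed

lemma dtheta_alt_eq: "q > 0 \<Longrightarrow> t > 0 \<Longrightarrow> dtheta_alt q t = theta_alt (q * t) * theta_alt (q / t)"
  unfolding dtheta_alt_def by (rule infsumI[OF dtheta_alt_has_sum])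

lemma dtheta_alt_summable:
  assumes "q > 0" "t > 0"
  shows "(\<lambda>(m, n). (-1::real) powi (m + n) * exp (- q * ((of_int m)\<^sup>2 * t + (of_int n)\<^sup>2 / t))) summable_on UNIV \<times> UNIV"
  using dtheta_alt_has_sum[OF assms] by (rule has_sum_imp_summable)

lemma dtheta_alt_inverse: "q > 0 \<Longrightarrow> t > 0 \<Longrightarrow> dtheta_alt q (1 / t) = dtheta_alt q t"
  by (subst (1 2) dtheta_alt_eq) (simp_all add: mult.commute)

text \<open>Poisson summation at \<open>c = 1 / 2\<close>, where the cosine is the alternating
  sign.\<close>

lemma theta_alt_dual:
  assumes "s > 0"
  shows "theta_alt s = sqrt (pi / s) * theta_half (pi\<^sup>2 / s)"
proof -
  have "theta_half (pi\<^sup>2 / s) = sqrt (s / pi) * theta_alt s"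
  proof -
    have c: "cos (2 * pi * (1 / 2) * of_int \<nu>) = (-1) powi \<nu>" for \<nu> :: int
      using cos_pi_times_int[of \<nu>] by (simp only: mult_ac) simp
    have comm: "exp (- s * (of_int \<nu>)\<^sup>2) * (-1) powi \<nu> = (-1) powi \<nu> * exp (- s * (of_int \<nu>)\<^sup>2)" for \<nu> :: int
      by (rule mult.commute)
    show ?thesis
      using poisson_gauss[of s "1 / 2", OF assms] unfolding half.theta_def theta_alt_def c comm by simp
  qed
  then have "sqrt (pi / s) * theta_half (pi\<^sup>2 / s) = (sqrt (pi / s) * sqrt (s / pi)) * theta_alt s"
    by simp
  also have "sqrt (pi / s) * sqrt (s / pi) = 1"
    using assms by (simp add: real_sqrt_mult[symmetric])
  finally show ?thesis by simp
qed

lemma dtheta_alt_dual: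
  assumes "q > 0" "t > 0"
  shows "dtheta_alt q t = pi / q * dtheta_half (pi\<^sup>2 / q) t"
proof -
  have "dtheta_alt q t = (sqrt (pi / (q * t)) * sqrt (pi / (q / t))) * (theta_half (pi\<^sup>2 / (q * t)) * theta_half (pi\<^sup>2 / (q / t)))"
    using assms theta_alt_dual[of "q * t"] theta_alt_dual[of "q / t"] by (simp add: dtheta_alt_eq)
  also have "sqrt (pi / (q * t)) * sqrt (pi / (q / t)) = sqrt ((pi / q)\<^sup>2)"
    using assms by (simp add: real_sqrt_mult[symmetric] power2_eq_square)
  also have "\<dots> = pi / q" using assms by simp
  also have "theta_half (pi\<^sup>2 / (q * t)) * theta_half (pi\<^sup>2 / (q / t)) = dtheta_half (pi\<^sup>2 / q) t"
    using assms by (simp add: half.dtheta_eq mult.commute)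
  finally show ?thesis .
qed

section \<open>How far the alternating product can drop below its value at the square\<close>

text \<open>This is D(q) of the overview: the coefficient in \<open>half.dtheta_lower'\<close> at
  \<open>pi\<^sup>2 / q\<close>, carried back by duality.\<close>

definition alt_drop :: "real \<Rightarrow> real" where
  "alt_drop q = pi / q * dtheta_half (pi\<^sup>2 / q / 2) 1"

text \<open>Every half-integer has square at least 1/4 (equivalently,
  \<open>n * (n + 1) \<ge> 0\<close>), so raising the parameter multiplies each term by at most
  \<open>exp (- (s' - s) / 4)\<close>.\<close>

lemma theta_half_mono:
  assumes "0 < s" "s \<le> s'"
  shows "theta_half s' \<le> exp (- (s' - s) / 4) * theta_half s"
proof (rule has_sum_mono)
  show "((\<lambda>n::int. exp (- s' * (of_int n + 1 / 2)\<^sup>2)) has_sum theta_half s') UNIV"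
    using assms by (intro half.theta_has_sum) auto
  show "((\<lambda>n::int. exp (- (s' - s) / 4) * exp (- s * (of_int n + 1 / 2)\<^sup>2)) has_sum exp (- (s' - s) / 4) * theta_half s) UNIV"
    using assms by (intro has_sum_cmult_right half.theta_has_sum) auto
  fix n :: int
  have "1 / 4 \<le> (of_int n + 1 / 2 :: real)\<^sup>2"
  proof -
    have "0 \<le> n * (n + 1)" by (simp add: zero_le_mult_iff) linarith
    then have "0 \<le> real_of_int (n * (n + 1))" by (simp only: of_int_0_le_iff)
    then show ?thesis by (simp add: power2_eq_square algebra_simps)
  qed
  then have "(s' - s) * (1 / 4) \<le> (s' - s) * (of_int n + 1 / 2)\<^sup>2"
    using assms by (intro mult_left_mono) auto
  then have "- s' * (of_int n + 1 / 2)\<^sup>2 \<le> - (s' - s) / 4 + - s * (of_int n + 1 / 2)\<^sup>2"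
    unfolding left_diff_distrib by argo
  then show "exp (- s' * (of_int n + 1 / 2)\<^sup>2) \<le> exp (- (s' - s) / 4) * exp (- s * (of_int n + 1 / 2)\<^sup>2)"
    by (simp only: exp_add[symmetric] exp_le_cancel_iff)
qed

lemma theta_half_nonneg: "0 \<le> theta_half s"
  unfolding half.theta_def by (intro infsum_nonneg) auto

lemma dtheta_half_1: "s > 0 \<Longrightarrow> dtheta_half s 1 = (theta_half s)\<^sup>2"
  by (simp add: half.dtheta_eq power2_eq_square)

lemma alt_drop_nonneg: "q > 0 \<Longrightarrow> 0 \<le> alt_drop q"
  by (simp add: alt_drop_def half.dtheta_nonneg)

text \<open>On the dual side the small-deviation range is the symmetrized bound. Where the minimum
  is 1, positivity of the dual product does it: the drop cannot exceed the value at the square,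
  which is at most the one at half the parameter.\<close>

lemma dtheta_alt_lower:
  assumes q: "q > 0" and t: "t > 0"
  shows "dtheta_alt q 1 - alt_drop q * min 1 ((t - 1)\<^sup>2 / t) \<le> dtheta_alt q t"
proof -
  define A where "A = pi\<^sup>2 / q"
  have A: "A > 0" using q by (simp add: A_def)
  have k: "0 < pi / q" using q by simp
  have "theta_half A \<le> exp (- (A - A / 2) / 4) * theta_half (A / 2)"
    using A by (intro theta_half_mono) auto
  also have "\<dots> \<le> 1 * theta_half (A / 2)"
    using A by (intro mult_right_mono theta_half_nonneg) auto
  finally have le: "dtheta_half A 1 \<le> dtheta_half (A / 2) 1"
    using A by (simp add: dtheta_half_1 power_mono theta_half_nonneg)
  have "dtheta_half A 1 - dtheta_half (A / 2) 1 * min 1 ((t - 1)\<^sup>2 / t) \<le> dtheta_half A t"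
  proof (cases "(t - 1)\<^sup>2 / t \<le> 1")
    case True
    have "(t - 1)\<^sup>2 / (2 * t) * dtheta_half (A / 2) 1 \<le> (t - 1)\<^sup>2 / t * dtheta_half (A / 2) 1"
      using t by (intro mult_right_mono half.dtheta_nonneg) (simp add: field_simps)
    then show ?thesis using half.dtheta_lower'[OF A t] True by (simp add: mult.commute)
  next
    case False
    then show ?thesis using le half.dtheta_nonneg[of A t] by simp
  qed
  then have "pi / q * (dtheta_half A 1 - dtheta_half (A / 2) 1 * min 1 ((t - 1)\<^sup>2 / t)) \<le> pi / q * dtheta_half A t"
    using k by (intro mult_left_mono) auto
  then show ?thesis
    using dtheta_alt_dual[OF q t] dtheta_alt_dual[OF q, of 1]
    by (simp add: alt_drop_def A_def right_diff_distrib mult.assoc)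
qed

text \<open>Comparing the dual parameter \<open>B = pi\<^sup>2 / (2 * q)\<close> with 1 in
  \<open>theta_half_mono\<close> yields a factor \<open>exp (- (B - 1) / 2)\<close>, which overcomes
  the prefactor \<open>pi / q\<close> as q tends to 0.\<close>

lemma alt_drop_small:
  assumes "c > 0"
  shows "\<exists>q0>0. \<forall>q. 0 < q \<and> q < q0 \<longrightarrow> alt_drop q < c"
proof -
  define K where "K = (theta_half 1)\<^sup>2"
  have "((\<lambda>q. pi / q * (exp (- (pi\<^sup>2 / q / 2 - 1) / 2) * K)) \<longlongrightarrow> 0) (at_right 0)"
    by real_asymp
  then have "\<forall>\<^sub>F q in at_right 0. pi / q * (exp (- (pi\<^sup>2 / q / 2 - 1) / 2) * K) < c"
    using assms by (rule order_tendstoD(2))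
  then obtain b where b: "b > 0" "\<And>q. 0 < q \<Longrightarrow> q < b \<Longrightarrow> pi / q * (exp (- (pi\<^sup>2 / q / 2 - 1) / 2) * K) < c"
    unfolding eventually_at_right_field by blast
  show ?thesis
  proof (intro exI conjI allI impI)
    show "min b 1 > 0" using b by simp
    fix q :: real assume "0 < q \<and> q < min b 1"
    then have q: "0 < q" "q < b" "q < 1" by auto
    define B where "B = pi\<^sup>2 / q / 2"
    have "1 * 2 \<le> 3 * (3::real)" by simp
    also have "\<dots> \<le> pi * pi" using pi_gt3 by (intro mult_mono) auto
    finally have "B \<ge> 1" using q by (simp add: B_def power2_eq_square field_simps)
    then have "theta_half B \<le> exp (- (B - 1) / 4) * theta_half 1" by (intro theta_half_mono) auto
    then have "(theta_half B)\<^sup>2 \<le> (exp (- (B - 1) / 4) * theta_half 1)\<^sup>2"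
      by (intro power_mono theta_half_nonneg)
    also have "\<dots> = exp (- (B - 1) / 2) * K"
      by (simp add: K_def power_mult_distrib exp_double[symmetric])
    finally have "pi / q * dtheta_half B 1 \<le> pi / q * (exp (- (B - 1) / 2) * K)"
      using q \<open>B \<ge> 1\<close> by (intro mult_left_mono) (auto simp: dtheta_half_1)
    also have "\<dots> < c" using b(2)[OF q(1,2)] by (simp add: B_def)
    finally show "alt_drop q < c" by (simp add: alt_drop_def B_def)
  qed
qed

section \<open>Second-order upper bounds near the square lattice\<close>

lemma exp_upper_quadratic:
  fixes u w :: real
  assumes "\<bar>u\<bar> \<le> w"
  shows "exp u \<le> 1 + u + w\<^sup>2 / 2 * exp w"
proof -
  obtain \<xi> where \<xi>: "\<bar>\<xi>\<bar> \<le> \<bar>u\<bar>" "exp u = (\<Sum>m<2. u ^ m / fact m) + exp \<xi> / fact 2 * u ^ 2"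
    using Maclaurin_exp_le[of u 2] by blast
  have "exp \<xi> * u\<^sup>2 \<le> exp w * w\<^sup>2"
    using \<xi>(1) assms by (intro mult_mono) (auto simp: abs_le_square_iff[symmetric])
  then show ?thesis using \<xi>(2) by (simp add: eval_nat_numeral algebra_simps)
qed

text \<open>The first-order changes u and v have sum at most 0, so only the Taylor remainders are
  left. Both are controlled by the same w because \<open>1 - 1 / t \<le> t - 1\<close>.\<close>

lemma exp_sym_upper:
  fixes q t a b :: real
  assumes "0 \<le> q" "0 \<le> a" "0 \<le> b" "1 \<le> t"
  shows "exp (- q * (a * t + b / t)) + exp (- q * (b * t + a / t))
    \<le> exp (- q * (a + b)) * (2 + (q * (a + b) * (t - 1))\<^sup>2 * exp (q * (a + b) * (t - 1)))"
proof -
  define u where "u = - q * (a * t + b / t - (a + b))"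
  define v where "v = - q * (b * t + a / t - (a + b))"
  define w where "w = q * (a + b) * (t - 1)"
  define E where "E = exp (- q * (a + b))"
  have "u + v = - (q * (a + b) * ((t - 1)\<^sup>2 / t))"
    using assms by (simp add: u_def v_def field_simps power2_eq_square)
  then have sum: "u + v \<le> 0" using assms by simp
  have s: "0 \<le> 1 - 1 / t" "1 - 1 / t \<le> t - 1"
  proof -
    have "0 \<le> (t - 1)\<^sup>2 / t" using assms by simp
    also have "(t - 1)\<^sup>2 / t = t - 2 + 1 / t" using assms by (simp add: field_simps power2_eq_square)
    finally show "1 - 1 / t \<le> t - 1" by simp
  qed (use assms in \<open>simp add: field_simps\<close>)
  have bound: "\<bar>q * (c * (t - 1) - d * (1 - 1 / t))\<bar> \<le> q * (c + d) * (t - 1)" if "0 \<le> c" "0 \<le> d" for c d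
  proof -
    have "d * (1 - 1 / t) \<le> d * (t - 1)" "0 \<le> d * (1 - 1 / t)" "0 \<le> c * (t - 1)"
      using s that assms by (auto intro: mult_left_mono)
    then have "\<bar>c * (t - 1) - d * (1 - 1 / t)\<bar> \<le> (c + d) * (t - 1)"
      unfolding distrib_right by linarith
    then have "q * \<bar>c * (t - 1) - d * (1 - 1 / t)\<bar> \<le> q * ((c + d) * (t - 1))"
      using assms by (intro mult_left_mono)
    then show ?thesis using assms by (simp add: abs_mult mult.assoc)
  qed
  have "u = - (q * (a * (t - 1) - b * (1 - 1 / t)))" "v = - (q * (b * (t - 1) - a * (1 - 1 / t)))"
    by (simp_all add: u_def v_def algebra_simps)
  then have "\<bar>u\<bar> \<le> w" "\<bar>v\<bar> \<le> w"
    using bound[OF assms(2,3)] bound[OF assms(3,2)] by (simp_all add: w_def add.commute)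
  from this[THEN exp_upper_quadratic] have "exp u + exp v \<le> 2 + w\<^sup>2 * exp w" using sum by simp
  then have "E * (exp u + exp v) \<le> E * (2 + w\<^sup>2 * exp w)" by (intro mult_left_mono) (simp_all add: E_def)
  moreover have "exp (- q * (a * t + b / t)) = E * exp u" "exp (- q * (b * t + a / t)) = E * exp v"
    unfolding exp_add[symmetric] u_def v_def E_def by (simp_all add: algebra_simps)
  ultimately show ?thesis by (simp add: E_def w_def distrib_left)
qed

text \<open>The unsigned contribution of a point and its mirror image to twice the difference
  between t and 1.\<close>

definition pair_diff :: "real \<Rightarrow> real \<Rightarrow> real \<Rightarrow> real \<Rightarrow> real" where
  "pair_diff q t a b = exp (- q * (a * t + b / t)) + exp (- q * (b * t + a / t)) + - 2 * exp (- q * (a + b))"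

text \<open>The remainder factor \<open>exp (q * r * (t - 1))\<close>, with
  \<open>r = a + b\<close>, costs at most a share \<eta> of the Gaussian exponent. Of the remaining
  \<open>q * (1 - \<eta>)\<close>, one unit is set aside as \<open>exp (- r)\<close> to keep a sum
  over the lattice convergent independently of q; the rest is evaluated at the shell radius
  k.\<close>

lemma pair_diff_bound:
  assumes q: "0 < q" "1 \<le> q * (1 - \<eta>)" and ab: "0 \<le> a" "0 \<le> b" "1 \<le> a + b" "k \<le> a + b"
    and t: "1 \<le> t" "t \<le> 1 + \<eta>"
  shows "\<bar>pair_diff q t a b\<bar> \<le> (t - 1)\<^sup>2 * q\<^sup>2 * exp (- (q * (1 - \<eta>) - 1) * k) * ((a + b)\<^sup>2 * exp (- (a + b)))"
proof -
  define r where "r = a + b"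
  have r: "1 \<le> r" "k \<le> r" using ab by (auto simp: r_def)
  have \<eta>: "0 \<le> \<eta>" using t by simp
  have "q * (1 - \<eta>) \<le> q * 1" using q \<eta> by (intro mult_left_mono) auto
  then have q1: "1 \<le> q" using q by linarith
  then have qr: "1 \<le> q * r" using r mult_mono[of 1 q 1 r] by simp
  have e: "exp (- q * r) * exp (q * r * (t - 1)) \<le> exp (- (q * (1 - \<eta>) * r))"
  proof -
    have "q * r * (t - 1) \<le> q * r * \<eta>" using t qr by (intro mult_left_mono) auto
    then show ?thesis by (simp add: exp_add[symmetric] algebra_simps)
  qed
  have up: "pair_diff q t a b \<le> (t - 1)\<^sup>2 * (q * r)\<^sup>2 * exp (- (q * (1 - \<eta>) * r))"
  proof -
    have "pair_diff q t a b \<le> exp (- q * r) * (2 + (q * r * (t - 1))\<^sup>2 * exp (q * r * (t - 1))) + - 2 * exp (- q * r)"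
      unfolding pair_diff_def r_def using exp_sym_upper[of q a b t] q ab t by simp
    also have "\<dots> = (t - 1)\<^sup>2 * (q * r)\<^sup>2 * (exp (- q * r) * exp (q * r * (t - 1)))"
      unfolding power_mult_distrib by (simp only: distrib_left) simp
    also have "\<dots> \<le> (t - 1)\<^sup>2 * (q * r)\<^sup>2 * exp (- (q * (1 - \<eta>) * r))"
      by (intro mult_left_mono e) auto
    finally show ?thesis .
  qed
  have low: "- ((t - 1)\<^sup>2 * (q * r)\<^sup>2 * exp (- (q * (1 - \<eta>) * r))) \<le> pair_diff q t a b"
  proof -
    define D where "D = (t - 1)\<^sup>2 / (2 * t)"
    have D: "0 \<le> D" "2 * D \<le> (t - 1)\<^sup>2"
      using t by (simp_all add: D_def divide_le_eq mult_left_le_one_le mult_le_cancel_left1)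
    have "2 * exp (- q * r) * (1 - q * r * D) \<le> pair_diff q t a b + 2 * exp (- q * r)"
      unfolding pair_diff_def r_def D_def using exp_sym_lower[of t q a b] t by simp
    then have 1: "- (2 * D * (q * r) * exp (- q * r)) \<le> pair_diff q t a b"
      by (simp add: algebra_simps)
    have "q * r \<le> (q * r)\<^sup>2" using mult_left_mono[OF qr, of "q * r"] qr by (simp add: power2_eq_square)
    moreover have "exp (- q * r) \<le> exp (- (q * (1 - \<eta>) * r))"
      using q r \<eta> by (simp add: algebra_simps)
    ultimately have "2 * D * (q * r) * exp (- q * r) \<le> (t - 1)\<^sup>2 * (q * r)\<^sup>2 * exp (- (q * (1 - \<eta>) * r))"
      using D qr by (intro mult_mono) auto
    with 1 show ?thesis by linarith
  qed
  have "exp (- (q * (1 - \<eta>) * r)) \<le> exp (- (q * (1 - \<eta>) - 1) * k) * exp (- r)"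
  proof -
    have "(q * (1 - \<eta>) - 1) * k \<le> (q * (1 - \<eta>) - 1) * r" using q r by (intro mult_left_mono) auto
    then have "- (q * (1 - \<eta>) * r) \<le> - (q * (1 - \<eta>) - 1) * k + - r"
      unfolding left_diff_distrib by argo
    then show ?thesis by (simp only: exp_add[symmetric] exp_le_cancel_iff)
  qed
  then have "(t - 1)\<^sup>2 * (q * r)\<^sup>2 * exp (- (q * (1 - \<eta>) * r)) \<le>
    (t - 1)\<^sup>2 * (q * r)\<^sup>2 * (exp (- (q * (1 - \<eta>) - 1) * k) * exp (- r))"
    by (intro mult_left_mono) auto
  also have "\<dots> = (t - 1)\<^sup>2 * q\<^sup>2 * exp (- (q * (1 - \<eta>) - 1) * k) * (r\<^sup>2 * exp (- r))"
    by (simp only: power_mult_distrib mult_ac)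
  finally show ?thesis using up low unfolding r_def by (simp only: abs_le_iff) linarith
qed

lemma pair_diff_0: "pair_diff q t 0 0 = 0"
  by (simp add: pair_diff_def)

text \<open>The finite total over the lattice of the factors in \<open>pair_diff_bound\<close> that
  do not involve q or t.\<close>

definition sq_moment :: real where
  "sq_moment = (\<Sum>\<^sub>\<infinity>(m::int, n::int)\<in>UNIV \<times> UNIV. ((of_int m)\<^sup>2 + (of_int n)\<^sup>2)\<^sup>2 * exp (- ((of_int m)\<^sup>2 + (of_int n)\<^sup>2)))"

lemma sq_moment_has_sum:
  "((\<lambda>(m::int, n::int). ((of_int m)\<^sup>2 + (of_int n)\<^sup>2)\<^sup>2 * exp (- ((of_int m)\<^sup>2 + (of_int n)\<^sup>2)))
    has_sum sq_moment) (UNIV \<times> UNIV)"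
  unfolding sq_moment_def
proof (rule has_sum_infsum, rule summable_on_comparison_test)
  let ?r = "\<lambda>(m::int, n::int). (of_int m)\<^sup>2 + (of_int n)\<^sup>2 :: real"
  show "(\<lambda>z. 16 * (case z of (m, n) \<Rightarrow> exp (- (1 / 2) * ((real_of_int m)\<^sup>2 * 1 + (real_of_int n)\<^sup>2 / 1)))) summable_on (UNIV \<times> UNIV)"
    by (intro summable_on_cmult_right full.dtheta_summable) auto
  fix z :: "int \<times> int"
  have "r\<^sup>2 * exp (- r) \<le> 16 * exp (- (r / 2))" if "0 \<le> r" for r :: real
  proof -
    have "r / 4 \<le> exp (r / 4)" using exp_ge_add_one_self[of "r / 4"] by linarith
    then have "(r / 4)\<^sup>2 \<le> (exp (r / 4))\<^sup>2" using that by (intro power_mono) auto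
    then have "r\<^sup>2 \<le> 16 * exp (r / 2)" by (simp add: power_divide exp_double[symmetric])
    then have "r\<^sup>2 * exp (- r) \<le> 16 * exp (r / 2) * exp (- r)" by (intro mult_right_mono) auto
    also have "\<dots> = 16 * exp (- (r / 2))" by (simp add: exp_add[symmetric])
    finally show ?thesis .
  qed
  from this[of "?r z"] show "(case z of (m, n) \<Rightarrow> ((real_of_int m)\<^sup>2 + (real_of_int n)\<^sup>2)\<^sup>2 * exp (- ((of_int m)\<^sup>2 + (of_int n)\<^sup>2)))
    \<le> 16 * (case z of (m, n) \<Rightarrow> exp (- (1 / 2) * ((real_of_int m)\<^sup>2 * 1 + (real_of_int n)\<^sup>2 / 1)))"
    by (simp add: case_prod_unfold)
qed auto

text \<open>The shells of the square lattice that matter: the origin, the four nearest points, all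
  of charge -1, and everything at squared distance at least 2.\<close>

lemma sum_squares_int_cases:
  fixes m n :: int
  obtains "m = 0" "n = 0" | "odd (m + n)" "m\<^sup>2 = 1 \<and> n = 0 \<or> m = 0 \<and> n\<^sup>2 = 1" | "2 \<le> m\<^sup>2 + n\<^sup>2"
proof (cases "2 \<le> m\<^sup>2 + n\<^sup>2")
  case False
  have sq: "\<bar>k\<bar> \<le> k\<^sup>2" for k :: int
  proof (cases "k = 0")
    case False
    then have "\<bar>k\<bar> * 1 \<le> \<bar>k\<bar> * \<bar>k\<bar>" by (intro mult_left_mono) auto
    then show ?thesis by (simp add: power2_eq_square)
  qed simp
  have "\<bar>m\<bar> + \<bar>n\<bar> \<le> 1" using False sq[of m] sq[of n] by linarith
  then consider "m = 0" "n = 0" | "m = 1 \<or> m = -1" "n = 0" | "m = 0" "n = 1 \<or> n = -1" by linarith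
  then show ?thesis using that by cases auto
qed

lemma dtheta_full_upper:
  assumes p: "0 < p" "1 \<le> p * (1 - \<eta>)" and t: "1 \<le> t" "t \<le> 1 + \<eta>"
  shows "2 * (dtheta_full p t - dtheta_full p 1) \<le> (t - 1)\<^sup>2 * p\<^sup>2 * exp (- (p * (1 - \<eta>) - 1)) * sq_moment"
proof -
  let ?K = "(t - 1)\<^sup>2 * p\<^sup>2 * exp (- (p * (1 - \<eta>) - 1) * 1)"
  have t0: "t > 0" using t by simp
  have "((\<lambda>z. (case z of (m, n) \<Rightarrow> exp (- p * ((of_int m)\<^sup>2 * t + (of_int n)\<^sup>2 / t)) + exp (- p * ((of_int n)\<^sup>2 * t + (of_int m)\<^sup>2 / t)))
      + - 2 * (case z of (m, n) \<Rightarrow> exp (- p * ((of_int m)\<^sup>2 * 1 + (of_int n)\<^sup>2 / 1)))) has_sum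
      (2 * dtheta_full p t + - 2 * dtheta_full p 1)) (UNIV \<times> UNIV :: (int \<times> int) set)"
    unfolding full.dtheta_def infsum_symmetrize(1)[OF full.dtheta_summable[OF p(1) t0]] prod.case
    by (intro has_sum_add has_sum_cmult_right has_sum_infsum full.dtheta_summable p
        infsum_symmetrize(2)[OF full.dtheta_summable[OF p(1) t0], unfolded prod.case]) auto
  moreover have "((\<lambda>z. ?K * (case z of (m::int, n::int) \<Rightarrow> ((of_int m)\<^sup>2 + (of_int n)\<^sup>2)\<^sup>2 * exp (- ((of_int m)\<^sup>2 + (of_int n)\<^sup>2))))
      has_sum ?K * sq_moment) (UNIV \<times> UNIV)"
    by (intro has_sum_cmult_right sq_moment_has_sum)
  ultimately have "2 * dtheta_full p t + - 2 * dtheta_full p 1 \<le> ?K * sq_moment"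
  proof (rule has_sum_mono)
    fix z :: "int \<times> int"
    obtain m n where z: "z = (m, n)" by (cases z)
    have "pair_diff p t ((of_int m)\<^sup>2) ((of_int n)\<^sup>2) \<le>
      ?K * (((of_int m)\<^sup>2 + (of_int n)\<^sup>2)\<^sup>2 * exp (- ((of_int m)\<^sup>2 + (of_int n)\<^sup>2)))"
    proof (cases "m = 0 \<and> n = 0")
      case False
      have "1 \<le> m\<^sup>2 + n\<^sup>2" by (rule sum_squares_int_cases[of m n]) (use False in auto)
      then have "1 \<le> (of_int m :: real)\<^sup>2 + (of_int n)\<^sup>2"
        by (metis of_int_1_le_iff of_int_add of_int_power)
      then show ?thesis using pair_diff_bound[OF p, of "(of_int m)\<^sup>2" "(of_int n)\<^sup>2" 1 t] t by simp
    qed (simp add: pair_diff_0)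
    then show "(case z of (m, n) \<Rightarrow> exp (- p * ((of_int m)\<^sup>2 * t + (of_int n)\<^sup>2 / t)) + exp (- p * ((of_int n)\<^sup>2 * t + (of_int m)\<^sup>2 / t)))
      + - 2 * (case z of (m, n) \<Rightarrow> exp (- p * ((of_int m)\<^sup>2 * 1 + (of_int n)\<^sup>2 / 1)))
      \<le> ?K * (case z of (m::int, n::int) \<Rightarrow> ((of_int m)\<^sup>2 + (of_int n)\<^sup>2)\<^sup>2 * exp (- ((of_int m)\<^sup>2 + (of_int n)\<^sup>2)))"
      unfolding z prod.case pair_diff_def by simp
  qed
  then show ?thesis by simp
qed

text \<open>For the nearest points \<open>pair_diff\<close> is positive by
  \<open>exp_pair_lower\<close>, and their charge turns it into a decrease of order exp(-q). All
  other nonzero points lie at squared distance at least 2, so \<open>pair_diff_bound\<close> with k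
  = 2 makes them of order exp(-2q(1 - \<eta>)).\<close>

lemma dtheta_alt_upper:
  assumes q: "5 \<le> q" "1 \<le> q * (1 - \<eta>)" and t: "1 \<le> t" "t \<le> 1 + \<eta>" and \<eta>: "\<eta> \<le> 1 / 4"
  shows "2 * (dtheta_alt q t - dtheta_alt q 1) \<le>
    (t - 1)\<^sup>2 * q\<^sup>2 * exp (- (q * (1 - \<eta>) - 1) * 2) * sq_moment - (t - 1)\<^sup>2 * (4 / 25 * q\<^sup>2 * exp (- q))"
proof -
  let ?K = "(t - 1)\<^sup>2 * q\<^sup>2 * exp (- (q * (1 - \<eta>) - 1) * 2)"
  let ?\<kappa> = "(t - 1)\<^sup>2 * (4 / 25 * q\<^sup>2 * exp (- q))"
  let ?f = "\<lambda>t. \<lambda>(m::int, n::int). (-1::real) powi (m + n) * exp (- q * ((of_int m)\<^sup>2 * t + (of_int n)\<^sup>2 / t))"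
  have t0: "t > 0" and q0: "q > 0" using t q by auto
  have "((\<lambda>z. (case z of (m, n) \<Rightarrow> ?f t (m, n) + ?f t (n, m)) + - 2 * ?f 1 z) has_sum
      (2 * dtheta_alt q t + - 2 * dtheta_alt q 1)) (UNIV \<times> UNIV)"
    unfolding dtheta_alt_def infsum_symmetrize(1)[OF dtheta_alt_summable[OF q0 t0]]
    by (intro has_sum_add has_sum_cmult_right has_sum_infsum dtheta_alt_summable q0
        infsum_symmetrize(2)[OF dtheta_alt_summable[OF q0 t0]]) auto
  \<comment> \<open>Only the point (1, 0) is credited with the decrease; the other three nearest
    points are bounded by the nonnegative majorant.\<close>
  moreover have "((\<lambda>z. ?K * (case z of (m::int, n::int) \<Rightarrow> ((of_int m)\<^sup>2 + (of_int n)\<^sup>2)\<^sup>2 * exp (- ((of_int m)\<^sup>2 + (of_int n)\<^sup>2)))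
      + (if z = (1, 0) then - ?\<kappa> else 0)) has_sum (?K * sq_moment + - ?\<kappa>)) (UNIV \<times> UNIV)"
    by (intro has_sum_add has_sum_cmult_right sq_moment_has_sum has_sum_finite_neutralI[of "{(1, 0)}"]) auto
  ultimately have "2 * dtheta_alt q t + - 2 * dtheta_alt q 1 \<le> ?K * sq_moment + - ?\<kappa>"
  proof (rule has_sum_mono)
    fix z :: "int \<times> int"
    obtain m n where z: "z = (m, n)" by (cases z)
    let ?a = "(of_int m)\<^sup>2 :: real" and ?b = "(of_int n)\<^sup>2 :: real"
    have eq: "(case z of (m, n) \<Rightarrow> ?f t (m, n) + ?f t (n, m)) + - 2 * ?f 1 z = (-1) powi (m + n) * pair_diff q t ?a ?b"
      unfolding z prod.case pair_diff_def by (simp add: algebra_simps add.commute[of n m])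
    have R: "0 \<le> ?K * ((?a + ?b)\<^sup>2 * exp (- (?a + ?b)))" by simp
    have "(-1) powi (m + n) * pair_diff q t ?a ?b \<le>
      ?K * ((?a + ?b)\<^sup>2 * exp (- (?a + ?b))) + (if (m, n) = (1, 0) then - ?\<kappa> else 0)"
    proof (rule sum_squares_int_cases[of m n])
      assume "m = 0" "n = 0"
      then show ?thesis by (simp add: pair_diff_0)
    next
      assume o: "odd (m + n)" and 1: "m\<^sup>2 = 1 \<and> n = 0 \<or> m = 0 \<and> n\<^sup>2 = 1"
      have "(?a = 1 \<and> ?b = 0) \<or> (?a = 0 \<and> ?b = 1)"
        using 1 by (metis of_int_0 of_int_1 of_int_power zero_power2)
      then have P: "pair_diff q t ?a ?b = exp (- (q * t)) + exp (- (q / t)) - 2 * exp (- q)"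
        by (auto simp: pair_diff_def)
      \<comment> \<open>4/25 is 4/5 times 1/5: \<open>t \<le> 5 / 4\<close> gives
        \<open>1 / t \<ge> 4 / 5\<close>, and \<open>q \<ge> 5\<close> gives
        \<open>2 * q / 5 - 1 \<ge> q / 5\<close>.\<close>
      have "4 / 25 * q\<^sup>2 \<le> q * (1 / t) * (q / (2 * t) - 1)"
      proof -
        have "4 / 5 \<le> 1 / t" using t \<eta> by (simp add: field_simps)
        moreover have "q / 5 \<le> q / (2 * t) - 1"
        proof -
          have "q * (2 / 5) \<le> q * (1 / (2 * t))" using t \<eta> q0 by (intro mult_left_mono) (simp_all add: field_simps)
          then show ?thesis using q by simp
        qed
        ultimately have "q * (4 / 5) * (q / 5) \<le> q * (1 / t) * (q / (2 * t) - 1)"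
          using q0 t by (intro mult_mono) auto
        then show ?thesis by (simp add: power2_eq_square)
      qed
      then have "(t - 1)\<^sup>2 * exp (- q) * (4 / 25 * q\<^sup>2) \<le> (t - 1)\<^sup>2 * exp (- q) * (q * (1 / t) * (q / (2 * t) - 1))"
        by (intro mult_left_mono) auto
      also have "\<dots> = exp (- q) * (q * ((t - 1)\<^sup>2 / t) * (q / (2 * t) - 1))" by simp
      also have "\<dots> \<le> pair_diff q t ?a ?b" unfolding P using q t by (intro exp_pair_lower) auto
      finally have "?\<kappa> \<le> pair_diff q t ?a ?b" by (simp add: mult_ac)
      moreover have "0 \<le> ?\<kappa>" by simp
      moreover have sgn: "(-1) powi (m + n) = (-1 :: real)" using o by (simp add: minus_one_powi_int)
      ultimately show ?thesis using R unfolding sgn mult_minus1 by (simp only: split: if_split) linarith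
    next
      assume "2 \<le> m\<^sup>2 + n\<^sup>2"
      then have 2: "2 \<le> ?a + ?b" and ne: "(m, n) \<noteq> (1, 0)"
        by (metis of_int_add of_int_le_iff of_int_numeral of_int_power, auto)
      have "\<bar>(-1) powi (m + n) * pair_diff q t ?a ?b\<bar> = \<bar>pair_diff q t ?a ?b\<bar>"
        by (simp add: abs_mult minus_one_powi_int)
      also have "\<dots> \<le> ?K * ((?a + ?b)\<^sup>2 * exp (- (?a + ?b)))"
        using 2 by (intro pair_diff_bound q0 q t) auto
      finally show ?thesis unfolding if_not_P[OF ne] by linarith
    qed
    then show "(case z of (m, n) \<Rightarrow> ?f t (m, n) + ?f t (n, m)) + - 2 * ?f 1 z \<le>
      ?K * (case z of (m::int, n::int) \<Rightarrow> ((of_int m)\<^sup>2 + (of_int n)\<^sup>2)\<^sup>2 * exp (- ((of_int m)\<^sup>2 + (of_int n)\<^sup>2)))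
      + (if z = (1, 0) then - ?\<kappa> else 0)"
      unfolding eq unfolding z prod.case .
  qed
  then show ?thesis by simp
qed

text \<open>After the common factor \<open>(t - 1)\<^sup>2 * q\<^sup>2 * exp (- q)\<close> is taken
  out, the full product and the outer shells carry exponentially small coefficients as V grows, and
  -4/25 from the nearest points prevails.\<close>

lemma energy_strict_local_max:
  fixes \<alpha> \<beta> :: real
  assumes ab: "0 < \<alpha>" "\<alpha> < \<beta>"
  shows "\<exists>V1>0. \<exists>\<eta>>0. \<forall>V>V1. \<forall>t. 1 < t \<and> t \<le> 1 + \<eta> \<longrightarrow>
    dtheta_full (pi * \<beta> * V) t + dtheta_alt (pi * \<alpha> * V) t < dtheta_full (pi * \<beta> * V) 1 + dtheta_alt (pi * \<alpha> * V) 1"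
proof -
  \<comment> \<open>1/4 is the range of \<open>dtheta_alt_upper\<close>; the other bound ensures
    \<open>\<beta> * (1 - \<eta>) \<ge> (\<alpha> + \<beta>) / 2 > \<alpha>\<close>.\<close>
  define \<eta> where "\<eta> = min (1 / 4) ((1 - \<alpha> / \<beta>) / 2)"
  have \<eta>: "0 < \<eta>" "\<eta> \<le> 1 / 4" "\<eta> \<le> (1 - \<alpha> / \<beta>) / 2"
  proof -
    show "0 < \<eta>" using ab by (simp add: \<eta>_def)
    show "\<eta> \<le> 1 / 4" unfolding \<eta>_def by (rule min.cobounded1)
    show "\<eta> \<le> (1 - \<alpha> / \<beta>) / 2" unfolding \<eta>_def by (rule min.cobounded2)
  qed
  have "\<beta> * \<eta> \<le> \<beta> * ((1 - \<alpha> / \<beta>) / 2)" using ab \<eta>(3) by (intro mult_left_mono) auto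
  also have "\<dots> = (\<beta> - \<alpha>) / 2" using ab by (simp add: field_simps)
  finally have gap: "\<alpha> < \<beta> * (1 - \<eta>)" using ab by (simp add: right_diff_distrib)
  \<comment> \<open>\<kappa> and \<mu> are the decay rates in V, relative to exp(-q), of the full
    product and of the outer shells of the alternating one.\<close>
  define \<kappa> where "\<kappa> = pi * (\<beta> * (1 - \<eta>) - \<alpha>)"
  define \<mu> where "\<mu> = pi * \<alpha> * (1 - 2 * \<eta>)"
  have pos: "0 < \<kappa>" "0 < \<mu>" using gap ab \<eta> by (auto simp: \<kappa>_def \<mu>_def)
  have "((\<lambda>V. exp (1 - \<kappa> * V)) \<longlongrightarrow> 0) at_top" "((\<lambda>V. exp (2 - \<mu> * V)) \<longlongrightarrow> 0) at_top"
    using pos by real_asymp+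
  then have "((\<lambda>V. ((\<beta> / \<alpha>)\<^sup>2 * exp (1 - \<kappa> * V) + exp (2 - \<mu> * V)) * sq_moment) \<longlongrightarrow>
      ((\<beta> / \<alpha>)\<^sup>2 * 0 + 0) * sq_moment) at_top"
    by (intro tendsto_intros)
  then have "\<forall>\<^sub>F V in at_top. ((\<beta> / \<alpha>)\<^sup>2 * exp (1 - \<kappa> * V) + exp (2 - \<mu> * V)) * sq_moment < 4 / 25"
    by (rule order_tendstoD(2)) simp
  moreover have "\<forall>\<^sub>F V in at_top. 5 \<le> pi * \<alpha> * (1 - \<eta>) * V"
  proof -
    have "0 < pi * \<alpha> * (1 - \<eta>)" using ab \<eta> by simp
    then show ?thesis by real_asymp
  qed
  ultimately have "\<forall>\<^sub>F V in at_top. ((\<beta> / \<alpha>)\<^sup>2 * exp (1 - \<kappa> * V) + exp (2 - \<mu> * V)) * sq_moment < 4 / 25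
      \<and> 5 \<le> pi * \<alpha> * (1 - \<eta>) * V"
    by (rule eventually_conj)
  then obtain V0 where V0: "\<And>V. V \<ge> V0 \<Longrightarrow> ((\<beta> / \<alpha>)\<^sup>2 * exp (1 - \<kappa> * V) + exp (2 - \<mu> * V)) * sq_moment < 4 / 25
      \<and> 5 \<le> pi * \<alpha> * (1 - \<eta>) * V"
    unfolding eventually_at_top_linorder by blast
  show ?thesis
  proof (intro exI conjI allI impI)
    show "0 < max V0 1" by simp
    show "0 < \<eta>" by (rule \<eta>(1))
    fix V t :: real assume V: "V > max V0 1" and "1 < t \<and> t \<le> 1 + \<eta>"
    then have t: "1 < t" "t \<le> 1 + \<eta>" by auto
    define p where "p = pi * \<beta> * V"
    define q where "q = pi * \<alpha> * V"
    have small: "((\<beta> / \<alpha>)\<^sup>2 * exp (1 - \<kappa> * V) + exp (2 - \<mu> * V)) * sq_moment < 4 / 25"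
      and q5: "5 \<le> q * (1 - \<eta>)"
      using V0[of V] V by (auto simp: q_def mult_ac)
    have pq: "0 < q" "q < p" using ab V by (auto simp: p_def q_def)
    have "q * (1 - \<eta>) \<le> q * 1" using pq \<eta> by (intro mult_left_mono) auto
    then have "5 \<le> q" using q5 by simp
    have "q * (1 - \<eta>) \<le> p * (1 - \<eta>)" using pq \<eta> by (intro mult_right_mono) auto
    then have p1: "1 \<le> p * (1 - \<eta>)" using q5 by simp
    have "2 * (dtheta_full p t - dtheta_full p 1) + 2 * (dtheta_alt q t - dtheta_alt q 1) \<le>
       (t - 1)\<^sup>2 * p\<^sup>2 * exp (- (p * (1 - \<eta>) - 1)) * sq_moment +
       ((t - 1)\<^sup>2 * q\<^sup>2 * exp (- (q * (1 - \<eta>) - 1) * 2) * sq_moment - (t - 1)\<^sup>2 * (4 / 25 * q\<^sup>2 * exp (- q)))"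
      using pq p1 q5 t \<eta> \<open>5 \<le> q\<close> by (intro add_mono dtheta_full_upper dtheta_alt_upper) auto
    also have "\<dots> = (t - 1)\<^sup>2 * q\<^sup>2 * exp (- q) * (((\<beta> / \<alpha>)\<^sup>2 * exp (1 - \<kappa> * V) + exp (2 - \<mu> * V)) * sq_moment - 4 / 25)"
    proof -
      have "p\<^sup>2 = q\<^sup>2 * (\<beta> / \<alpha>)\<^sup>2" using ab by (simp add: p_def q_def power_mult_distrib power_divide)
      moreover have "exp (- (p * (1 - \<eta>) - 1)) = exp (- q) * exp (1 - \<kappa> * V)"
        by (simp add: exp_add[symmetric] p_def q_def \<kappa>_def algebra_simps)
      moreover have "exp (- (q * (1 - \<eta>) - 1) * 2) = exp (- q) * exp (2 - \<mu> * V)"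
        by (simp add: exp_add[symmetric] q_def \<mu>_def algebra_simps)
      ultimately show ?thesis by (simp only:) (simp add: algebra_simps)
    qed
    also have "\<dots> < 0" using small t pq by (intro mult_pos_neg) auto
    finally show "dtheta_full (pi * \<beta> * V) t + dtheta_alt (pi * \<alpha> * V) t < dtheta_full (pi * \<beta> * V) 1 + dtheta_alt (pi * \<alpha> * V) 1"
      unfolding p_def q_def by simp
  qed
qed

section \<open>Energies of rectangular lattices\<close>

lemma lattice_bij:
  fixes u v :: "real^2"
  assumes "u \<noteq> 0" "v \<noteq> 0" "orthogonal u v"
  shows "bij_betw (\<lambda>(m, n). of_int m *\<^sub>R u + of_int n *\<^sub>R v) (UNIV - {(0 :: int, 0 :: int)}) (lattice_of u v - {0})"
proof -
  have inj: "m = m' \<and> n = n'"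
    if "of_int m *\<^sub>R u + of_int n *\<^sub>R v = of_int m' *\<^sub>R u + of_int n' *\<^sub>R v" for m n m' n' :: int
    using orth_coeffs_unique[OF assms that] by simp
  have zero: "of_int m *\<^sub>R u + of_int n *\<^sub>R v = 0 \<longleftrightarrow> m = 0 \<and> n = 0" for m n :: int
    using inj[of m n 0 0] by auto
  show ?thesis
    unfolding bij_betw_def lattice_of_def
  proof
    show "inj_on (\<lambda>(m, n). of_int m *\<^sub>R u + of_int n *\<^sub>R v) (UNIV - {(0 :: int, 0 :: int)})"
      using inj by (auto simp: inj_on_def)
    show "(\<lambda>(m, n). of_int m *\<^sub>R u + of_int n *\<^sub>R v) ` (UNIV - {(0 :: int, 0 :: int)}) =
      {of_int m *\<^sub>R u + of_int n *\<^sub>R v |m n. True} - {0}"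
      using zero by (auto simp: image_iff)
  qed
qed

lemma norm_lattice_point:
  fixes u v :: "real^2"
  assumes "orthogonal u v"
  shows "(norm (a *\<^sub>R u + b *\<^sub>R v))\<^sup>2 = a\<^sup>2 * (norm u)\<^sup>2 + b\<^sup>2 * (norm v)\<^sup>2"
  using assms unfolding power2_norm_eq_inner orthogonal_def
  by (simp add: inner_add_left inner_add_right inner_commute power2_eq_square)

lemma infsum_remove_zero:
  fixes f :: "int \<times> int \<Rightarrow> real"
  assumes "f summable_on UNIV \<times> UNIV"
  shows "infsum f (UNIV - {(0, 0)}) = infsum f (UNIV \<times> UNIV) - f (0, 0)"
proof -
  have "f summable_on UNIV - {(0, 0)}" by (rule summable_on_subset[OF assms]) auto
  then have "infsum f (insert (0, 0) (UNIV - {(0, 0)})) = f (0, 0) + infsum f (UNIV - {(0, 0)})"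
    by (intro infsum_insert) auto
  moreover have "insert (0, 0) (UNIV - {(0, 0)}) = (UNIV \<times> UNIV :: (int \<times> int) set)" by auto
  ultimately show ?thesis by simp
qed

text \<open>The energy sees the basis only through V and the length ratio t. Each -1 removes the
  origin, which the energy omits.\<close>

lemma alt_energy_lattice_of:
  fixes u v :: "real^2"
  assumes uv: "u \<noteq> 0" "v \<noteq> 0" "orthogonal u v" and pos: "\<alpha> > 0" "\<beta> > 0" "V > 0" "t > 0"
    and norms: "(norm u)\<^sup>2 = V * t" "(norm v)\<^sup>2 = V / t"
  shows "alt_energy (gauss \<beta>) (\<lambda>r. \<epsilon> * gauss \<alpha> r) (lattice_of u v) =
    dtheta_full (pi * \<beta> * V) t - 1 + \<epsilon> * (dtheta_alt (pi * \<alpha> * V) t - 1)"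
proof -
  let ?h = "\<lambda>(m :: int, n :: int). of_int m *\<^sub>R u + of_int n *\<^sub>R v"
  have g: "gauss c ((norm (of_int m *\<^sub>R u + of_int n *\<^sub>R v))\<^sup>2) =
      exp (- (pi * c * V) * ((of_int m)\<^sup>2 * t + (of_int n)\<^sup>2 / t))" for c and m n :: int
    unfolding norm_lattice_point[OF uv(3)] norms gauss_def by (simp add: algebra_simps)
  have basis: "orth_basis (lattice_of u v) u v" using uv by (simp add: orth_basis_def)
  have "(\<Sum>\<^sub>\<infinity>p\<in>lattice_of u v - {0}. gauss \<beta> ((norm p)\<^sup>2)) =
    (\<Sum>\<^sub>\<infinity>z\<in>UNIV - {(0, 0)}. gauss \<beta> ((norm (?h z))\<^sup>2))"
    by (rule infsum_reindex_bij_betw[OF lattice_bij[OF uv], symmetric])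
  also have "\<dots> = (\<Sum>\<^sub>\<infinity>(m, n)\<in>UNIV - {(0, 0)}. exp (- (pi * \<beta> * V) * ((of_int m)\<^sup>2 * t + (of_int n)\<^sup>2 / t)))"
    by (intro infsum_cong) (auto simp: g)
  also have "\<dots> = dtheta_full (pi * \<beta> * V) t - 1"
    using full.dtheta_summable[of "pi * \<beta> * V" t] pos
    by (subst infsum_remove_zero) (simp_all add: full.dtheta_def)
  finally have 1: "(\<Sum>\<^sub>\<infinity>p\<in>lattice_of u v - {0}. gauss \<beta> ((norm p)\<^sup>2)) = dtheta_full (pi * \<beta> * V) t - 1" .
  have "(\<Sum>\<^sub>\<infinity>p\<in>lattice_of u v - {0}. alt_charge (lattice_of u v) p * (\<epsilon> * gauss \<alpha> ((norm p)\<^sup>2))) =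
    (\<Sum>\<^sub>\<infinity>z\<in>UNIV - {(0, 0)}. alt_charge (lattice_of u v) (?h z) * (\<epsilon> * gauss \<alpha> ((norm (?h z))\<^sup>2)))"
    by (rule infsum_reindex_bij_betw[OF lattice_bij[OF uv], symmetric])
  also have "\<dots> = (\<Sum>\<^sub>\<infinity>z\<in>UNIV - {(0, 0)}. \<epsilon> * (case z of (m, n) \<Rightarrow>
      (-1) powi (m + n) * exp (- (pi * \<alpha> * V) * ((of_int m)\<^sup>2 * t + (of_int n)\<^sup>2 / t))))"
    by (intro infsum_cong) (auto simp: g alt_charge_eq[OF basis])
  also have "\<dots> = \<epsilon> * (\<Sum>\<^sub>\<infinity>(m, n)\<in>UNIV - {(0, 0)}.
      (-1) powi (m + n) * exp (- (pi * \<alpha> * V) * ((of_int m)\<^sup>2 * t + (of_int n)\<^sup>2 / t)))"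
    by (rule infsum_cmult_right')
  also have "\<dots> = \<epsilon> * (dtheta_alt (pi * \<alpha> * V) t - 1)"
    using dtheta_alt_summable[of "pi * \<alpha> * V" t] pos
    by (subst infsum_remove_zero) (simp_all add: dtheta_alt_def)
  finally show ?thesis unfolding alt_energy_def 1 by simp
qed

text \<open>Lagrange's identity turns orthogonality and the determinant into
  \<open>norm u * norm v = V\<close>; then t is the ratio of the lengths.\<close>

lemma rect_latticeE:
  assumes "M \<in> rect_lattices V" "V > 0"
  obtains u v t where "M = lattice_of u v" "u \<noteq> 0" "v \<noteq> 0" "orthogonal u v" "t > 0"
    "(norm u)\<^sup>2 = V * t" "(norm v)\<^sup>2 = V / t"
proof -
  obtain u v :: "real^2" where M: "M = lattice_of u v" "orthogonal u v"
      "\<bar>det (vector [u, v] :: real^2^2)\<bar> = V"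
    using assms(1) unfolding rect_lattices_def by blast
  have "(det (vector [u, v] :: real^2^2))\<^sup>2 + (u \<bullet> v)\<^sup>2 = (norm u)\<^sup>2 * (norm v)\<^sup>2"
    unfolding power2_norm_eq_inner
    by (simp add: det_2 inner_vec_def sum_2 power2_eq_square algebra_simps)
  then have "(norm u * norm v)\<^sup>2 = V\<^sup>2"
    using M by (simp add: orthogonal_def power_mult_distrib) (metis power2_abs)
  then have V: "norm u * norm v = V" using assms(2) by (simp add: power2_eq_iff_nonneg)
  then have nz: "u \<noteq> 0" "v \<noteq> 0" using assms(2) by auto
  show thesis
  proof (rule that[OF M(1) nz M(2), of "norm u / norm v"])
    show "(norm u)\<^sup>2 = V * (norm u / norm v)" "(norm v)\<^sup>2 = V / (norm u / norm v)"
      using nz unfolding V[symmetric] by (simp_all add: power2_eq_square)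
  qed (use nz in simp)
qed

text \<open>The linear map sending the scaled unit vectors to u and v preserves norms. It maps the
  square lattice onto the given one, so the required isometry is its inverse.\<close>

lemma orthogonal_square_isometric:
  fixes u v :: "real^2"
  assumes "orthogonal u v" "V > 0" "(norm u)\<^sup>2 = V" "(norm v)\<^sup>2 = V"
  shows "isometric_lattices (lattice_of u v) (scale_lattice (sqrt V) square_lattice)"
proof -
  define e1 :: "real^2" where "e1 = vector [1, 0]"
  define e2 :: "real^2" where "e2 = vector [0, 1]"
  define g where "g = (\<lambda>x :: real^2. (x $ 1 / sqrt V) *\<^sub>R u + (x $ 2 / sqrt V) *\<^sub>R v)"
  have "linear g"
    unfolding g_def by (intro linearI) (simp_all add: algebra_simps add_divide_distrib)
  moreover have "norm (g x) = norm x" for x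
  proof -
    have "(norm (g x))\<^sup>2 = (x $ 1)\<^sup>2 + (x $ 2)\<^sup>2"
      unfolding g_def norm_lattice_point[OF assms(1)] assms(3,4) using assms(2) by (simp add: power_divide)
    also have "\<dots> = (norm x)\<^sup>2"
      unfolding power2_norm_eq_inner by (simp add: inner_vec_def sum_2 power2_eq_square)
    finally show ?thesis by simp
  qed
  ultimately have g: "orthogonal_transformation g" by (simp add: orthogonal_transformation)
  have ge: "g (sqrt V *\<^sub>R e1) = u" "g (sqrt V *\<^sub>R e2) = v"
    using assms(2) by (simp_all add: g_def e1_def e2_def)
  have "scale_lattice (sqrt V) square_lattice = lattice_of (sqrt V *\<^sub>R e1) (sqrt V *\<^sub>R e2)"
    unfolding rect_lattice_1[symmetric] rect_lattice_def scale_lattice_of e1_def e2_def by simp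
  moreover have "g ` lattice_of (sqrt V *\<^sub>R e1) (sqrt V *\<^sub>R e2) = lattice_of u v"
  proof -
    have "g (of_int m *\<^sub>R (sqrt V *\<^sub>R e1) + of_int n *\<^sub>R (sqrt V *\<^sub>R e2)) = of_int m *\<^sub>R u + of_int n *\<^sub>R v" for m n :: int
      using \<open>linear g\<close> by (simp only: linear_add linear_scale[of g "of_int m"] linear_scale[of g "of_int n"] ge)
    then show ?thesis unfolding lattice_of_def by (auto simp: image_iff) metis+
  qed
  ultimately have im: "g ` scale_lattice (sqrt V) square_lattice = lattice_of u v" by simp
  have "inv g ` lattice_of u v = scale_lattice (sqrt V) square_lattice"
    unfolding im[symmetric] using orthogonal_transformation_inj[OF g] by (simp add: image_image)
  then show ?thesis
    unfolding isometric_lattices_def using orthogonal_transformation_inv[OF g] by blast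
qed

lemma scaled_rect_lattice_energy:
  assumes "\<alpha> > 0" "\<beta> > 0" "V > 0" "y > 0"
  shows "alt_energy (gauss \<beta>) (\<lambda>r. \<epsilon> * gauss \<alpha> r) (scale_lattice (sqrt V) (rect_lattice y)) =
    dtheta_full (pi * \<beta> * V) (y\<^sup>2) - 1 + \<epsilon> * (dtheta_alt (pi * \<alpha> * V) (y\<^sup>2) - 1)"
  unfolding rect_lattice_def scale_lattice_of
proof (rule alt_energy_lattice_of)
  let ?u = "sqrt V *\<^sub>R vector [y, 0] :: real^2" and ?v = "sqrt V *\<^sub>R vector [0, inverse y] :: real^2"
  show "(norm ?u)\<^sup>2 = V * y\<^sup>2" "(norm ?v)\<^sup>2 = V / y\<^sup>2"
    unfolding power2_norm_eq_inner using assms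
    by (simp_all add: inner_vec_def sum_2 power2_eq_square field_simps)
  then show "?u \<noteq> 0" "?v \<noteq> 0" using assms by auto
  show "orthogonal ?u ?v" by (simp add: orthogonal_def inner_vec_def sum_2)
qed (use assms in auto)

text \<open>Exchanging the basis vectors replaces t by 1 / t, so \<open>t > 1\<close> covers all
  non-square lattices. Equality of energies forces t = 1, that is, basis vectors of equal length,
  and the lattice is then isometric to the square one.\<close>

lemma square_unique_minimizer:
  assumes pos: "\<alpha> > 0" "\<beta> > 0" "V > 0"
    and less: "\<And>t. t > 1 \<Longrightarrow> dtheta_full (pi * \<beta> * V) 1 + \<epsilon> * dtheta_alt (pi * \<alpha> * V) 1 <
      dtheta_full (pi * \<beta> * V) t + \<epsilon> * dtheta_alt (pi * \<alpha> * V) t"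
  shows "unique_minimizer_in (alt_energy (gauss \<beta>) (\<lambda>r. \<epsilon> * gauss \<alpha> r)) (rect_lattices V)
    (scale_lattice (sqrt V) square_lattice)"
proof -
  let ?E = "alt_energy (gauss \<beta>) (\<lambda>r. \<epsilon> * gauss \<alpha> r)"
  let ?S = "scale_lattice (sqrt V) square_lattice"
  have cmp: "?E ?S < ?E M \<or> ?E M = ?E ?S \<and> isometric_lattices M ?S" if "M \<in> rect_lattices V" for M
  proof -
    obtain u v t where M: "M = lattice_of u v" "u \<noteq> 0" "v \<noteq> 0" "orthogonal u v" "t > 0"
        "(norm u)\<^sup>2 = V * t" "(norm v)\<^sup>2 = V / t"
      using rect_latticeE[OF \<open>M \<in> rect_lattices V\<close> pos(3)] .
    have EM: "?E M = dtheta_full (pi * \<beta> * V) t - 1 + \<epsilon> * (dtheta_alt (pi * \<alpha> * V) t - 1)"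
      unfolding M(1) by (rule alt_energy_lattice_of) (use M pos in auto)
    have ES: "?E ?S = dtheta_full (pi * \<beta> * V) 1 - 1 + \<epsilon> * (dtheta_alt (pi * \<alpha> * V) 1 - 1)"
      using scaled_rect_lattice_energy[OF pos, of 1 \<epsilon>] by (simp add: rect_lattice_1)
    have inv: "dtheta_full (pi * \<beta> * V) (1 / t) = dtheta_full (pi * \<beta> * V) t"
      "dtheta_alt (pi * \<alpha> * V) (1 / t) = dtheta_alt (pi * \<alpha> * V) t"
      using pos M(5) by (auto intro!: full.dtheta_inverse dtheta_alt_inverse)
    consider "t = 1" | "t > 1" | "1 / t > 1" using M(5) by (cases "t = 1"; cases "t > 1") auto
    then show ?thesis
    proof cases
      case 1
      then have "isometric_lattices M ?S"
        unfolding M(1) using M pos by (intro orthogonal_square_isometric) auto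
      then show ?thesis using EM ES 1 by simp
    next
      case 2
      from less[OF this] show ?thesis unfolding EM ES right_diff_distrib by linarith
    next
      case 3
      from less[OF this] show ?thesis unfolding EM ES right_diff_distrib inv by linarith
    qed
  qed
  have S: "?S \<in> rect_lattices V" using pos(3) by (rule scaled_square_lattice_in)
  show ?thesis
    unfolding unique_minimizer_in_def minimizer_in_def is_arg_min_def
  proof (intro conjI allI impI)
    show "\<nexists>M. M \<in> rect_lattices V \<and> ?E M < ?E ?S" using cmp by (metis less_asym less_irrefl)
    fix M assume "M \<in> rect_lattices V \<and> (\<nexists>y. y \<in> rect_lattices V \<and> ?E y < ?E M)"
    then show "isometric_lattices M ?S" using cmp S by blast
  qed (rule S)
qed

theorem theorem2p6:
  "(\<forall>\<alpha> \<beta> :: real. 0 < \<alpha> \<and> \<alpha> < \<beta> \<longrightarrow>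
      (\<exists>V1 > 0. \<forall>V > V1.
         \<not> minimizer_in (alt_energy (gauss \<beta>) (gauss \<alpha>)) (rect_lattices V)
             (scale_lattice (sqrt V) square_lattice) \<and>
         square_local_maximizer (alt_energy (gauss \<beta>) (gauss \<alpha>)) V))
   \<and>
   (\<forall>\<beta> V :: real. 0 < \<beta> \<and> 0 < V \<longrightarrow>
      (\<exists>\<alpha>0 > 0. \<forall>\<alpha>. 0 < \<alpha> \<and> \<alpha> < \<beta> \<and> \<alpha> < \<alpha>0 \<longrightarrow>
         unique_minimizer_in (alt_energy (gauss \<beta>) (gauss \<alpha>)) (rect_lattices V)
           (scale_lattice (sqrt V) square_lattice)))
   \<and>
   (\<forall>\<alpha> \<beta> V :: real. 0 < \<alpha> \<and> \<alpha> < \<beta> \<and> 0 < V \<longrightarrow>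
      (\<exists>\<epsilon>0 > 0. \<forall>\<epsilon>. 0 \<le> \<epsilon> \<and> \<epsilon> < \<epsilon>0 \<longrightarrow>
         unique_minimizer_in (alt_energy (gauss \<beta>) (\<lambda>r. \<epsilon> * gauss \<alpha> r)) (rect_lattices V)
           (scale_lattice (sqrt V) square_lattice)))"
proof (intro conjI allI impI)
  fix \<alpha> \<beta> :: real assume "0 < \<alpha> \<and> \<alpha> < \<beta>"
  then have ab: "0 < \<alpha>" "\<alpha> < \<beta>" "0 < \<beta>" by auto
  obtain V1 \<eta> where V1: "V1 > 0" "\<eta> > 0" and less: "\<And>V t. V1 < V \<Longrightarrow> 1 < t \<Longrightarrow> t \<le> 1 + \<eta> \<Longrightarrow>
    dtheta_full (pi * \<beta> * V) t + dtheta_alt (pi * \<alpha> * V) t < dtheta_full (pi * \<beta> * V) 1 + dtheta_alt (pi * \<alpha> * V) 1"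
    using energy_strict_local_max[OF ab(1,2)] by blast
  show "\<exists>V1>0. \<forall>V>V1.
      \<not> minimizer_in (alt_energy (gauss \<beta>) (gauss \<alpha>)) (rect_lattices V) (scale_lattice (sqrt V) square_lattice) \<and>
      square_local_maximizer (alt_energy (gauss \<beta>) (gauss \<alpha>)) V"
  proof (intro exI[of _ V1] conjI allI impI)
    fix V assume V: "V1 < V"
    let ?E = "alt_energy (gauss \<beta>) (gauss \<alpha>)"
    let ?L = "\<lambda>y. scale_lattice (sqrt V) (rect_lattice y)"
    have V0: "V > 0" using V V1 by simp
    have E: "?E (?L y) = dtheta_full (pi * \<beta> * V) (y\<^sup>2) + dtheta_alt (pi * \<alpha> * V) (y\<^sup>2) - 2" if "y > 0" for y
      using scaled_rect_lattice_energy[OF ab(1,3) V0 that, of 1] by simp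
    have up: "?E (?L y) < ?E (?L 1)" if "1 < y" "y\<^sup>2 \<le> 1 + \<eta>" for y
      using less[OF V, of "y\<^sup>2"] that by (simp add: E one_less_power)
    have down: "?E (?L y) < ?E (?L 1)" if "0 < y" "y < 1" "(1 / y)\<^sup>2 \<le> 1 + \<eta>" for y
    proof -
      have "?E (?L y) = ?E (?L (1 / y))"
        using that ab V0 full.dtheta_inverse[of "pi * \<beta> * V" "y\<^sup>2"] dtheta_alt_inverse[of "pi * \<alpha> * V" "y\<^sup>2"]
        by (simp add: E power_divide)
      then show ?thesis using up[of "1 / y"] that by simp
    qed
    have "((\<lambda>y. y\<^sup>2) \<longlongrightarrow> 1\<^sup>2) (at (1::real) within {0<..})" "((\<lambda>y. (1 / y)\<^sup>2) \<longlongrightarrow> (1 / 1)\<^sup>2) (at (1::real) within {0<..})"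
      by (intro tendsto_intros; simp)+
    from this[THEN order_tendstoD(2), of "1 + \<eta>"] V1
    have ev: "\<forall>\<^sub>F y in at 1 within {0<..}. y\<^sup>2 < 1 + \<eta>" "\<forall>\<^sub>F y in at 1 within {0<..}. (1 / y)\<^sup>2 < 1 + \<eta>" by auto
    show "square_local_maximizer ?E V"
      unfolding square_local_maximizer_def
    proof -
      have pos: "\<forall>\<^sub>F y in at (1::real) within {0<..}. 0 < y" by (auto simp: eventually_at_filter)
      from ev pos show "\<forall>\<^sub>F y in at 1 within {0<..}. ?E (?L y) \<le> ?E (?L 1)"
      proof eventually_elim
        case (elim y)
        then show ?case using up[of y] down[of y] by (cases y "1 :: real" rule: linorder_cases) auto
      qed
    qed
    show "\<not> minimizer_in ?E (rect_lattices V) (scale_lattice (sqrt V) square_lattice)"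
    proof
      assume "minimizer_in ?E (rect_lattices V) (scale_lattice (sqrt V) square_lattice)"
      then have min: "\<not> ?E M < ?E (?L 1)" if "M \<in> rect_lattices V" for M
        using that unfolding minimizer_in_def is_arg_min_def rect_lattice_1 by blast
      \<comment> \<open>A competitor in the family with \<open>t = 1 + \<eta>\<close>, the far end
        of the interval of strict decrease.\<close>
      have "?E (?L (sqrt (1 + \<eta>))) < ?E (?L 1)" using V1 by (intro up) auto
      then show False using min scaled_rect_lattice_in[OF V0, of "sqrt (1 + \<eta>)"] V1 by auto
    qed
  qed (rule V1)
next
  fix \<beta> V :: real assume "0 < \<beta> \<and> 0 < V"
  then have pos: "0 < \<beta>" "0 < V" by auto
  have "0 < pi * \<beta> * V" using pos by simp
  then obtain c where c: "c > 0" "\<And>t. 1 \<le> t \<Longrightarrow> dtheta_full (pi * \<beta> * V) 1 + c * min 1 ((t - 1)\<^sup>2 / t) \<le> dtheta_full (pi * \<beta> * V) t"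
    using dtheta_gap by blast
  obtain q0 where q0: "q0 > 0" "\<And>q. 0 < q \<Longrightarrow> q < q0 \<Longrightarrow> alt_drop q < c"
    using alt_drop_small[OF c(1)] by blast
  show "\<exists>\<alpha>0>0. \<forall>\<alpha>. 0 < \<alpha> \<and> \<alpha> < \<beta> \<and> \<alpha> < \<alpha>0 \<longrightarrow>
      unique_minimizer_in (alt_energy (gauss \<beta>) (gauss \<alpha>)) (rect_lattices V) (scale_lattice (sqrt V) square_lattice)"
  \<comment> \<open>The condition \<open>\<alpha> < q0 / (pi * V)\<close> says that
    \<open>q = pi * \<alpha> * V\<close> lies below \<open>q0\<close>, where the drop is smaller
    than the gap.\<close>
  proof (intro exI[of _ "q0 / (pi * V)"] conjI allI impI)
    show "0 < q0 / (pi * V)" using q0 pos by simp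
    fix \<alpha> assume "0 < \<alpha> \<and> \<alpha> < \<beta> \<and> \<alpha> < q0 / (pi * V)"
    then have a: "0 < \<alpha>" "pi * \<alpha> * V < q0" using pos by (auto simp: field_simps)
    have q: "0 < pi * \<alpha> * V" using a pos by simp
    have "unique_minimizer_in (alt_energy (gauss \<beta>) (\<lambda>r. 1 * gauss \<alpha> r)) (rect_lattices V)
      (scale_lattice (sqrt V) square_lattice)"
    proof (rule square_unique_minimizer[OF a(1) pos])
      fix t :: real assume t: "t > 1"
      have "alt_drop (pi * \<alpha> * V) * min 1 ((t - 1)\<^sup>2 / t) < c * min 1 ((t - 1)\<^sup>2 / t)"
        using q0(2)[OF q a(2)] t by (intro mult_strict_right_mono) auto
      then show "dtheta_full (pi * \<beta> * V) 1 + 1 * dtheta_alt (pi * \<alpha> * V) 1 <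
        dtheta_full (pi * \<beta> * V) t + 1 * dtheta_alt (pi * \<alpha> * V) t"
        using c(2)[of t] dtheta_alt_lower[OF q, of t] t by linarith
    qed
    then show "unique_minimizer_in (alt_energy (gauss \<beta>) (gauss \<alpha>)) (rect_lattices V)
      (scale_lattice (sqrt V) square_lattice)" by simp
  qed
next
  fix \<alpha> \<beta> V :: real assume "0 < \<alpha> \<and> \<alpha> < \<beta> \<and> 0 < V"
  then have pos: "0 < \<alpha>" "0 < \<beta>" "0 < V" by auto
  define q where "q = pi * \<alpha> * V"
  have q: "0 < q" and "0 < pi * \<beta> * V" using pos by (simp_all add: q_def)
  then obtain c where c: "c > 0" "\<And>t. 1 \<le> t \<Longrightarrow> dtheta_full (pi * \<beta> * V) 1 + c * min 1 ((t - 1)\<^sup>2 / t) \<le> dtheta_full (pi * \<beta> * V) t"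
    using dtheta_gap by blast
  have d: "0 \<le> alt_drop q" by (rule alt_drop_nonneg[OF q])
  show "\<exists>\<epsilon>0>0. \<forall>\<epsilon>. 0 \<le> \<epsilon> \<and> \<epsilon> < \<epsilon>0 \<longrightarrow>
      unique_minimizer_in (alt_energy (gauss \<beta>) (\<lambda>r. \<epsilon> * gauss \<alpha> r)) (rect_lattices V) (scale_lattice (sqrt V) square_lattice)"
  \<comment> \<open>The summand 1 keeps the denominator positive; the bound still gives
    \<open>\<epsilon> * alt_drop q < c\<close>.\<close>
  proof (intro exI[of _ "c / (alt_drop q + 1)"] conjI allI impI)
    show "0 < c / (alt_drop q + 1)" using c d by simp
    fix \<epsilon> assume "0 \<le> \<epsilon> \<and> \<epsilon> < c / (alt_drop q + 1)"
    then have "0 \<le> \<epsilon>" "\<epsilon> * (alt_drop q + 1) < c" using d by (auto simp: pos_less_divide_eq)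
    then have \<epsilon>: "0 \<le> \<epsilon>" "\<epsilon> * alt_drop q < c" by (auto simp: distrib_left)
    show "unique_minimizer_in (alt_energy (gauss \<beta>) (\<lambda>r. \<epsilon> * gauss \<alpha> r)) (rect_lattices V)
      (scale_lattice (sqrt V) square_lattice)"
    proof (rule square_unique_minimizer[OF pos])
      fix t :: real assume t: "t > 1"
      define D where "D = min 1 ((t - 1)\<^sup>2 / t)"
      have D: "0 < D" using t by (simp add: D_def)
      have "\<epsilon> * (dtheta_alt q 1 - alt_drop q * D) \<le> \<epsilon> * dtheta_alt q t"
        using dtheta_alt_lower[OF q, of t] t \<epsilon> by (intro mult_left_mono) (auto simp: D_def)
      then have "\<epsilon> * dtheta_alt q 1 - (\<epsilon> * alt_drop q) * D \<le> \<epsilon> * dtheta_alt q t"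
        by (simp add: right_diff_distrib)
      moreover have "(\<epsilon> * alt_drop q) * D < c * D" using \<epsilon> D by (intro mult_strict_right_mono)
      ultimately show "dtheta_full (pi * \<beta> * V) 1 + \<epsilon> * dtheta_alt (pi * \<alpha> * V) 1 <
        dtheta_full (pi * \<beta> * V) t + \<epsilon> * dtheta_alt (pi * \<alpha> * V) t"
        using c(2)[of t] t unfolding q_def[symmetric] D_def[symmetric] by linarith
    qed
  qed
qed

end
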